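(* Suppose $F$ is an extender and $E\in M_F$ is an $M_F$-extender, and suppose that $j_F(j_F)(E)$ and $j_F(E)$ commute in $M_{F^2}$. Then $j^{M_F}_E(j_F(\xi))=j_F(\xi)$ for every ordinal $\xi$, i.e. $(j^{M_F}_E\circ j_F)\restriction\mathrm{Ord}=j_F\restriction\mathrm{Ord}$.
   Context: For an extender $F$, $j_F:V\to M_F$ is its ultrapower embedding; for an inner model $M$ and an $M$-extender $E\in M$, $j^M_E:M\to M^M_E$ is the ultrapower computed in $M$. $M_{F^2}=j_F(M_F)=M^{M_F}_{j_F(F)}$, and $j_F(j_F):M_F\to M_{F^2}$ is the image of the class $j_F$ under $j_F$; so $j_F(E)$ and $j_F(j_F)(E)$ are $M_{F^2}$-extenders. Two extenders $E_0,E_1$ commute (in a model $N$) if $j_{E_0}(j_{E_1})=j_{E_1}\restriction M_{E_0}$ and $j_{E_1}(j_{E_0})=j_{E_0}\restriction M_{E_1}$, all computed in $N$. *)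

theory Defs
  imports Main
begin

section \<open>Models of ZFC\<close>

datatype fm = Mem nat nat | Eq nat nat | Neg fm | Conj fm fm | All nat fm

primrec sat :: "('v \<Rightarrow> 'v \<Rightarrow> bool) \<Rightarrow> (nat \<Rightarrow> 'v) \<Rightarrow> fm \<Rightarrow> bool" where
  "sat R \<rho> (Mem i k) \<longleftrightarrow> R (\<rho> i) (\<rho> k)"
| "sat R \<rho> (Eq i k) \<longleftrightarrow> \<rho> i = \<rho> k"
| "sat R \<rho> (Neg \<phi>) \<longleftrightarrow> \<not> sat R \<rho> \<phi>"
| "sat R \<rho> (Conj \<phi> \<psi>) \<longleftrightarrow> sat R \<rho> \<phi> \<and> sat R \<rho> \<psi>"
| "sat R \<rho> (All i \<phi>) \<longleftrightarrow> (\<forall>x. sat R (\<rho>(i := x)) \<phi>)"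

text \<open>The universe of sets is an arbitrary (possibly ill-founded) model of first-order ZFC.
  Separation and Replacement are the first-order schemes; the assignment \<open>\<rho>\<close> supplies the
  parameters. It is not assumed that arbitrary HOL predicates satisfy these schemes.\<close>

class zfc =
  fixes mem :: "'a \<Rightarrow> 'a \<Rightarrow> bool"  (infix "\<epsilon>" 50)
  assumes extensionality: "(\<forall>z. z \<epsilon> x \<longleftrightarrow> z \<epsilon> y) \<Longrightarrow> x = y"
    and foundation: "\<exists>y. y \<epsilon> x \<Longrightarrow> \<exists>y. y \<epsilon> x \<and> (\<forall>z. z \<epsilon> x \<longrightarrow> \<not> z \<epsilon> y)"
    and pairing: "\<exists>p. \<forall>z. z \<epsilon> p \<longleftrightarrow> z = x \<or> z = y"
    and union: "\<exists>u. \<forall>z. z \<epsilon> u \<longleftrightarrow> (\<exists>y. y \<epsilon> x \<and> z \<epsilon> y)"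
    and power_set: "\<exists>p. \<forall>z. z \<epsilon> p \<longleftrightarrow> (\<forall>w. w \<epsilon> z \<longrightarrow> w \<epsilon> x)"
    and infinity: "\<exists>i. (\<exists>e. e \<epsilon> i \<and> (\<forall>z. \<not> z \<epsilon> e)) \<and>
      (\<forall>x. x \<epsilon> i \<longrightarrow> (\<exists>y. y \<epsilon> i \<and> (\<forall>z. z \<epsilon> y \<longleftrightarrow> z \<epsilon> x \<or> z = x)))"
    and separation: "\<exists>b. \<forall>x. x \<epsilon> b \<longleftrightarrow> x \<epsilon> a \<and> sat mem (\<rho>(0 := x)) \<phi>"
    and replacement: "(\<forall>x. x \<epsilon> a \<longrightarrow> (\<exists>!y. sat mem (\<rho>(0 := x, 1 := y)) \<phi>)) \<Longrightarrow>
      \<exists>b. \<forall>y. y \<epsilon> b \<longleftrightarrow> (\<exists>x. x \<epsilon> a \<and> sat mem (\<rho>(0 := x, 1 := y)) \<phi>)"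
    and choice: "(\<forall>x. x \<epsilon> a \<longrightarrow> (\<exists>y. y \<epsilon> x)) \<Longrightarrow>
      (\<forall>x y z. x \<epsilon> a \<and> y \<epsilon> a \<and> z \<epsilon> x \<and> z \<epsilon> y \<longrightarrow> x = y) \<Longrightarrow>
      \<exists>c. \<forall>x. x \<epsilon> a \<longrightarrow> (\<exists>!y. y \<epsilon> c \<and> y \<epsilon> x)"

section \<open>Basic set theory, relativized to a class\<close>

text \<open>A class is a HOL set of elements of the model. In all definitions below the first
  argument \<open>N\<close> is the class to which every quantifier is relativized, so that \<open>P N x\<close> reads
  ``\<open>P(x)\<close> holds in \<open>N\<close>''. The universe itself is \<open>V\<close>.\<close>

abbreviation V :: "'v::zfc set" where "V \<equiv> UNIV"

definition subset_of :: "'v::zfc set \<Rightarrow> 'v \<Rightarrow> 'v \<Rightarrow> bool" where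
  "subset_of N x y \<longleftrightarrow> (\<forall>z\<in>N. z \<epsilon> x \<longrightarrow> z \<epsilon> y)"

definition is_empty :: "'v::zfc set \<Rightarrow> 'v \<Rightarrow> bool" where
  "is_empty N x \<longleftrightarrow> (\<forall>z\<in>N. \<not> z \<epsilon> x)"

definition is_union2 :: "'v::zfc set \<Rightarrow> 'v \<Rightarrow> 'v \<Rightarrow> 'v \<Rightarrow> bool" where
  "is_union2 N x y u \<longleftrightarrow> (\<forall>z\<in>N. z \<epsilon> u \<longleftrightarrow> z \<epsilon> x \<or> z \<epsilon> y)"

definition is_inter :: "'v::zfc set \<Rightarrow> 'v \<Rightarrow> 'v \<Rightarrow> 'v \<Rightarrow> bool" where
  "is_inter N x y u \<longleftrightarrow> (\<forall>z\<in>N. z \<epsilon> u \<longleftrightarrow> z \<epsilon> x \<and> z \<epsilon> y)"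

definition is_diff :: "'v::zfc set \<Rightarrow> 'v \<Rightarrow> 'v \<Rightarrow> 'v \<Rightarrow> bool" where
  "is_diff N x y u \<longleftrightarrow> (\<forall>z\<in>N. z \<epsilon> u \<longleftrightarrow> z \<epsilon> x \<and> \<not> z \<epsilon> y)"

definition is_Union :: "'v::zfc set \<Rightarrow> 'v \<Rightarrow> 'v \<Rightarrow> bool" where
  "is_Union N x u \<longleftrightarrow> (\<forall>z\<in>N. z \<epsilon> u \<longleftrightarrow> (\<exists>y\<in>N. y \<epsilon> x \<and> z \<epsilon> y))"

definition is_upair :: "'v::zfc set \<Rightarrow> 'v \<Rightarrow> 'v \<Rightarrow> 'v \<Rightarrow> bool" where
  "is_upair N x y u \<longleftrightarrow> (\<forall>z\<in>N. z \<epsilon> u \<longleftrightarrow> z = x \<or> z = y)"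

definition is_pair :: "'v::zfc set \<Rightarrow> 'v \<Rightarrow> 'v \<Rightarrow> 'v \<Rightarrow> bool" where
  "is_pair N x y p \<longleftrightarrow> (\<exists>u\<in>N. \<exists>v\<in>N. is_upair N x x u \<and> is_upair N x y v \<and> is_upair N u v p)"

definition app :: "'v::zfc set \<Rightarrow> 'v \<Rightarrow> 'v \<Rightarrow> 'v \<Rightarrow> bool" where
  "app N f x y \<longleftrightarrow> (\<exists>p\<in>N. p \<epsilon> f \<and> is_pair N x y p)"

definition is_fun_on :: "'v::zfc set \<Rightarrow> 'v \<Rightarrow> 'v \<Rightarrow> bool" where
  "is_fun_on N f a \<longleftrightarrow>
     (\<forall>p\<in>N. p \<epsilon> f \<longrightarrow> (\<exists>x\<in>N. \<exists>y\<in>N. x \<epsilon> a \<and> is_pair N x y p)) \<and>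
     (\<forall>x\<in>N. x \<epsilon> a \<longrightarrow> (\<exists>!y. y \<in> N \<and> app N f x y))"

definition is_fun :: "'v::zfc set \<Rightarrow> 'v \<Rightarrow> 'v \<Rightarrow> 'v \<Rightarrow> bool" where
  "is_fun N f a b \<longleftrightarrow> is_fun_on N f a \<and> (\<forall>x\<in>N. \<forall>y\<in>N. app N f x y \<longrightarrow> y \<epsilon> b)"

definition is_restrict :: "'v::zfc set \<Rightarrow> 'v \<Rightarrow> 'v \<Rightarrow> 'v \<Rightarrow> bool" where
  "is_restrict N f a g \<longleftrightarrow>
     (\<forall>p\<in>N. p \<epsilon> g \<longleftrightarrow> p \<epsilon> f \<and> (\<exists>x\<in>N. \<exists>y\<in>N. x \<epsilon> a \<and> is_pair N x y p))"

definition transitive :: "'v::zfc set \<Rightarrow> 'v \<Rightarrow> bool" where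
  "transitive N x \<longleftrightarrow> (\<forall>y\<in>N. y \<epsilon> x \<longrightarrow> subset_of N y x)"

definition ordinal :: "'v::zfc set \<Rightarrow> 'v \<Rightarrow> bool" where
  "ordinal N x \<longleftrightarrow> transitive N x \<and> (\<forall>y\<in>N. y \<epsilon> x \<longrightarrow> transitive N y)"

definition natural :: "'v::zfc set \<Rightarrow> 'v \<Rightarrow> bool" where
  "natural N n \<longleftrightarrow> ordinal N n \<and>
     (\<forall>m\<in>N. (m \<epsilon> n \<or> m = n) \<and> \<not> is_empty N m \<longrightarrow>
        (\<exists>k\<in>N. \<forall>z\<in>N. z \<epsilon> m \<longleftrightarrow> z \<epsilon> k \<or> z = k))"

definition is_finite :: "'v::zfc set \<Rightarrow> 'v \<Rightarrow> bool" where
  "is_finite N a \<longleftrightarrow> (\<exists>n\<in>N. \<exists>f\<in>N. natural N n \<and> is_fun N f n a \<and>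
     (\<forall>y\<in>N. y \<epsilon> a \<longrightarrow> (\<exists>!x. x \<in> N \<and> x \<epsilon> n \<and> app N f x y)))"

definition finite_subset :: "'v::zfc set \<Rightarrow> 'v \<Rightarrow> 'v \<Rightarrow> bool" where
  "finite_subset N a l \<longleftrightarrow> subset_of N a l \<and> is_finite N a"

section \<open>Extenders\<close>

definition ultrafilter :: "'v::zfc set \<Rightarrow> 'v \<Rightarrow> 'v \<Rightarrow> bool" where
  "ultrafilter N S U \<longleftrightarrow>
     (\<forall>X\<in>N. X \<epsilon> U \<longrightarrow> subset_of N X S) \<and>
     S \<epsilon> U \<and>
     (\<forall>X\<in>N. \<forall>Y\<in>N. X \<epsilon> U \<and> subset_of N X Y \<and> subset_of N Y S \<longrightarrow> Y \<epsilon> U) \<and>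
     (\<forall>X\<in>N. \<forall>Y\<in>N. \<forall>Z\<in>N. X \<epsilon> U \<and> Y \<epsilon> U \<and> is_inter N X Y Z \<longrightarrow> Z \<epsilon> U) \<and>
     (\<forall>X\<in>N. \<forall>Y\<in>N. subset_of N X S \<and> is_diff N S X Y \<longrightarrow> (X \<epsilon> U \<longleftrightarrow> \<not> Y \<epsilon> U))"

text \<open>\<open>{s \<in> S. P s} \<in> U\<close>:\<close>

definition measure_one :: "'v::zfc set \<Rightarrow> 'v \<Rightarrow> 'v \<Rightarrow> ('v \<Rightarrow> bool) \<Rightarrow> bool" where
  "measure_one N S U P \<longleftrightarrow> (\<exists>X\<in>N. X \<epsilon> U \<and> (\<forall>s\<in>N. s \<epsilon> X \<longleftrightarrow> s \<epsilon> S \<and> P s))"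

text \<open>For a finite set \<open>a\<close> of ordinals, \<open>[k]\<close> to the power \<open>|a|\<close> is represented by the set of
  strictly increasing functions from \<open>a\<close> to \<open>k\<close> (such a function corresponds to its range).
  The projection induced by \<open>a \<subseteq> b\<close> then is restriction of functions from \<open>b\<close> to \<open>a\<close>.\<close>

definition is_space :: "'v::zfc set \<Rightarrow> 'v \<Rightarrow> 'v \<Rightarrow> 'v \<Rightarrow> bool" where
  "is_space N a k S \<longleftrightarrow>
     (\<forall>s\<in>N. s \<epsilon> S \<longleftrightarrow> is_fun N s a k \<and>
        (\<forall>x\<in>N. \<forall>y\<in>N. x \<epsilon> a \<and> y \<epsilon> a \<and> x \<epsilon> y \<longrightarrow>
           (\<exists>u\<in>N. \<exists>v\<in>N. app N s x u \<and> app N s y v \<and> u \<epsilon> v)))"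

text \<open>\<open>U\<close> is the \<open>a\<close>-th measure of \<open>E\<close> and \<open>S = \<Union>U\<close> its underlying set:\<close>

definition ext_at :: "'v::zfc set \<Rightarrow> 'v \<Rightarrow> 'v \<Rightarrow> 'v \<Rightarrow> 'v \<Rightarrow> bool" where
  "ext_at N E a S U \<longleftrightarrow> app N E a U \<and> is_Union N U S"

definition ext_system :: "'v::zfc set \<Rightarrow> 'v \<Rightarrow> 'v \<Rightarrow> bool" where
  "ext_system N E l \<longleftrightarrow>
     ordinal N l \<and>
     (\<forall>p\<in>N. p \<epsilon> E \<longrightarrow> (\<exists>a\<in>N. \<exists>U\<in>N. finite_subset N a l \<and> is_pair N a U p)) \<and>
     (\<forall>a\<in>N. finite_subset N a l \<longrightarrow> (\<exists>!U. U \<in> N \<and> app N E a U)) \<and>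
     (\<forall>a\<in>N. \<forall>S\<in>N. \<forall>U\<in>N. ext_at N E a S U \<longrightarrow>
        (\<exists>k\<in>N. ordinal N k \<and> is_space N a k S) \<and> ultrafilter N S U)"

definition ext_coherent :: "'v::zfc set \<Rightarrow> 'v \<Rightarrow> bool" where
  "ext_coherent N E \<longleftrightarrow>
     (\<forall>a\<in>N. \<forall>S\<in>N. \<forall>U\<in>N. \<forall>b\<in>N. \<forall>T\<in>N. \<forall>W\<in>N.
        ext_at N E a S U \<and> ext_at N E b T W \<and> subset_of N a b \<longrightarrow>
        (\<forall>X\<in>N. subset_of N X S \<longrightarrow>
           (X \<epsilon> U \<longleftrightarrow> measure_one N T W (\<lambda>t. \<exists>s\<in>N. is_restrict N t a s \<and> s \<epsilon> X))))"

definition ext_normal :: "'v::zfc set \<Rightarrow> 'v \<Rightarrow> bool" where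
  "ext_normal N E \<longleftrightarrow>
     (\<forall>a\<in>N. \<forall>S\<in>N. \<forall>U\<in>N. \<forall>\<alpha>\<in>N. \<forall>f\<in>N.
        ext_at N E a S U \<and> \<alpha> \<epsilon> a \<and> is_fun_on N f S \<and>
        measure_one N S U (\<lambda>s. \<exists>u\<in>N. \<exists>v\<in>N. app N f s u \<and> app N s \<alpha> v \<and> u \<epsilon> v) \<longrightarrow>
        (\<exists>b\<in>N. \<exists>T\<in>N. \<exists>W\<in>N. \<exists>\<beta>\<in>N.
           ext_at N E b T W \<and> subset_of N a b \<and> \<beta> \<epsilon> b \<and>
           measure_one N T W
             (\<lambda>t. \<exists>s\<in>N. \<exists>u\<in>N. is_restrict N t a s \<and> app N f s u \<and> app N t \<beta> u)))"

text \<open>Elements of the ultrapower of \<open>N\<close> by \<open>E\<close> are represented by pairs \<open>(a, f)\<close> with \<open>f \<in> N\<close> a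
  function on the underlying set of the \<open>a\<close>-th measure. Pairs are compared after lifting to
  \<open>c = a \<union> b\<close>; \<open>R\<close> is instantiated with equality and membership.\<close>

definition ult_code :: "'v::zfc set \<Rightarrow> 'v \<Rightarrow> 'v \<Rightarrow> bool" where
  "ult_code N E p \<longleftrightarrow> (\<exists>a\<in>N. \<exists>f\<in>N. \<exists>S\<in>N. \<exists>U\<in>N.
     is_pair N a f p \<and> ext_at N E a S U \<and> is_fun_on N f S)"

definition ult_rel :: "('v \<Rightarrow> 'v \<Rightarrow> bool) \<Rightarrow> 'v::zfc set \<Rightarrow> 'v \<Rightarrow> 'v \<Rightarrow> 'v \<Rightarrow> bool" where
  "ult_rel R N E p q \<longleftrightarrow>
     (\<exists>a\<in>N. \<exists>f\<in>N. \<exists>b\<in>N. \<exists>g\<in>N. \<exists>c\<in>N. \<exists>S\<in>N. \<exists>U\<in>N.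
        is_pair N a f p \<and> is_pair N b g q \<and> is_union2 N a b c \<and> ext_at N E c S U \<and>
        measure_one N S U (\<lambda>t. \<exists>r\<in>N. \<exists>s\<in>N. \<exists>u\<in>N. \<exists>v\<in>N.
          is_restrict N t a r \<and> is_restrict N t b s \<and> app N f r u \<and> app N g s v \<and> R u v))"

abbreviation ult_eq :: "'v::zfc set \<Rightarrow> 'v \<Rightarrow> 'v \<Rightarrow> 'v \<Rightarrow> bool" where
  "ult_eq \<equiv> ult_rel (=)"

abbreviation ult_mem :: "'v::zfc set \<Rightarrow> 'v \<Rightarrow> 'v \<Rightarrow> 'v \<Rightarrow> bool" where
  "ult_mem \<equiv> ult_rel mem"

definition ult_wellfounded :: "'v::zfc set \<Rightarrow> 'v \<Rightarrow> bool" where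
  "ult_wellfounded N E \<longleftrightarrow>
     (\<forall>D\<in>N. \<not> is_empty N D \<and> (\<forall>p\<in>N. p \<epsilon> D \<longrightarrow> ult_code N E p) \<longrightarrow>
        (\<exists>p\<in>N. p \<epsilon> D \<and> (\<forall>q\<in>N. q \<epsilon> D \<longrightarrow> \<not> ult_mem N E q p)))"

text \<open>The length \<open>l\<close> is arbitrary and the underlying sets may vary with \<open>a\<close>, so both short and
  long extenders are covered.\<close>

definition extender :: "'v::zfc set \<Rightarrow> 'v \<Rightarrow> bool" where
  "extender N E \<longleftrightarrow> E \<in> N \<and> (\<exists>l\<in>N. ext_system N E l) \<and>
     ext_coherent N E \<and> ext_normal N E \<and> ult_wellfounded N E"

section \<open>Ultrapowers and their embeddings\<close>

text \<open>The transitive collapse of the ultrapower is given by the recursion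
  \<open>\<pi> p = {\<pi> q | q is a member of p in the ultrapower}\<close>. The relation is not set-like on
  pairs, so a set approximation \<open>g\<close> of \<open>\<pi>\<close> is defined on a set \<open>D\<close> of pairs which, up to
  equality in the ultrapower, contains all members of its elements.\<close>

definition collapse_approx :: "'v::zfc set \<Rightarrow> 'v \<Rightarrow> 'v \<Rightarrow> 'v \<Rightarrow> bool" where
  "collapse_approx N E D g \<longleftrightarrow>
     is_fun_on N g D \<and>
     (\<forall>p\<in>N. p \<epsilon> D \<longrightarrow> ult_code N E p) \<and>
     (\<forall>p\<in>N. \<forall>q\<in>N. p \<epsilon> D \<and> ult_code N E q \<and> ult_mem N E q p \<longrightarrow>
        (\<exists>r\<in>N. r \<epsilon> D \<and> ult_eq N E q r)) \<and>
     (\<forall>p\<in>N. \<forall>y\<in>N. p \<epsilon> D \<and> app N g p y \<longrightarrow>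
        (\<forall>z\<in>N. z \<epsilon> y \<longleftrightarrow> (\<exists>q\<in>N. q \<epsilon> D \<and> ult_mem N E q p \<and> app N g q z)))"

definition collapse :: "'v::zfc set \<Rightarrow> 'v \<Rightarrow> 'v \<Rightarrow> 'v \<Rightarrow> bool" where
  "collapse N E p x \<longleftrightarrow>
     (\<exists>D\<in>N. \<exists>g\<in>N. collapse_approx N E D g \<and> p \<epsilon> D \<and> app N g p x)"

definition Ult :: "'v::zfc set \<Rightarrow> 'v \<Rightarrow> 'v set" where
  "Ult N E = {x \<in> N. \<exists>p\<in>N. ult_code N E p \<and> collapse N E p x}"

text \<open>\<open>p = (\<emptyset>, constant function with value x)\<close>:\<close>

definition const_code :: "'v::zfc set \<Rightarrow> 'v \<Rightarrow> 'v \<Rightarrow> 'v \<Rightarrow> bool" where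
  "const_code N E x p \<longleftrightarrow> (\<exists>a\<in>N. \<exists>f\<in>N. \<exists>S\<in>N. \<exists>U\<in>N.
     is_pair N a f p \<and> is_empty N a \<and> ext_at N E a S U \<and> is_fun_on N f S \<and>
     (\<forall>s\<in>N. s \<epsilon> S \<longrightarrow> app N f s x))"

definition ult_emb :: "'v::zfc set \<Rightarrow> 'v \<Rightarrow> 'v \<Rightarrow> 'v" where
  "ult_emb N E x = (THE y. y \<in> N \<and> (\<exists>p\<in>N. const_code N E x p \<and> collapse N E p y))"

section \<open>Images of classes and commuting extenders\<close>

text \<open>The restriction of \<open>j\<close> to the class \<open>A\<close>, as a class of ordered pairs of \<open>N\<close>:\<close>

definition graph :: "'v::zfc set \<Rightarrow> 'v set \<Rightarrow> ('v \<Rightarrow> 'v) \<Rightarrow> 'v set" where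
  "graph N A j = {p \<in> N. \<exists>x\<in>A. is_pair N x (j x) p}"

definition class_app :: "'v::zfc set \<Rightarrow> 'v \<Rightarrow> 'v" where
  "class_app J x = (THE y. \<exists>p\<in>J. is_pair V x y p)"

text \<open>For an embedding \<open>j\<close> of \<open>N\<close> and a class \<open>C\<close> of \<open>N\<close>, the image \<open>j(C)\<close> is the union of the
  sets \<open>j(C \<inter> x)\<close> over all sets \<open>x\<close> of \<open>N\<close>.\<close>

definition class_image :: "'v::zfc set \<Rightarrow> ('v \<Rightarrow> 'v) \<Rightarrow> 'v set \<Rightarrow> 'v set" where
  "class_image N j C =
     {y. \<exists>x\<in>N. \<exists>c\<in>N. (\<forall>z\<in>N. z \<epsilon> c \<longleftrightarrow> z \<in> C \<and> z \<epsilon> x) \<and> y \<epsilon> j c}"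

definition commute :: "'v::zfc set \<Rightarrow> 'v \<Rightarrow> 'v \<Rightarrow> bool" where
  "commute N E\<^sub>0 E\<^sub>1 \<longleftrightarrow>
     class_image N (ult_emb N E\<^sub>0) (graph N N (ult_emb N E\<^sub>1)) =
       graph N (Ult N E\<^sub>0) (ult_emb N E\<^sub>1) \<and>
     class_image N (ult_emb N E\<^sub>1) (graph N N (ult_emb N E\<^sub>0)) =
       graph N (Ult N E\<^sub>1) (ult_emb N E\<^sub>0)"

abbreviation M :: "'v::zfc \<Rightarrow> 'v set" where "M F \<equiv> Ult V F"

abbreviation j :: "'v::zfc \<Rightarrow> 'v \<Rightarrow> 'v" where "j F \<equiv> ult_emb V F"

text \<open>\<open>j\<^sub>F(M\<^sub>F)\<close> and \<open>j\<^sub>F(j\<^sub>F)\<close>:\<close>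

definition M2 :: "'v::zfc \<Rightarrow> 'v set" where
  "M2 F = class_image V (j F) (M F)"

definition jj :: "'v::zfc \<Rightarrow> 'v \<Rightarrow> 'v" where
  "jj F = class_app (class_image V (j F) (graph V V (j F)))"

end

(* Write i for the ultrapower embedding of M_F by E, and let i0 and i1 be the embeddings of M_{F^2}
   by j_F(j_F)(E) and j_F(E); so i0 o j_F(j_F) = j_F(j_F) o i and i1 o j_F = j_F o i on M_F.
   For every ordinal a of M_F one has j_F(j_F)(a) <= j_F(a), with equality only if a is in the range
   of j_F.

   Let xi be least with i(j_F(xi)) > j_F(xi), put eta = j_F(xi) and x = j_F(eta) = j_F(j_F)(eta), and
   let c be least with i(c) >= eta.  Then i0(x) = j_F(j_F)(i(eta)) <= j_F(i(eta)) = i1(x).  Since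
   j_F(c) is the least d with i1(d) >= x, the hypothesis i0(i1) = i1 says that i0(j_F(c)) is the
   least d with i1(d) >= i0(x); hence i0(j_F(c)) <= x.  On the other hand
   i0(j_F(j_F)(c)) = j_F(j_F)(i(c)) >= x.  So j_F(c) <= j_F(j_F)(c), which forces c = j_F(zeta) for
   some zeta <= xi.  If zeta < xi, then i(c) = c < eta by minimality of xi, contradicting the choice
   of c; if zeta = xi, then i0(x) <= x, that is i(eta) <= eta.

   The elementarity of ultrapower embeddings is proved for the universe (Los's theorem and the
   Mostowski collapse, by means of Collection and choice functions).  It is a scheme of first-order
   statements about (universe, extender), so elementarity itself carries it to M_F and M_{F^2}. *)

theory Submission
  imports Defs
begin

section \<open>Satisfaction and definability\<close>

text \<open>The universe is an arbitrary model of first-order ZFC, possibly ill-founded, so an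
  arbitrary HOL predicate may not enter Separation, Replacement or the choice of a least ordinal.
  Every such use below carries a proof of definability. Two notions are kept apart:
  \<open>vdef\<close> allows parameters and speaks of the universe alone, as the axiom schemes do;
  \<open>udef\<close> is parameter-free and uniform in the class, which is what an elementary
  embedding can transport.

  The hypothesis on commuting extenders is an equality between classes of pairs, and it enters
  through a single pair. If x were below i0(j_F(c)), then x would lie in the ultrapower by
  j_F(j_F)(E), so the pair (x, i1(x)) would belong to i0(s) for some set s of pairs from the graph
  of i1. Every pair in s with first entry below j_F(c) has second entry below x. Applying i0 to this
  statement gives i1(x) < i0(x), against the comparison of j_F(j_F) with j_F at i(eta). The
  leastness of xi and of c is legitimate because M_F and i are definable over the universe from F
  and E.\<close>

primrec satG :: "'a set \<Rightarrow> ('a \<Rightarrow> 'a \<Rightarrow> bool) \<Rightarrow> ('a \<Rightarrow> 'a \<Rightarrow> bool) \<Rightarrow> (nat \<Rightarrow> 'a) \<Rightarrow> fm \<Rightarrow> bool" where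
  "satG A r e \<rho> (Mem i k) \<longleftrightarrow> r (\<rho> i) (\<rho> k)"
| "satG A r e \<rho> (Eq i k) \<longleftrightarrow> e (\<rho> i) (\<rho> k)"
| "satG A r e \<rho> (Neg \<phi>) \<longleftrightarrow> \<not> satG A r e \<rho> \<phi>"
| "satG A r e \<rho> (Conj \<phi> \<psi>) \<longleftrightarrow> satG A r e \<rho> \<phi> \<and> satG A r e \<rho> \<psi>"
| "satG A r e \<rho> (All i \<phi>) \<longleftrightarrow> (\<forall>x\<in>A. satG A r e (\<rho>(i := x)) \<phi>)"

abbreviation satN :: "'v::zfc set \<Rightarrow> (nat \<Rightarrow> 'v) \<Rightarrow> fm \<Rightarrow> bool" where
  "satN N \<equiv> satG N mem (=)"

lemma sat_eq_satN: "sat mem \<rho> \<phi> = satN UNIV \<rho> \<phi>"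
  by (induction \<phi> arbitrary: \<rho>) auto

primrec fv :: "fm \<Rightarrow> nat set" where
  "fv (Mem i k) = {i, k}"
| "fv (Eq i k) = {i, k}"
| "fv (Neg \<phi>) = fv \<phi>"
| "fv (Conj \<phi> \<psi>) = fv \<phi> \<union> fv \<psi>"
| "fv (All i \<phi>) = fv \<phi> - {i}"

lemma finite_fv: "finite (fv \<phi>)"
  by (induction \<phi>) auto

lemma satG_cong: "(\<And>i. i \<in> fv \<phi> \<Longrightarrow> \<rho> i = \<rho>' i) \<Longrightarrow> satG A r e \<rho> \<phi> = satG A r e \<rho>' \<phi>"
proof (induction \<phi> arbitrary: \<rho> \<rho>')
  case (All k \<phi>)
  have "satG A r e (\<rho>(k := x)) \<phi> = satG A r e (\<rho>'(k := x)) \<phi>" for x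
    by (rule All.IH) (use All.prems in auto)
  then show ?case by simp
next
  case (Neg \<phi>)
  have "satG A r e \<rho> \<phi> = satG A r e \<rho>' \<phi>" by (rule Neg.IH) (use Neg.prems in auto)
  then show ?case by simp
next
  case (Conj \<phi> \<psi>)
  have "satG A r e \<rho> \<phi> = satG A r e \<rho>' \<phi>" by (rule Conj.IH) (use Conj.prems in auto)
  moreover have "satG A r e \<rho> \<psi> = satG A r e \<rho>' \<psi>" by (rule Conj.IH) (use Conj.prems in auto)
  ultimately show ?case by simp
qed auto

lemma satG_iso:
  assumes "\<And>x y. x \<in> A \<Longrightarrow> y \<in> A \<Longrightarrow> r x y \<longleftrightarrow> r' (h x) (h y)"
    and "\<And>x y. x \<in> A \<Longrightarrow> y \<in> A \<Longrightarrow> e x y \<longleftrightarrow> e' (h x) (h y)"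
  shows "(\<And>i. \<rho> i \<in> A) \<Longrightarrow> satG A r e \<rho> \<phi> = satG (h ` A) r' e' (\<lambda>i. h (\<rho> i)) \<phi>"
proof (induction \<phi> arbitrary: \<rho>)
  case (All k \<phi>)
  have "satG A r e (\<rho>(k := x)) \<phi> = satG (h ` A) r' e' ((\<lambda>i. h (\<rho> i))(k := h x)) \<phi>" if "x \<in> A" for x
  proof -
    have "satG A r e (\<rho>(k := x)) \<phi> = satG (h ` A) r' e' (\<lambda>i. h ((\<rho>(k := x)) i)) \<phi>"
      by (rule All.IH) (use All.prems that in auto)
    also have "(\<lambda>i. h ((\<rho>(k := x)) i)) = (\<lambda>i. h (\<rho> i))(k := h x)" by auto
    finally show ?thesis .
  qed
  then show ?case by simp
qed (simp_all add: assms)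

lemma fm_rename: "\<exists>\<psi>. \<forall>(A::'a set) r e \<rho>. satG A r e \<rho> \<psi> = satG A r e (\<lambda>i. \<rho> (f i)) \<phi>"
proof (induction \<phi> arbitrary: f)
  case (Mem i k) then show ?case by (intro exI[of _ "Mem (f i) (f k)"]) auto
next
  case (Eq i k) then show ?case by (intro exI[of _ "Eq (f i) (f k)"]) auto
next
  case (Neg \<phi>)
  then obtain \<psi> where "\<forall>(A::'a set) r e \<rho>. satG A r e \<rho> \<psi> = satG A r e (\<lambda>i. \<rho> (f i)) \<phi>" by blast
  then show ?case by (intro exI[of _ "Neg \<psi>"]) auto
next
  case (Conj \<phi> \<phi>')
  then obtain \<psi> \<psi>' where "\<forall>(A::'a set) r e \<rho>. satG A r e \<rho> \<psi> = satG A r e (\<lambda>i. \<rho> (f i)) \<phi>"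
    "\<forall>(A::'a set) r e \<rho>. satG A r e \<rho> \<psi>' = satG A r e (\<lambda>i. \<rho> (f i)) \<phi>'" by metis
  then show ?case by (intro exI[of _ "Conj \<psi> \<psi>'"]) auto
next
  case (All k \<phi>)
  have "finite (f ` fv \<phi>)" by (simp add: finite_fv)
  \<comment> \<open>The map \<open>f\<close> may identify variables, so the bound variable is
    renamed to one outside the image of the free variables to avoid capture.\<close>
  then obtain m where m: "m \<notin> f ` fv \<phi>" using ex_new_if_finite infinite_UNIV_nat by blast
  obtain \<psi> where \<psi>: "\<forall>(A::'a set) r e \<rho>. satG A r e \<rho> \<psi> = satG A r e (\<lambda>i. \<rho> ((f(k := m)) i)) \<phi>"
    using All.IH by blast
  have "satG A r e (\<rho>(m := x)) \<psi> = satG A r e ((\<lambda>i. \<rho> (f i))(k := x)) \<phi>" for A :: "'a set" and r e \<rho> x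
    by (subst \<psi>[rule_format], rule satG_cong) (use m in auto)
  then show ?case by (intro exI[of _ "All m \<psi>"]) auto
qed

text \<open>One formula defines \<open>P N\<close> in every class \<open>N\<close>; this uniformity is what elementarity transfers.\<close>

definition udef :: "('v::zfc set \<Rightarrow> (nat \<Rightarrow> 'v) \<Rightarrow> bool) \<Rightarrow> bool" where
  "udef P \<longleftrightarrow> (\<exists>\<phi>. \<forall>N \<rho>. P N \<rho> \<longleftrightarrow> satN N \<rho> \<phi>)"

lemma udef_sat: "udef (\<lambda>N \<rho>. satN N \<rho> \<phi>)"
  unfolding udef_def by blast

lemma udef_ren: assumes "udef P" shows "udef (\<lambda>N \<rho>. P N (\<lambda>i. \<rho> (f i)))"
proof -
  obtain \<phi> where "\<And>N \<rho>. P N \<rho> \<longleftrightarrow> satN N \<rho> \<phi>" using assms unfolding udef_def by blast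
  moreover obtain \<psi> where "\<forall>(A::'a set) r e \<rho>. satG A r e \<rho> \<psi> = satG A r e (\<lambda>i. \<rho> (f i)) \<phi>"
    using fm_rename by blast
  ultimately show ?thesis unfolding udef_def by blast
qed

lemma udef_mem: "udef (\<lambda>N \<rho>. \<rho> i \<epsilon> \<rho> k)"
  unfolding udef_def by (intro exI[of _ "Mem i k"]) auto

lemma udef_eq: "udef (\<lambda>N \<rho>. \<rho> i = \<rho> k)"
  unfolding udef_def by (intro exI[of _ "Eq i k"]) auto

lemma udef_neg: "udef P \<Longrightarrow> udef (\<lambda>N \<rho>. \<not> P N \<rho>)"
  unfolding udef_def by (metis satG.simps(3))

lemma udef_conj: "udef P \<Longrightarrow> udef Q \<Longrightarrow> udef (\<lambda>N \<rho>. P N \<rho> \<and> Q N \<rho>)"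
  unfolding udef_def by (metis satG.simps(4))

lemma udef_disj: "udef P \<Longrightarrow> udef Q \<Longrightarrow> udef (\<lambda>N \<rho>. P N \<rho> \<or> Q N \<rho>)"
  using udef_neg[OF udef_conj[OF udef_neg udef_neg], of P Q] by simp

lemma udef_imp: "udef P \<Longrightarrow> udef Q \<Longrightarrow> udef (\<lambda>N \<rho>. P N \<rho> \<longrightarrow> Q N \<rho>)"
  using udef_neg[OF udef_conj[OF _ udef_neg], of P Q] by simp

lemma udef_iff: "udef P \<Longrightarrow> udef Q \<Longrightarrow> udef (\<lambda>N \<rho>. P N \<rho> \<longleftrightarrow> Q N \<rho>)"
  using udef_conj[OF udef_imp udef_imp, of P Q Q P] by (simp add: iff_conv_conj_imp)

lemma udef_const: "udef (\<lambda>N \<rho>. b)"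
  using udef_eq[of 0 0] udef_neg[OF udef_eq[of 0 0]] by (cases b) auto

lemma udef_upd_all:
  assumes "udef P" shows "udef (\<lambda>N \<rho>. \<forall>x\<in>N. P N (\<rho>(n := x)))"
proof -
  obtain \<phi> where "\<And>N \<rho>. P N \<rho> \<longleftrightarrow> satN N \<rho> \<phi>" using assms unfolding udef_def by blast
  then show ?thesis unfolding udef_def by (intro exI[of _ "All n \<phi>"]) auto
qed

lemma udef_all:
  assumes "udef (\<lambda>N \<rho>. Q N (\<rho> 0) (\<lambda>i. \<rho> (Suc i)))"
  shows "udef (\<lambda>N \<rho>. \<forall>x\<in>N. Q N x \<rho>)"
proof -
  obtain \<phi> where \<phi>: "\<And>N \<rho>. Q N (\<rho> 0) (\<lambda>i. \<rho> (Suc i)) \<longleftrightarrow> satN N \<rho> \<phi>"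
    using assms unfolding udef_def by blast
  have "finite {i. Suc i \<in> fv \<phi>}" 
    using finite_vimageI[OF finite_fv[of \<phi>], of Suc] by (simp add: vimage_def)
  then obtain m where m: "Suc m \<notin> fv \<phi>" using ex_new_if_finite infinite_UNIV_nat by blast
  obtain \<psi> where \<psi>: "\<forall>(A::'a set) r e \<rho>. satG A r e \<rho> \<psi> = satG A r e (\<lambda>i. \<rho> (case i of 0 \<Rightarrow> m | Suc k \<Rightarrow> k)) \<phi>"
    using fm_rename by blast
  have "Q N x \<rho> = satN N (\<rho>(m := x)) \<psi>" for N x \<rho>
  proof -
    have "Q N x \<rho> = satN N (\<lambda>i. case i of 0 \<Rightarrow> x | Suc k \<Rightarrow> \<rho> k) \<phi>"
      using \<phi>[of N "\<lambda>i. case i of 0 \<Rightarrow> x | Suc k \<Rightarrow> \<rho> k"] by simp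
    also have "\<dots> = satN N (\<rho>(m := x)) \<psi>" by (subst \<psi>[rule_format], rule satG_cong) (use m in \<open>auto split: nat.split\<close>)
    finally show ?thesis .
  qed
  then show ?thesis unfolding udef_def by (intro exI[of _ "All m \<psi>"]) auto
qed

lemma udef_ex:
  assumes "udef (\<lambda>N \<rho>. Q N (\<rho> 0) (\<lambda>i. \<rho> (Suc i)))"
  shows "udef (\<lambda>N \<rho>. \<exists>x\<in>N. Q N x \<rho>)"
  using udef_neg[OF udef_all, of "\<lambda>N x \<rho>. \<not> Q N x \<rho>"] udef_neg[OF assms] by simp

text \<open>Assignments may take values outside the class, so membership in \<open>N\<close> is a
  real condition; a relativized quantifier expresses it.\<close>

lemma udef_in: "udef (\<lambda>N \<rho>. \<rho> i \<in> N)"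
proof -
  have "udef (\<lambda>N \<rho>. \<exists>x\<in>N. x = \<rho> i)" by (intro udef_ex udef_eq)
  then show ?thesis by simp
qed

lemma udef_ex1:
  assumes "udef (\<lambda>N \<rho>. Q N (\<rho> 0) (\<lambda>i. \<rho> (Suc i)))"
  shows "udef (\<lambda>N \<rho>. \<exists>!x. x \<in> N \<and> Q N x \<rho>)"
proof -
  have 1: "udef (\<lambda>N \<rho>. Q N (\<rho> 0) (\<lambda>i. \<rho> (Suc (Suc i))))"
    using udef_ren[OF assms, of "\<lambda>i. case i of 0 \<Rightarrow> 0 | Suc k \<Rightarrow> Suc (Suc k)"] by simp
  have "udef (\<lambda>N \<rho>. \<exists>x\<in>N. Q N x \<rho> \<and> (\<forall>y\<in>N. Q N y \<rho> \<longrightarrow> y = x))"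
    by (intro udef_ex udef_conj udef_all udef_imp udef_eq assms 1)
  moreover have "(\<exists>!x. x \<in> N \<and> Q N x \<rho>) = (\<exists>x\<in>N. Q N x \<rho> \<and> (\<forall>y\<in>N. Q N y \<rho> \<longrightarrow> y = x))" for N \<rho>
    by blast
  ultimately show ?thesis by simp
qed

lemmas udef_intros = udef_mem udef_eq udef_neg udef_conj udef_disj udef_imp udef_iff udef_all udef_ex
  udef_ex1 udef_in

section \<open>Uniform definability of the notions in the statement\<close>

lemma udef_subset_of: "udef (\<lambda>N \<rho>. subset_of N (\<rho> a) (\<rho> b))"
  unfolding subset_of_def by (intro udef_intros)

lemma udef_is_empty: "udef (\<lambda>N \<rho>. is_empty N (\<rho> a))"
  unfolding is_empty_def by (intro udef_intros)

lemma udef_is_union2: "udef (\<lambda>N \<rho>. is_union2 N (\<rho> a) (\<rho> b) (\<rho> c))"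
  unfolding is_union2_def by (intro udef_intros)

lemma udef_is_inter: "udef (\<lambda>N \<rho>. is_inter N (\<rho> a) (\<rho> b) (\<rho> c))"
  unfolding is_inter_def by (intro udef_intros)

lemma udef_is_diff: "udef (\<lambda>N \<rho>. is_diff N (\<rho> a) (\<rho> b) (\<rho> c))"
  unfolding is_diff_def by (intro udef_intros)

lemma udef_is_Union: "udef (\<lambda>N \<rho>. is_Union N (\<rho> a) (\<rho> b))"
  unfolding is_Union_def by (intro udef_intros)

lemma udef_is_upair: "udef (\<lambda>N \<rho>. is_upair N (\<rho> a) (\<rho> b) (\<rho> c))"
  unfolding is_upair_def by (intro udef_intros)

lemma udef_is_pair: "udef (\<lambda>N \<rho>. is_pair N (\<rho> a) (\<rho> b) (\<rho> c))"
  unfolding is_pair_def by (intro udef_intros udef_is_upair)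

lemma udef_app: "udef (\<lambda>N \<rho>. app N (\<rho> a) (\<rho> b) (\<rho> c))"
  unfolding app_def by (intro udef_intros udef_is_pair)

lemma udef_is_fun_on: "udef (\<lambda>N \<rho>. is_fun_on N (\<rho> a) (\<rho> b))"
  unfolding is_fun_on_def by (intro udef_intros udef_is_pair udef_app)

lemma udef_is_fun: "udef (\<lambda>N \<rho>. is_fun N (\<rho> a) (\<rho> b) (\<rho> c))"
  unfolding is_fun_def by (intro udef_intros udef_is_fun_on udef_app)

lemma udef_is_restrict: "udef (\<lambda>N \<rho>. is_restrict N (\<rho> a) (\<rho> b) (\<rho> c))"
  unfolding is_restrict_def by (intro udef_intros udef_is_pair)

lemma udef_transitive: "udef (\<lambda>N \<rho>. transitive N (\<rho> a))"
  unfolding transitive_def by (intro udef_intros udef_subset_of)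

lemma udef_ordinal: "udef (\<lambda>N \<rho>. ordinal N (\<rho> a))"
  unfolding ordinal_def by (intro udef_intros udef_transitive)

lemma udef_natural: "udef (\<lambda>N \<rho>. natural N (\<rho> a))"
  unfolding natural_def by (intro udef_intros udef_ordinal udef_is_empty)

lemma udef_is_finite: "udef (\<lambda>N \<rho>. is_finite N (\<rho> a))"
  unfolding is_finite_def by (intro udef_intros udef_natural udef_is_fun udef_app)

lemma udef_finite_subset: "udef (\<lambda>N \<rho>. finite_subset N (\<rho> a) (\<rho> b))"
  unfolding finite_subset_def by (intro udef_intros udef_is_finite udef_subset_of)

lemma udef_ultrafilter: "udef (\<lambda>N \<rho>. ultrafilter N (\<rho> a) (\<rho> b))"
  unfolding ultrafilter_def by (intro udef_intros udef_subset_of udef_is_inter udef_is_diff)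

lemma udef_is_space: "udef (\<lambda>N \<rho>. is_space N (\<rho> a) (\<rho> b) (\<rho> c))"
  unfolding is_space_def by (intro udef_intros udef_is_fun udef_app)

lemma udef_ext_at: "udef (\<lambda>N \<rho>. ext_at N (\<rho> a) (\<rho> b) (\<rho> c) (\<rho> d))"
  unfolding ext_at_def by (intro udef_intros udef_is_Union udef_app)

lemma udef_ext_system: "udef (\<lambda>N \<rho>. ext_system N (\<rho> a) (\<rho> b))"
  unfolding ext_system_def
  by (intro udef_intros udef_ordinal udef_app udef_ext_at udef_is_space udef_ultrafilter
      udef_finite_subset udef_is_pair)

lemma udef_ext_coherent: "udef (\<lambda>N \<rho>. ext_coherent N (\<rho> a))"
  unfolding ext_coherent_def measure_one_def
  by (intro udef_intros udef_ext_at udef_subset_of udef_is_restrict)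

lemma udef_ext_normal: "udef (\<lambda>N \<rho>. ext_normal N (\<rho> a))"
  unfolding ext_normal_def measure_one_def
  by (intro udef_intros udef_ext_at udef_subset_of udef_is_restrict udef_app udef_is_fun_on)

lemma udef_ult_code: "udef (\<lambda>N \<rho>. ult_code N (\<rho> a) (\<rho> b))"
  unfolding ult_code_def
  by (intro udef_intros udef_ext_at udef_is_fun_on udef_is_pair)

lemma udef_ult_eq: "udef (\<lambda>N \<rho>. ult_eq N (\<rho> a) (\<rho> b) (\<rho> c))"
  unfolding ult_rel_def measure_one_def
  by (intro udef_intros udef_ext_at udef_is_pair udef_is_union2 udef_is_restrict udef_app)

lemma udef_ult_mem: "udef (\<lambda>N \<rho>. ult_mem N (\<rho> a) (\<rho> b) (\<rho> c))"
  unfolding ult_rel_def measure_one_def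
  by (intro udef_intros udef_ext_at udef_is_pair udef_is_union2 udef_is_restrict udef_app)

lemma udef_ult_wellfounded: "udef (\<lambda>N \<rho>. ult_wellfounded N (\<rho> a))"
  unfolding ult_wellfounded_def
  by (intro udef_intros udef_is_empty udef_ult_code udef_ult_mem)

lemma udef_extender: "udef (\<lambda>N \<rho>. extender N (\<rho> a))"
  unfolding extender_def
  by (intro udef_intros udef_ext_system udef_ext_coherent udef_ext_normal udef_ult_wellfounded)

lemma udef_collapse_approx: "udef (\<lambda>N \<rho>. collapse_approx N (\<rho> a) (\<rho> b) (\<rho> c))"
  unfolding collapse_approx_def
  by (intro udef_intros udef_is_fun_on udef_ult_code udef_ult_mem udef_ult_eq udef_app)

lemma udef_collapse: "udef (\<lambda>N \<rho>. collapse N (\<rho> a) (\<rho> b) (\<rho> c))"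
  unfolding collapse_def
  by (intro udef_intros udef_collapse_approx udef_app)

lemma udef_in_Ult: "udef (\<lambda>N \<rho>. \<rho> a \<in> Ult N (\<rho> b))"
  unfolding Ult_def mem_Collect_eq
  by (intro udef_intros udef_collapse udef_ult_code)

lemma udef_const_code: "udef (\<lambda>N \<rho>. const_code N (\<rho> a) (\<rho> b) (\<rho> c))"
  unfolding const_code_def
  by (intro udef_intros udef_is_pair udef_is_empty udef_ext_at udef_is_fun_on udef_app)

text \<open>Definability over the universe, with parameters: the even variables are the arguments
  and the odd ones the parameters.\<close>

definition mrg :: "(nat \<Rightarrow> 'a) \<Rightarrow> (nat \<Rightarrow> 'a) \<Rightarrow> nat \<Rightarrow> 'a" where
  "mrg \<rho> c i = (if even i then \<rho> (i div 2) else c (i div 2))"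

definition vdef :: "((nat \<Rightarrow> 'v::zfc) \<Rightarrow> bool) \<Rightarrow> bool" where
  "vdef P \<longleftrightarrow> (\<exists>Q c. udef Q \<and> (\<forall>\<rho>. P \<rho> \<longleftrightarrow> Q UNIV (mrg \<rho> c)))"

definition vterm :: "((nat \<Rightarrow> 'v::zfc) \<Rightarrow> 'v) \<Rightarrow> bool" where
  "vterm t \<longleftrightarrow> vdef (\<lambda>\<rho>. \<rho> 0 = t (\<lambda>i. \<rho> (Suc i)))"

lemma vdef_ren: assumes "vdef P" shows "vdef (\<lambda>\<rho>. P (\<lambda>i. \<rho> (f i)))"
proof -
  obtain Q c where Q: "udef Q" "\<And>\<rho>. P \<rho> \<longleftrightarrow> Q UNIV (mrg \<rho> c)"
    using assms unfolding vdef_def by blast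
  define h where "h i = (if even i then 2 * f (i div 2) else i)" for i
  have "mrg (\<lambda>i. \<rho> (f i)) c = (\<lambda>i. mrg \<rho> c (h i))" for \<rho>
    by (rule ext) (simp add: mrg_def h_def)
  then have "\<forall>\<rho>. P (\<lambda>i. \<rho> (f i)) \<longleftrightarrow> Q UNIV (\<lambda>i. mrg \<rho> c (h i))" using Q(2) by metis
  with udef_ren[OF Q(1), of h] show ?thesis unfolding vdef_def
    by (intro exI[of _ "\<lambda>N \<rho>. Q N (\<lambda>i. \<rho> (h i))"] exI[of _ c] conjI)
qed

lemma vdef_neg: assumes "vdef P" shows "vdef (\<lambda>\<rho>. \<not> P \<rho>)"
proof -
  obtain Q c where Q: "udef Q" "\<And>\<rho>. P \<rho> \<longleftrightarrow> Q UNIV (mrg \<rho> c)"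
    using assms unfolding vdef_def by blast
  then show ?thesis unfolding vdef_def
    by (intro exI[of _ "\<lambda>N \<rho>. \<not> Q N \<rho>"] exI[of _ c]) (auto intro: udef_neg)
qed

lemma vdef_conj: assumes "vdef P" "vdef P'" shows "vdef (\<lambda>\<rho>. P \<rho> \<and> P' \<rho>)"
proof -
  obtain Q c where Q: "udef Q" "\<And>\<rho>. P \<rho> \<longleftrightarrow> Q UNIV (mrg \<rho> c)"
    using assms unfolding vdef_def by blast
  obtain Q' c' where Q': "udef Q'" "\<And>\<rho>. P' \<rho> \<longleftrightarrow> Q' UNIV (mrg \<rho> c')"
    using assms unfolding vdef_def by blast
  \<comment> \<open>The two parameter sequences are interleaved as \<open>mrg c c'\<close>;
    \<open>h\<close> finds the entries of \<open>c\<close> at the even places of that sequence and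
    \<open>h'\<close> those of \<open>c'\<close> at the odd ones.\<close>
  define h where "h i = (if even i then i else Suc (2 * (2 * (i div 2))))" for i :: nat
  define h' where "h' i = (if even i then i else Suc (2 * Suc (2 * (i div 2))))" for i :: nat
  have odd: "odd i \<Longrightarrow> (i - Suc 0) div 2 = i div 2" for i :: nat by presburger
  have "mrg \<rho> c = (\<lambda>i. mrg \<rho> (mrg c c') (h i))" "mrg \<rho> c' = (\<lambda>i. mrg \<rho> (mrg c c') (h' i))" for \<rho>
    by (rule ext, use odd in \<open>simp add: mrg_def h_def h'_def\<close>)+
  then have "\<forall>\<rho>. (P \<rho> \<and> P' \<rho>) \<longleftrightarrow>
      Q UNIV (\<lambda>i. mrg \<rho> (mrg c c') (h i)) \<and> Q' UNIV (\<lambda>i. mrg \<rho> (mrg c c') (h' i))"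
    using Q(2) Q'(2) by metis
  with udef_conj[OF udef_ren[OF Q(1), of h] udef_ren[OF Q'(1), of h']] show ?thesis unfolding vdef_def
    by (intro exI[of _ "\<lambda>N \<rho>. Q N (\<lambda>i. \<rho> (h i)) \<and> Q' N (\<lambda>i. \<rho> (h' i))"] exI[of _ "mrg c c'"] conjI)
qed

lemma vdef_disj: "vdef P \<Longrightarrow> vdef Q \<Longrightarrow> vdef (\<lambda>\<rho>. P \<rho> \<or> Q \<rho>)"
  using vdef_neg[OF vdef_conj[OF vdef_neg vdef_neg], of P Q] by simp

lemma vdef_imp: "vdef P \<Longrightarrow> vdef Q \<Longrightarrow> vdef (\<lambda>\<rho>. P \<rho> \<longrightarrow> Q \<rho>)"
  using vdef_neg[OF vdef_conj[OF _ vdef_neg], of P Q] by simp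

lemma vdef_iff: "vdef P \<Longrightarrow> vdef Q \<Longrightarrow> vdef (\<lambda>\<rho>. P \<rho> \<longleftrightarrow> Q \<rho>)"
  using vdef_conj[OF vdef_imp vdef_imp, of P Q Q P] by (simp add: iff_conv_conj_imp)

lemma vdef_all:
  assumes "vdef (\<lambda>\<rho>. Q (\<rho> 0) (\<lambda>i. \<rho> (Suc i)))"
  shows "vdef (\<lambda>\<rho>. \<forall>x. Q x \<rho>)"
proof -
  obtain R c where R: "udef R" "\<And>\<rho>. Q (\<rho> 0) (\<lambda>i. \<rho> (Suc i)) \<longleftrightarrow> R UNIV (mrg \<rho> c)"
    using assms unfolding vdef_def by blast
  \<comment> \<open>Value 0 marks the new bound variable. Otherwise \<open>g i - 1\<close> is the
    old position: an argument moves down by two, because arguments occupy even places, and a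
    parameter stays where it is.\<close>
  define g where "g i = (if i = 0 then 0 else if even i then i - 1 else Suc i)" for i :: nat
  define R' where "R' N \<rho> = (\<forall>x\<in>N. R N (\<lambda>i. if g i = 0 then x else \<rho> (g i - 1)))" for N \<rho>
  have "(\<lambda>i. if g i = 0 then \<rho> 0 else \<rho> (Suc (g i - 1))) = (\<lambda>i. \<rho> (g i))" for \<rho> :: "nat \<Rightarrow> 'a"
    by (rule ext) simp
  then have "udef (\<lambda>N \<rho>. R N (\<lambda>i. if g i = 0 then \<rho> 0 else \<rho> (Suc (g i - 1))))"
    using udef_ren[OF R(1), of g] by simp
  then have "udef R'" unfolding R'_def by (rule udef_all)
  moreover have "(\<forall>x. Q x \<rho>) = R' UNIV (mrg \<rho> c)" for \<rho>
  proof -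
    have "Q x \<rho> = R UNIV (\<lambda>i. if g i = 0 then x else mrg \<rho> c (g i - 1))" for x
    proof -
      have "Q x \<rho> = R UNIV (mrg (\<lambda>i. case i of 0 \<Rightarrow> x | Suc k \<Rightarrow> \<rho> k) c)"
        using R(2)[of "\<lambda>i. case i of 0 \<Rightarrow> x | Suc k \<Rightarrow> \<rho> k"] by simp
      also have "mrg (\<lambda>i. case i of 0 \<Rightarrow> x | Suc k \<Rightarrow> \<rho> k) c = (\<lambda>i. if g i = 0 then x else mrg \<rho> c (g i - 1))"
      proof
        fix i
        show "mrg (\<lambda>i. case i of 0 \<Rightarrow> x | Suc k \<Rightarrow> \<rho> k) c i = (if g i = 0 then x else mrg \<rho> c (g i - 1))"
        proof (cases "even i \<and> i \<noteq> 0")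
          case True
          then obtain k where "i = 2 * Suc k" by (metis evenE mult_0_right not0_implies_Suc)
          then show ?thesis by (simp add: mrg_def g_def)
        next
          case False
          then show ?thesis by (cases "i = 0") (simp_all add: mrg_def g_def)
        qed
      qed
      finally show ?thesis .
    qed
    then show ?thesis by (simp add: R'_def)
  qed
  ultimately show ?thesis unfolding vdef_def by blast
qed

lemma vdef_ex:
  assumes "vdef (\<lambda>\<rho>. Q (\<rho> 0) (\<lambda>i. \<rho> (Suc i)))"
  shows "vdef (\<lambda>\<rho>. \<exists>x. Q x \<rho>)"
  using vdef_neg[OF vdef_all, of "\<lambda>x \<rho>. \<not> Q x \<rho>"] vdef_neg[OF assms] by simp

lemma vdef_udef: "udef P \<Longrightarrow> vdef (P UNIV)"
  using udef_ren[of P "\<lambda>i. 2 * i"] unfolding vdef_def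
  by (intro exI[of _ "\<lambda>N \<rho>. P N (\<lambda>i. \<rho> (2 * i))"]) (simp add: mrg_def)

lemma vterm_var: "vterm (\<lambda>\<rho>. \<rho> i)"
  unfolding vterm_def using vdef_udef[OF udef_eq[of 0 "Suc i"]] by simp

lemma vterm_const: "vterm (\<lambda>\<rho>. a)"
  unfolding vterm_def vdef_def
  by (rule exI[of _ "\<lambda>N \<rho>. \<rho> 0 = \<rho> 1"], rule exI[of _ "\<lambda>_. a"]) (auto simp: mrg_def udef_eq)

lemma vterm_ren: assumes "vterm t" shows "vterm (\<lambda>\<rho>. t (\<lambda>i. \<rho> (f i)))"
  using vdef_ren[OF assms[unfolded vterm_def], of "\<lambda>i. case i of 0 \<Rightarrow> 0 | Suc k \<Rightarrow> Suc (f k)"]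
  unfolding vterm_def by simp

lemma vdef_atom:
  assumes "vterm s" "vterm t" "udef (\<lambda>N \<rho>. R (\<rho> 0) (\<rho> 1))"
  shows "vdef (\<lambda>\<rho>. R (s \<rho>) (t \<rho>))"
proof -
  have 1: "vdef (\<lambda>\<rho>. \<rho> 0 = s (\<lambda>i. \<rho> (Suc (Suc i))))"
    using vterm_ren[OF assms(1), of Suc]
      vdef_ren[OF assms(1)[unfolded vterm_def], of "\<lambda>i. case i of 0 \<Rightarrow> 0 | Suc k \<Rightarrow> Suc (Suc k)"] by simp
  have 2: "vdef (\<lambda>\<rho>. \<rho> (Suc 0) = t (\<lambda>i. \<rho> (Suc (Suc i))))"
    using vdef_ren[OF assms(2)[unfolded vterm_def], of "\<lambda>i. case i of 0 \<Rightarrow> 1 | Suc k \<Rightarrow> Suc (Suc k)"] by simp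
  have 3: "vdef (\<lambda>\<rho>. R (\<rho> 0) (\<rho> (Suc 0)))" using vdef_udef[OF assms(3)] by simp
  have "vdef (\<lambda>\<rho>. \<exists>y x. x = s \<rho> \<and> y = t \<rho> \<and> R x y)"
    by (intro vdef_ex vdef_conj) (use 1 2 3 in simp_all)
  then show ?thesis by simp
qed

lemma vdef_mem: "vterm s \<Longrightarrow> vterm t \<Longrightarrow> vdef (\<lambda>\<rho>. s \<rho> \<epsilon> t \<rho>)"
  by (rule vdef_atom[where R=mem]) (auto intro: udef_mem)

lemma vdef_eq: "vterm s \<Longrightarrow> vterm t \<Longrightarrow> vdef (\<lambda>\<rho>. s \<rho> = t \<rho>)"
  by (rule vdef_atom) (auto intro: udef_eq)

text \<open>Terms are substituted semantically, by recursion on the formula, so no syntactic capture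
  arises: below a quantifier every term is shifted to ignore the new variable, except the one for
  the bound variable, which becomes that variable.\<close>

lemma vdef_satN: "(\<And>i. vterm (t i)) \<Longrightarrow> vdef (\<lambda>\<rho>. satN UNIV (\<lambda>i. t i \<rho>) \<phi>)"
proof (induction \<phi> arbitrary: t)
  case (All k \<phi>)
  define t' where "t' i = (if i = k then (\<lambda>\<rho>. \<rho> 0) else (\<lambda>\<rho>. t i (\<lambda>i. \<rho> (Suc i))))" for i
  have "vterm (t' i)" for i
  proof (cases "i = k")
    case False then show ?thesis unfolding t'_def using vterm_ren[OF All.prems[of i], of Suc] by simp
  qed (simp add: t'_def vterm_var)
  then have "vdef (\<lambda>\<rho>. satN UNIV (\<lambda>i. t' i \<rho>) \<phi>)" by (rule All.IH)
  moreover have eq: "(\<lambda>i. t' i \<rho>) = (\<lambda>i. t i (\<lambda>i. \<rho> (Suc i)))(k := \<rho> 0)" for \<rho>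
    by (rule ext) (simp add: t'_def)
  ultimately have "vdef (\<lambda>\<rho>. satN UNIV ((\<lambda>i. t i (\<lambda>i. \<rho> (Suc i)))(k := \<rho> 0)) \<phi>)"
    by (simp only: eq)
  then have "vdef (\<lambda>\<rho>. \<forall>x. satN UNIV ((\<lambda>i. t i \<rho>)(k := x)) \<phi>)"
    by (rule vdef_all)
  then show ?case by simp
next
  case (Mem i k) show ?case unfolding satG.simps by (rule vdef_mem; rule Mem)
next
  case (Eq i k) show ?case unfolding satG.simps by (rule vdef_eq; rule Eq)
next
  case (Neg \<phi>) show ?case unfolding satG.simps by (rule vdef_neg; rule Neg.IH; rule Neg.prems)
next
  case (Conj \<phi> \<psi>)
  show ?case unfolding satG.simps
    by (rule vdef_conj, rule Conj.IH(1), rule Conj.prems, rule Conj.IH(2), rule Conj.prems)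
qed

lemma vdef_subst_udef:
  assumes "udef P" "\<And>i. vterm (t i)" shows "vdef (\<lambda>\<rho>. P UNIV (\<lambda>i. t i \<rho>))"
proof -
  obtain \<phi> where "\<And>N \<rho>. P N \<rho> = satN N \<rho> \<phi>" using assms(1) unfolding udef_def by blast
  with vdef_satN[of t \<phi>, OF assms(2)] show ?thesis by (simp only:)
qed

lemma vdef_subst:
  assumes "vdef P" "\<And>i. vterm (t i)" shows "vdef (\<lambda>\<rho>. P (\<lambda>i. t i \<rho>))"
proof -
  obtain Q c where Q: "udef Q" "\<And>\<rho>. P \<rho> \<longleftrightarrow> Q UNIV (mrg \<rho> c)"
    using assms unfolding vdef_def by blast
  define t' where "t' i = (if even i then t (i div 2) else (\<lambda>_. c (i div 2)))" for i
  have "vterm (t' i)" for i unfolding t'_def using assms(2) vterm_const[of "c (i div 2)"] by simp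
  from vdef_subst_udef[OF Q(1), of t', OF this] have "vdef (\<lambda>\<rho>. Q UNIV (\<lambda>i. t' i \<rho>))" .
  moreover have "(\<lambda>i. t' i \<rho>) = mrg (\<lambda>i. t i \<rho>) c" for \<rho>
    by (rule ext) (simp add: mrg_def t'_def)
  ultimately show ?thesis unfolding Q(2) by (simp only:)
qed

lemma vterm_subst:
  assumes "vterm s" "\<And>i. vterm (t i)" shows "vterm (\<lambda>\<rho>. s (\<lambda>i. t i \<rho>))"
proof -
  define t' where "t' i = (case i of 0 \<Rightarrow> (\<lambda>\<rho>. \<rho> 0) | Suc k \<Rightarrow> (\<lambda>\<rho>. t k (\<lambda>i. \<rho> (Suc i))))" for i
  have "vterm (t' i)" for i
  proof (cases i)
    case (Suc k) then show ?thesis unfolding t'_def using vterm_ren[OF assms(2)[of k], of Suc] by simp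
  qed (simp add: t'_def vterm_var)
  from vdef_subst[OF assms(1)[unfolded vterm_def], of t', OF this]
  show ?thesis by (simp add: vterm_def t'_def)
qed

text \<open>A finite list of arguments must become a total assignment. Repeating the last entry
  keeps all values inside any class that contains the list, and all terms among the definable
  ones.\<close>

definition elist :: "'a list \<Rightarrow> nat \<Rightarrow> 'a" where
  "elist xs i = (if i < length xs then xs ! i else last xs)"

lemma elist_simps [simp]:
  "elist [a] 0 = a" "elist [a,b] 0 = a" "elist [a,b] (Suc 0) = b"
  "elist [a,b,c] 0 = a" "elist [a,b,c] (Suc 0) = b" "elist [a,b,c] (Suc (Suc 0)) = c"
  "elist [a,b,c,d] 0 = a" "elist [a,b,c,d] (Suc 0) = b" "elist [a,b,c,d] (Suc (Suc 0)) = c"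
  "elist [a,b,c,d] (Suc (Suc (Suc 0))) = d"
  by (auto simp: elist_def)

lemma vterm_elist: "\<forall>t \<in> set ts. vterm t \<Longrightarrow> ts \<noteq> [] \<Longrightarrow> vterm (elist ts i)"
  unfolding elist_def by (cases "i < length ts") simp_all

lemma vdef_comp1:
  assumes "vdef (\<lambda>\<rho>. P (\<rho> 0))" "vterm a"
  shows "vdef (\<lambda>\<rho>. P (a \<rho>))"
proof -
  have "vterm (elist [a] i)" for i by (rule vterm_elist) (use assms in simp_all)
  from vdef_subst[OF assms(1), of "elist [a]", OF this] show ?thesis by simp
qed

lemma vdef_comp2:
  assumes "vdef (\<lambda>\<rho>. P (\<rho> 0) (\<rho> (Suc 0)))" "vterm a" "vterm b"
  shows "vdef (\<lambda>\<rho>. P (a \<rho>) (b \<rho>))"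
proof -
  have "vterm (elist [a,b] i)" for i by (rule vterm_elist) (use assms in simp_all)
  from vdef_subst[OF assms(1), of "elist [a,b]", OF this] show ?thesis by simp
qed

lemma vdef_comp3:
  assumes "vdef (\<lambda>\<rho>. P (\<rho> 0) (\<rho> (Suc 0)) (\<rho> (Suc (Suc 0))))" "vterm a" "vterm b" "vterm c"
  shows "vdef (\<lambda>\<rho>. P (a \<rho>) (b \<rho>) (c \<rho>))"
proof -
  have "vterm (elist [a,b,c] i)" for i by (rule vterm_elist) (use assms in simp_all)
  from vdef_subst[OF assms(1), of "elist [a,b,c]", OF this] show ?thesis by simp
qed

lemma vdef_comp4:
  assumes "vdef (\<lambda>\<rho>. P (\<rho> 0) (\<rho> (Suc 0)) (\<rho> (Suc (Suc 0))) (\<rho> (Suc (Suc (Suc 0)))))" "vterm a" "vterm b" "vterm c" "vterm d"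
  shows "vdef (\<lambda>\<rho>. P (a \<rho>) (b \<rho>) (c \<rho>) (d \<rho>))"
proof -
  have "vterm (elist [a,b,c,d] i)" for i by (rule vterm_elist) (use assms in simp_all)
  from vdef_subst[OF assms(1), of "elist [a,b,c,d]", OF this] show ?thesis by simp
qed

lemma vterm_comp1:
  assumes "vdef (\<lambda>\<rho>. \<rho> 0 = g (\<rho> (Suc 0)))" "vterm a"
  shows "vterm (\<lambda>\<rho>. g (a \<rho>))"
proof -
  have 1: "vterm (elist [a] i)" for i by (rule vterm_elist) (use assms in simp_all)
  have "vterm (\<lambda>\<rho>. g (\<rho> 0))" unfolding vterm_def by (rule assms(1))
  from vterm_subst[OF this, of "elist [a]", OF 1] show ?thesis by simp
qed

lemma vterm_comp2:
  assumes "vdef (\<lambda>\<rho>. \<rho> 0 = g (\<rho> (Suc 0)) (\<rho> (Suc (Suc 0))))" "vterm a" "vterm b"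
  shows "vterm (\<lambda>\<rho>. g (a \<rho>) (b \<rho>))"
proof -
  have 1: "vterm (elist [a,b] i)" for i by (rule vterm_elist) (use assms in simp_all)
  have "vterm (\<lambda>\<rho>. g (\<rho> 0) (\<rho> (Suc 0)))" unfolding vterm_def by (rule assms(1))
  from vterm_subst[OF this, of "elist [a,b]", OF 1] show ?thesis by simp
qed

lemma vterm_app1: "vterm (\<lambda>\<rho>. g (\<rho> 0)) \<Longrightarrow> vterm a \<Longrightarrow> vterm (\<lambda>\<rho>. g (a \<rho>))"
  by (rule vterm_comp1) (simp_all add: vterm_def)

lemmas vdef_intros = vdef_mem vdef_eq vdef_neg vdef_conj vdef_disj vdef_imp vdef_iff vdef_all vdef_ex

section \<open>Set existence from the axiom schemes, and set operations as definable terms\<close>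

lemma zext: "(\<And>z. z \<epsilon> x \<longleftrightarrow> z \<epsilon> y) \<Longrightarrow> x = (y :: 'v::zfc)"
  using extensionality by blast

lemma THE_set:
  fixes P :: "'v::zfc \<Rightarrow> bool"
  assumes "\<exists>b. \<forall>x. x \<epsilon> b \<longleftrightarrow> P x"
  shows "x \<epsilon> (THE b. \<forall>x. x \<epsilon> b \<longleftrightarrow> P x) \<longleftrightarrow> P x"
proof -
  have "\<exists>!b. \<forall>x. x \<epsilon> b \<longleftrightarrow> P x" using assms zext by metis
  from theI'[OF this] show ?thesis by blast
qed

text \<open>The whole assignment apart from one variable is frozen into parameters; this makes the
  one-variable form of Separation available inside a definition that still has other free
  variables.\<close>

lemma vdef_fix:
  assumes "vdef (\<lambda>\<rho>. P (\<rho> 0) (\<lambda>i. \<rho> (Suc i)))" shows "vdef (\<lambda>\<rho>. P (\<rho> 0) \<sigma>)"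
proof -
  have "vterm ((case i of 0 \<Rightarrow> (\<lambda>\<rho>. \<rho> 0) | Suc k \<Rightarrow> (\<lambda>\<rho>. \<sigma> k)))" for i
    by (cases i) (simp_all add: vterm_var vterm_const)
  from vdef_subst[OF assms, of "\<lambda>i. case i of 0 \<Rightarrow> (\<lambda>\<rho>. \<rho> 0) | Suc k \<Rightarrow> (\<lambda>\<rho>. \<sigma> k)", OF this]
  show ?thesis by simp
qed

lemma vterm_fix:
  assumes "vterm (\<lambda>\<rho>. P (\<rho> 0) (\<lambda>i. \<rho> (Suc i)))" shows "vterm (\<lambda>\<rho>. P (\<rho> 0) \<sigma>)"
proof -
  have "vterm ((case i of 0 \<Rightarrow> (\<lambda>\<rho>. \<rho> 0) | Suc k \<Rightarrow> (\<lambda>\<rho>. \<sigma> k)))" for i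
    by (cases i) (simp_all add: vterm_var vterm_const)
  from vterm_subst[OF assms, of "\<lambda>i. case i of 0 \<Rightarrow> (\<lambda>\<rho>. \<rho> 0) | Suc k \<Rightarrow> (\<lambda>\<rho>. \<sigma> k)", OF this]
  show ?thesis by simp
qed

lemma separation_vdef:
  assumes "vdef (\<lambda>\<rho>. P (\<rho> 0))" shows "\<exists>b. \<forall>x. x \<epsilon> b \<longleftrightarrow> x \<epsilon> a \<and> P x"
proof -
  obtain Q c where Q: "udef Q" "\<And>\<rho>. P (\<rho> 0) \<longleftrightarrow> Q UNIV (mrg \<rho> c)"
    using assms unfolding vdef_def by blast
  obtain \<phi> where \<phi>: "\<And>N \<rho>. Q N \<rho> = satN N \<rho> \<phi>" using Q(1) unfolding udef_def by blast
  have "P x \<longleftrightarrow> sat mem ((mrg (\<lambda>_. a) c)(0 := x)) \<phi>" for x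
  proof -
    have "mrg ((\<lambda>_. a)(0 := x)) c = (mrg (\<lambda>_. a) c)(0 := x)"
      by (rule ext) (auto simp: mrg_def elim!: evenE)
    then show ?thesis using Q(2)[of "(\<lambda>_. a)(0 := x)"] by (simp add: sat_eq_satN \<phi>)
  qed
  then show ?thesis using separation by simp
qed

lemma replacement_vdef:
  assumes "vdef (\<lambda>\<rho>. R (\<rho> 0) (\<rho> (Suc 0)))" and "\<And>x. x \<epsilon> a \<Longrightarrow> \<exists>!y. R x y"
  shows "\<exists>b. \<forall>y. y \<epsilon> b \<longleftrightarrow> (\<exists>x. x \<epsilon> a \<and> R x y)"
proof -
  obtain Q c where Q: "udef Q" "\<And>\<rho>. R (\<rho> 0) (\<rho> (Suc 0)) \<longleftrightarrow> Q UNIV (mrg \<rho> c)"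
    using assms unfolding vdef_def by blast
  \<comment> \<open>The axiom scheme reserves variables 0 and 1 for argument and value.
    \<open>h\<close> moves the two argument positions there and sends the parameters to the
    variables from 2 on.\<close>
  define h :: "nat \<Rightarrow> nat" where "h i = (if even i then if i = 0 then 0 else 1 else Suc (Suc (i div 2)))" for i
  obtain \<phi> where \<phi>: "\<And>N \<rho>. Q N (\<lambda>i. \<rho> (h i)) = satN N \<rho> \<phi>"
    using udef_ren[OF Q(1), of h] unfolding udef_def by blast
  have "R x y \<longleftrightarrow> sat mem ((\<lambda>i. c (i - 2))(0 := x, 1 := y)) \<phi>" for x y
  proof -
    have "mrg (\<lambda>i. if i = 0 then x else y) c = (\<lambda>i. ((\<lambda>i. c (i - 2))(0 := x, 1 := y)) (h i))"
      by (rule ext) (auto simp: mrg_def h_def)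
    then show ?thesis using Q(2)[of "\<lambda>i. if i = 0 then x else y"] by (simp add: sat_eq_satN \<phi>[symmetric])
  qed
  then show ?thesis using replacement[of a "\<lambda>i. c (i - 2)" \<phi>] assms(2) by simp
qed

text \<open>Set operations as total functions. The values of \<open>zsep\<close> and \<open>zrep\<close> are meaningful only for
  definable arguments; otherwise the description may fail to denote.\<close>

definition zsep :: "'v::zfc \<Rightarrow> ('v \<Rightarrow> bool) \<Rightarrow> 'v" where
  "zsep a P = (THE b. \<forall>x. x \<epsilon> b \<longleftrightarrow> x \<epsilon> a \<and> P x)"

definition zrep :: "'v::zfc \<Rightarrow> ('v \<Rightarrow> 'v) \<Rightarrow> 'v" where
  "zrep a G = (THE b. \<forall>y. y \<epsilon> b \<longleftrightarrow> (\<exists>x. x \<epsilon> a \<and> y = G x))"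

definition zU :: "'v::zfc \<Rightarrow> 'v" where "zU a = (THE b. \<forall>x. x \<epsilon> b \<longleftrightarrow> (\<exists>y. y \<epsilon> a \<and> x \<epsilon> y))"

definition zP :: "'v::zfc \<Rightarrow> 'v" where "zP a = (THE b. \<forall>x. x \<epsilon> b \<longleftrightarrow> (\<forall>y. y \<epsilon> x \<longrightarrow> y \<epsilon> a))"

definition upair :: "'v::zfc \<Rightarrow> 'v \<Rightarrow> 'v" where "upair a c = (THE b. \<forall>x. x \<epsilon> b \<longleftrightarrow> x = a \<or> x = c)"

lemma zsep: "vdef (\<lambda>\<rho>. P (\<rho> 0)) \<Longrightarrow> x \<epsilon> zsep a P \<longleftrightarrow> x \<epsilon> a \<and> P x"
  unfolding zsep_def by (rule THE_set, rule separation_vdef)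

lemma zrep: assumes "vterm (\<lambda>\<rho>. G (\<rho> 0))" shows "y \<epsilon> zrep a G \<longleftrightarrow> (\<exists>x. x \<epsilon> a \<and> y = G x)"
proof -
  have "vdef (\<lambda>\<rho>. \<rho> (Suc 0) = G (\<rho> 0))"
    using vdef_ren[OF assms[unfolded vterm_def], of "\<lambda>i. if i = 0 then 1 else 0"] by simp
  then have "\<exists>b. \<forall>y. y \<epsilon> b \<longleftrightarrow> (\<exists>x. x \<epsilon> a \<and> y = G x)"
    by (rule replacement_vdef[where R="\<lambda>x y. y = G x"]) simp
  then show ?thesis unfolding zrep_def by (rule THE_set)
qed

lemma zU_iff [simp]: "x \<epsilon> zU a \<longleftrightarrow> (\<exists>y. y \<epsilon> a \<and> x \<epsilon> y)"
  unfolding zU_def by (rule THE_set, rule union)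

lemma zP_iff [simp]: "x \<epsilon> zP a \<longleftrightarrow> (\<forall>y. y \<epsilon> x \<longrightarrow> y \<epsilon> a)"
  unfolding zP_def by (rule THE_set, rule power_set)

lemma upair_iff [simp]: "x \<epsilon> upair a c \<longleftrightarrow> x = a \<or> x = c"
  unfolding upair_def by (rule THE_set, rule pairing)

lemma eq_zU_iff: "y = zU a \<longleftrightarrow> (\<forall>x. x \<epsilon> y \<longleftrightarrow> (\<exists>z. z \<epsilon> a \<and> x \<epsilon> z))"
  by (metis zU_iff zext)

lemma eq_zP_iff: "y = zP a \<longleftrightarrow> (\<forall>x. x \<epsilon> y \<longleftrightarrow> (\<forall>z. z \<epsilon> x \<longrightarrow> z \<epsilon> a))"
  by (metis zP_iff zext)

lemma eq_upair_iff: "y = upair a b \<longleftrightarrow> (\<forall>x. x \<epsilon> y \<longleftrightarrow> x = a \<or> x = b)"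
  by (metis upair_iff zext)

lemma vterm_zU: "vterm a \<Longrightarrow> vterm (\<lambda>\<rho>. zU (a \<rho>))"
  by (rule vterm_comp1[where g=zU]; simp only: eq_zU_iff) (intro vdef_intros vterm_var)

lemma vterm_zP: "vterm a \<Longrightarrow> vterm (\<lambda>\<rho>. zP (a \<rho>))"
  by (rule vterm_comp1[where g=zP]; simp only: eq_zP_iff) (intro vdef_intros vterm_var)

lemma vterm_upair: "vterm a \<Longrightarrow> vterm b \<Longrightarrow> vterm (\<lambda>\<rho>. upair (a \<rho>) (b \<rho>))"
  by (rule vterm_comp2[where g=upair]; simp only: eq_upair_iff) (intro vdef_intros vterm_var)

lemma vterm_zsep:
  assumes a: "vterm a" and P: "vdef (\<lambda>\<rho>. P (\<rho> 0) (\<lambda>i. \<rho> (Suc i)))"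
  shows "vterm (\<lambda>\<rho>. zsep (a \<rho>) (\<lambda>x. P x \<rho>))"
proof -
  have eq: "y = zsep (a \<rho>) (\<lambda>x. P x \<rho>) \<longleftrightarrow> (\<forall>x. x \<epsilon> y \<longleftrightarrow> x \<epsilon> a \<rho> \<and> P x \<rho>)" for y \<rho>
    using zsep[OF vdef_fix[OF P, of \<rho>], of _ "a \<rho>"] zext[of y "zsep (a \<rho>) (\<lambda>x. P x \<rho>)"] by blast
  have P': "vdef (\<lambda>\<rho>. P (\<rho> 0) (\<lambda>i. \<rho> (Suc (Suc i))))"
    using vdef_ren[OF P, of "\<lambda>i. case i of 0 \<Rightarrow> 0 | Suc k \<Rightarrow> Suc (Suc k)"] by simp
  show ?thesis unfolding vterm_def eq
    by (intro vdef_intros vterm_var vterm_ren[OF a] P')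
qed

lemma vterm_zrep:
  assumes a: "vterm a" and G: "vterm (\<lambda>\<rho>. G (\<rho> 0) (\<lambda>i. \<rho> (Suc i)))"
  shows "vterm (\<lambda>\<rho>. zrep (a \<rho>) (\<lambda>x. G x \<rho>))"
proof -
  have eq: "y = zrep (a \<rho>) (\<lambda>x. G x \<rho>) \<longleftrightarrow> (\<forall>z. z \<epsilon> y \<longleftrightarrow> (\<exists>x. x \<epsilon> a \<rho> \<and> z = G x \<rho>))" for y \<rho>
    using zrep[OF vterm_fix[OF G, of \<rho>], of _ "a \<rho>"] zext[of y "zrep (a \<rho>) (\<lambda>x. G x \<rho>)"] by blast
  have G': "vterm (\<lambda>\<rho>. G (\<rho> 0) (\<lambda>i. \<rho> (Suc (Suc (Suc i)))))"
    using vterm_ren[OF G, of "\<lambda>i. case i of 0 \<Rightarrow> 0 | Suc k \<Rightarrow> Suc (Suc (Suc k))"] by simp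
  show ?thesis unfolding vterm_def eq
    by (intro vdef_intros vterm_var vterm_ren[OF a] G')
qed

lemma vterm_If:
  assumes P: "vdef P" and s: "vterm s" and t: "vterm t"
  shows "vterm (\<lambda>\<rho>. if P \<rho> then s \<rho> else t \<rho>)"
proof -
  have eq: "y = (if b then u else v) \<longleftrightarrow> (b \<and> y = u) \<or> (\<not> b \<and> y = v)" for b and y u v :: 'a by simp
  show ?thesis unfolding vterm_def eq
    by (intro vdef_intros vterm_var vterm_ren[OF s] vterm_ren[OF t] vdef_ren[OF P])
qed

lemma vterm_THE:
  assumes ex: "\<And>\<rho>. \<exists>!y. R y \<rho>" and R: "vdef (\<lambda>\<rho>. R (\<rho> 0) (\<lambda>i. \<rho> (Suc i)))"
  shows "vterm (\<lambda>\<rho>. THE y. R y \<rho>)"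
proof -
  have "y = (THE y. R y \<rho>) \<longleftrightarrow> R y \<rho>" for y \<rho>
    using theI'[OF ex[of \<rho>]] ex[of \<rho>] by blast
  then show ?thesis unfolding vterm_def using R by simp
qed

definition opair :: "'v::zfc \<Rightarrow> 'v \<Rightarrow> 'v" where "opair a b = upair (upair a a) (upair a b)"

definition un2 :: "'v::zfc \<Rightarrow> 'v \<Rightarrow> 'v" where "un2 a b = zU (upair a b)"

text \<open>The union over the set of values at \<open>x\<close>: where the value is unique, the
  union of its singleton is the value itself. This form is built from definable terms and is
  total.\<close>

definition fval :: "'v::zfc \<Rightarrow> 'v \<Rightarrow> 'v" where "fval f x = zU (zsep (zU (zU f)) (\<lambda>y. opair x y \<epsilon> f))"

definition lam :: "'v::zfc \<Rightarrow> ('v \<Rightarrow> 'v) \<Rightarrow> 'v" where "lam a G = zrep a (\<lambda>x. opair x (G x))"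

definition restr :: "'v::zfc \<Rightarrow> 'v \<Rightarrow> 'v" where
  "restr f a = zsep f (\<lambda>p. \<exists>x y. x \<epsilon> a \<and> p = opair x y)"

definition zemp :: "'v::zfc" where "zemp = zsep undefined (\<lambda>_. False)"

lemma vterm_opair: "vterm a \<Longrightarrow> vterm b \<Longrightarrow> vterm (\<lambda>\<rho>. opair (a \<rho>) (b \<rho>))"
  unfolding opair_def by (intro vterm_upair)

lemma vterm_un2: "vterm a \<Longrightarrow> vterm b \<Longrightarrow> vterm (\<lambda>\<rho>. un2 (a \<rho>) (b \<rho>))"
  unfolding un2_def by (intro vterm_upair vterm_zU)

lemmas definable_sets = vdef_intros vterm_var vterm_const vterm_zU vterm_zP vterm_upair vterm_opair vterm_un2
  vterm_zsep vterm_zrep vterm_If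

lemma vdef_const: "vdef (\<lambda>\<rho>. b)"
  using vdef_udef[OF udef_const[of b]] by simp

lemma zemp [simp]: "\<not> x \<epsilon> zemp"
  unfolding zemp_def by (subst zsep) (auto intro: vdef_const)

lemma opair_inj [simp]: "opair a b = opair c d \<longleftrightarrow> a = c \<and> b = d"
  unfolding opair_def by (metis upair_iff)

lemma un2_iff [simp]: "x \<epsilon> un2 a b \<longleftrightarrow> x \<epsilon> a \<or> x \<epsilon> b"
  unfolding un2_def by auto

lemma vterm_fval: "vterm f \<Longrightarrow> vterm x \<Longrightarrow> vterm (\<lambda>\<rho>. fval (f \<rho>) (x \<rho>))"
  by (rule vterm_comp2[where g=fval]; simp only: fval_def vterm_def[symmetric]) (intro definable_sets)+

lemma vterm_restr: "vterm f \<Longrightarrow> vterm a \<Longrightarrow> vterm (\<lambda>\<rho>. restr (f \<rho>) (a \<rho>))"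
  by (rule vterm_comp2[where g=restr]; simp only: restr_def vterm_def[symmetric]) (intro definable_sets)+

lemma vterm_lam: "vterm a \<Longrightarrow> vterm (\<lambda>\<rho>. G (\<rho> 0) (\<lambda>i. \<rho> (Suc i))) \<Longrightarrow> vterm (\<lambda>\<rho>. lam (a \<rho>) (\<lambda>x. G x \<rho>))"
  unfolding lam_def by (intro definable_sets)

section \<open>The relativized notions evaluated in the universe\<close>

lemma is_upair_iff [simp]: "is_upair UNIV x y p \<longleftrightarrow> p = upair x y"
  unfolding is_upair_def by (auto intro: zext)

lemma is_pair_iff [simp]: "is_pair UNIV x y p \<longleftrightarrow> p = opair x y"
  unfolding is_pair_def opair_def by simp

lemma app_iff [simp]: "app UNIV f x y \<longleftrightarrow> opair x y \<epsilon> f"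
  unfolding app_def by simp

lemma is_union2_iff [simp]: "is_union2 UNIV a b c \<longleftrightarrow> c = un2 a b"
  unfolding is_union2_def by (auto intro: zext)

lemma is_Union_iff [simp]: "is_Union UNIV a c \<longleftrightarrow> c = zU a"
  unfolding is_Union_def by (auto intro: zext)

lemma is_empty_iff [simp]: "is_empty UNIV a \<longleftrightarrow> a = zemp"
  unfolding is_empty_def by (auto intro: zext)

lemma restr_iff: "p \<epsilon> restr f a \<longleftrightarrow> p \<epsilon> f \<and> (\<exists>x y. x \<epsilon> a \<and> p = opair x y)"
  unfolding restr_def by (rule zsep) (intro definable_sets)

lemma opair_restr_iff [simp]: "opair x y \<epsilon> restr f a \<longleftrightarrow> opair x y \<epsilon> f \<and> x \<epsilon> a"
  by (auto simp: restr_iff)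

lemma is_restrict_iff [simp]: "is_restrict UNIV f a g \<longleftrightarrow> g = restr f a"
  unfolding is_restrict_def by (auto simp: restr_iff intro!: zext)

abbreviation fun_on :: "'v::zfc \<Rightarrow> 'v \<Rightarrow> bool" where "fun_on \<equiv> is_fun_on UNIV"

lemma fun_on_iff: "fun_on f a \<longleftrightarrow>
    (\<forall>p. p \<epsilon> f \<longrightarrow> (\<exists>x y. x \<epsilon> a \<and> p = opair x y)) \<and> (\<forall>x. x \<epsilon> a \<longrightarrow> (\<exists>!y. opair x y \<epsilon> f))"
  unfolding is_fun_on_def by simp

lemma vdef_fun_on:
  assumes "vterm f" "vterm a" shows "vdef (\<lambda>\<rho>. fun_on (f \<rho>) (a \<rho>))"
proof -
  have "vdef (\<lambda>\<rho>. fun_on (\<rho> 0) (\<rho> (Suc 0)))"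
    unfolding fun_on_iff Ex1_def by (intro definable_sets)
  from vdef_comp2[OF this assms] show ?thesis .
qed

lemma opair_in_fld: assumes "opair x y \<epsilon> f" shows "y \<epsilon> zU (zU f) \<and> x \<epsilon> zU (zU f)"
proof -
  have "upair x y \<epsilon> opair x y" by (simp add: opair_def)
  then have "upair x y \<epsilon> zU f" using assms zU_iff by blast
  moreover have "x \<epsilon> upair x y" "y \<epsilon> upair x y" by simp_all
  ultimately show ?thesis using zU_iff by blast
qed

lemma fval_eqI:
  assumes "opair x y \<epsilon> f" "\<And>z. opair x z \<epsilon> f \<Longrightarrow> z = y" shows "fval f x = y"
proof -
  have z: "z \<epsilon> zsep (zU (zU f)) (\<lambda>y. opair x y \<epsilon> f) \<longleftrightarrow> z \<epsilon> zU (zU f) \<and> opair x z \<epsilon> f" for z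
    by (rule zsep) (intro definable_sets)
  have "z \<epsilon> zsep (zU (zU f)) (\<lambda>y. opair x y \<epsilon> f) \<longleftrightarrow> z = y" for z
    unfolding z using assms opair_in_fld by blast
  then show ?thesis unfolding fval_def by (intro zext) (simp add: zU_iff)
qed

lemma fun_on_fval: "fun_on f a \<Longrightarrow> x \<epsilon> a \<Longrightarrow> opair x y \<epsilon> f \<longleftrightarrow> y = fval f x"
  unfolding fun_on_iff by (metis fval_eqI)

lemma fun_on_dom: "fun_on f a \<Longrightarrow> opair x y \<epsilon> f \<Longrightarrow> x \<epsilon> a"
  unfolding fun_on_iff by (metis opair_inj)

lemma lam_iff: "vterm (\<lambda>\<rho>. G (\<rho> 0)) \<Longrightarrow> p \<epsilon> lam a G \<longleftrightarrow> (\<exists>x. x \<epsilon> a \<and> p = opair x (G x))"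
  unfolding lam_def by (rule zrep) (intro definable_sets)

lemma lam_opair: "vterm (\<lambda>\<rho>. G (\<rho> 0)) \<Longrightarrow> opair x y \<epsilon> lam a G \<longleftrightarrow> x \<epsilon> a \<and> y = G x"
  by (simp add: lam_iff)

lemma lam_fun_on: "vterm (\<lambda>\<rho>. G (\<rho> 0)) \<Longrightarrow> fun_on (lam a G) a"
  by (simp add: fun_on_iff lam_iff) blast

lemma lam_fval: "vterm (\<lambda>\<rho>. G (\<rho> 0)) \<Longrightarrow> x \<epsilon> a \<Longrightarrow> fval (lam a G) x = G x"
  by (rule fval_eqI) (simp_all add: lam_opair)

lemmas definable_intros = definable_sets vterm_fval vterm_restr vterm_lam vdef_fun_on

lemma not_self [simp]: "\<not> x \<epsilon> x"
proof
  assume "x \<epsilon> x"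
  then obtain y where "y \<epsilon> upair x x" "\<forall>z. z \<epsilon> upair x x \<longrightarrow> \<not> z \<epsilon> y" 
    using foundation[of "upair x x"] by auto
  then show False using \<open>x \<epsilon> x\<close> by simp
qed

lemma not_cycle2: "x \<epsilon> y \<Longrightarrow> \<not> y \<epsilon> x"
proof
  assume a: "x \<epsilon> y" "y \<epsilon> x"
  then obtain z where "z \<epsilon> upair x y" "\<forall>w. w \<epsilon> upair x y \<longrightarrow> \<not> w \<epsilon> z" 
    using foundation[of "upair x y"] by auto
  then show False using a by auto
qed

section \<open>Recursion, transitive closures and Collection\<close>

text \<open>Partial solutions on sets closed under \<open>r\<close>-predecessors agree, by a minimal
  disagreement, so their common value \<open>v\<close> is definable. A minimal point covered by no
  partial solution could be added to the covered ones with the value that the recursion prescribes,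
  so all of \<open>D\<close> is covered. Well-foundedness is used for subsets of \<open>D\<close>
  only, as sets are all that foundation and \<open>ult_wellfounded\<close> speak about.\<close>

lemma wf_recursion:
  fixes D :: "'v::zfc"
  assumes r: "vdef (\<lambda>\<rho>. r (\<rho> 0) (\<rho> (Suc 0)))" and G: "vterm (\<lambda>\<rho>. G (\<rho> 0))"
    and wf: "\<And>X. \<exists>x. x \<epsilon> X \<Longrightarrow> (\<And>x. x \<epsilon> X \<Longrightarrow> x \<epsilon> D) \<Longrightarrow> \<exists>m. m \<epsilon> X \<and> (\<forall>q. q \<epsilon> X \<longrightarrow> \<not> r q m)"
  shows "\<exists>g. fun_on g D \<and> (\<forall>p. p \<epsilon> D \<longrightarrow> fval g p = G (zrep (zsep D (\<lambda>q. r q p)) (fval g)))"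
proof -
  note rr = vdef_comp2[OF r] and GG = vterm_comp1[OF G[unfolded vterm_def]]
  define pred where "pred p = zsep D (\<lambda>q. r q p)" for p
  have vpred: "vterm s \<Longrightarrow> vterm (\<lambda>\<rho>. pred (s \<rho>))" for s
    by (erule vterm_app1[rotated]) (unfold pred_def, intro definable_intros rr)
  have pred: "q \<epsilon> pred p \<longleftrightarrow> q \<epsilon> D \<and> r q p" for q p
    unfolding pred_def by (rule zsep) (intro definable_intros rr)
  define appr where "appr f A \<longleftrightarrow> (\<forall>p. p \<epsilon> A \<longrightarrow> p \<epsilon> D) \<and> (\<forall>p q. p \<epsilon> A \<and> q \<epsilon> pred p \<longrightarrow> q \<epsilon> A) \<and>
    fun_on f A \<and> (\<forall>p. p \<epsilon> A \<longrightarrow> fval f p = G (zrep (pred p) (fval f)))" for f A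
  have vappr: "vdef (\<lambda>\<rho>. appr (s \<rho>) (t \<rho>))" if "vterm s" "vterm t" for s t
    by (rule vdef_comp2[OF _ that]) (unfold appr_def, intro definable_intros GG vpred)
  have rep_cong: "zrep A f = zrep A g" if "vterm (\<lambda>\<rho>. f (\<rho> 0))" "vterm (\<lambda>\<rho>. g (\<rho> 0))"
    "\<And>x. x \<epsilon> A \<Longrightarrow> f x = g x" for A :: 'v and f g
    using that by (intro zext) (auto simp: zrep)
  have vf: "vterm (\<lambda>\<rho>. fval f (\<rho> 0))" for f :: 'v by (intro definable_intros)
  have agree: "fval f p = fval f' p" if 1: "appr f A" "appr f' A'" and 2: "p \<epsilon> A" "p \<epsilon> A'" for f A f' A' p
  proof (rule ccontr)
    assume ne: "fval f p \<noteq> fval f' p"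
    define X where "X = zsep A (\<lambda>p. p \<epsilon> A' \<and> fval f p \<noteq> fval f' p)"
    have X: "q \<epsilon> X \<longleftrightarrow> q \<epsilon> A \<and> q \<epsilon> A' \<and> fval f q \<noteq> fval f' q" for q
      unfolding X_def by (rule zsep) (intro definable_intros)
    obtain m where m: "m \<epsilon> X" "\<And>q. q \<epsilon> X \<Longrightarrow> \<not> r q m"
      using wf[of X] ne 1 2 unfolding X appr_def by blast
    have "zrep (pred m) (fval f) = zrep (pred m) (fval f')"
      by (rule rep_cong[OF vf vf]) (use m 1 in \<open>unfold X appr_def, meson pred\<close>)
    then show False using m 1 unfolding X appr_def by metis
  qed
  \<comment> \<open>The default \<open>zemp\<close> makes \<open>w\<close> functional everywhere, so
    that \<open>v\<close> is a definable term before totality on \<open>D\<close> is known.\<close>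
  define w where "w p y \<longleftrightarrow> (\<exists>f A. appr f A \<and> p \<epsilon> A \<and> y = fval f p) \<or> (\<not> (\<exists>f A. appr f A \<and> p \<epsilon> A) \<and> y = zemp)" for p y
  have ex1: "\<exists>!y. w p y" for p unfolding w_def using agree by (metis (no_types))
  define v where "v p = (THE y. w p y)" for p
  have vv: "vterm (\<lambda>\<rho>. v (s \<rho>))" if "vterm s" for s
  proof (rule vterm_app1[OF _ that])
    show "vterm (\<lambda>\<rho>. v (\<rho> 0))" unfolding v_def
      by (rule vterm_THE[where R="\<lambda>y \<rho>. w (\<rho> 0) y", OF ex1]) (unfold w_def, intro definable_intros vappr)
  qed
  have v: "v p = fval f p" if "appr f A" "p \<epsilon> A" for f A p
    unfolding v_def using that by (intro the1_equality ex1) (auto simp: w_def)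
  have veq: "v p = G (zrep (pred p) v)" and vcl: "q \<epsilon> pred p \<Longrightarrow> q \<epsilon> A" if "appr f A" "p \<epsilon> A" for f A p q
  proof -
    show cl: "q \<epsilon> pred p \<Longrightarrow> q \<epsilon> A" for q using that unfolding appr_def by blast
    have "zrep (pred p) (fval f) = zrep (pred p) v"
      by (rule rep_cong[OF vf]) (use v[OF that(1)] cl in \<open>auto intro: vv vterm_var\<close>)
    then show "v p = G (zrep (pred p) v)" using v[OF that] that unfolding appr_def by auto
  qed
  have tot: "\<exists>f A. appr f A \<and> p \<epsilon> A" if pD: "p \<epsilon> D" for p
  proof (rule ccontr)
    assume no: "\<nexists>f A. appr f A \<and> p \<epsilon> A"
    define X where "X = zsep D (\<lambda>p. \<nexists>f A. appr f A \<and> p \<epsilon> A)"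
    have X: "q \<epsilon> X \<longleftrightarrow> q \<epsilon> D \<and> (\<nexists>f A. appr f A \<and> q \<epsilon> A)" for q
      unfolding X_def by (rule zsep) (intro definable_intros vappr)
    obtain m where m: "m \<epsilon> X" "\<And>q. q \<epsilon> X \<Longrightarrow> \<not> r q m"
      using wf[of X] no pD unfolding X by blast
    \<comment> \<open>All points already covered together with the minimal uncovered one; minimality
      makes this set closed under predecessors.\<close>
    define A where "A = zsep D (\<lambda>p. (\<exists>f A. appr f A \<and> p \<epsilon> A) \<or> p = m)"
    have A: "q \<epsilon> A \<longleftrightarrow> q \<epsilon> D \<and> ((\<exists>f A. appr f A \<and> q \<epsilon> A) \<or> q = m)" for q
      unfolding A_def by (rule zsep) (intro definable_intros vappr)
    define v' where "v' p = (if p = m then G (zrep (pred m) v) else v p)" for p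
    have vv': "vterm (\<lambda>\<rho>. v' (\<rho> 0))" unfolding v'_def by (intro definable_intros GG vpred vv)
    have mm: "\<not> r m m"
      using m by blast
    have predm: "q \<epsilon> pred p \<Longrightarrow> q \<noteq> m" if "p \<epsilon> A" for p q
    proof
      assume "q \<epsilon> pred p" "q = m"
      show False
      proof (cases "p = m")
        case True then show False using mm \<open>q \<epsilon> pred p\<close> \<open>q = m\<close> pred by blast
      next
        case False
        then obtain f B where "appr f B" "p \<epsilon> B" using \<open>p \<epsilon> A\<close> A by blast
        then show False using vcl \<open>q \<epsilon> pred p\<close> \<open>q = m\<close> m(1) X by blast
      qed
    qed
    have cl: "q \<epsilon> A" if pq: "p \<epsilon> A" "q \<epsilon> pred p" for p q
    proof (cases "p = m")
      case True then show ?thesis using pq m(2) unfolding A X pred by blast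
    next
      case False
      then obtain f B where "appr f B" "p \<epsilon> B" using pq A by blast
      then show ?thesis using vcl pq(2) unfolding A pred by blast
    qed
    have "appr (lam A v') A"
      unfolding appr_def
    proof (intro conjI allI impI)
      fix p assume p: "p \<epsilon> A"
      have "zrep (pred p) (fval (lam A v')) = zrep (pred p) v"
      proof (rule rep_cong[OF vf])
        fix q assume q: "q \<epsilon> pred p"
        then have "fval (lam A v') q = v' q" using cl[OF p] by (intro lam_fval vv') auto
        then show "fval (lam A v') q = v q" using predm[OF p q] by (simp add: v'_def)
      qed (intro vv vterm_var)
      moreover have "v' p = G (zrep (pred p) v)"
        using p veq unfolding A v'_def by auto
      ultimately show "fval (lam A v') p = G (zrep (pred p) (fval (lam A v')))"
        using lam_fval[OF vv' p] by simp
    next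
      show "p \<epsilon> D" if "p \<epsilon> A" for p using that A by blast
      show "q \<epsilon> A" if "p \<epsilon> A \<and> q \<epsilon> pred p" for p q using that cl by blast
      show "fun_on (lam A v') A" by (rule lam_fun_on[OF vv'])
    qed
    moreover have "m \<epsilon> A" using m(1) unfolding A X by blast
    ultimately show False using m(1) unfolding X by blast
  qed
  have "fval (lam D v) p = G (zrep (zsep D (\<lambda>q. r q p)) (fval (lam D v)))" if "p \<epsilon> D" for p
  proof -
    have "zrep (pred p) (fval (lam D v)) = zrep (pred p) v"
      by (rule rep_cong[OF vf vv[OF vterm_var]], rule lam_fval[OF vv[OF vterm_var]]) (use pred in blast)
    then show ?thesis using veq tot[OF that] lam_fval[of v p D, OF vv[OF vterm_var] that] 
      unfolding pred_def by metis
  qed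
  then show ?thesis using lam_fun_on[of v D, OF vv[OF vterm_var]] by blast
qed

section \<open>Transitive closures, induction along membership and rank stages\<close>

definition trans_set :: "'v::zfc \<Rightarrow> bool" where
  "trans_set T \<longleftrightarrow> (\<forall>y z. y \<epsilon> T \<and> z \<epsilon> y \<longrightarrow> z \<epsilon> T)"

lemma vdef_trans_set: "vterm a \<Longrightarrow> vdef (\<lambda>\<rho>. trans_set (a \<rho>))"
  by (erule vdef_comp1[rotated]) (unfold trans_set_def, intro definable_intros)

lemma wf_mem: "\<exists>x. x \<epsilon> X \<Longrightarrow> \<exists>m. m \<epsilon> X \<and> (\<forall>q. q \<epsilon> X \<longrightarrow> \<not> q \<epsilon> m)"
  using foundation by blast

lemma trans_closure: fixes x :: "'v::zfc" shows "\<exists>T. (\<forall>y. y \<epsilon> x \<longrightarrow> y \<epsilon> T) \<and> trans_set T"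
proof -
  \<comment> \<open>Recursion along \<open>\<epsilon>\<close> on the inductive set \<open>i\<close> itself, which avoids constructing \<open>\<omega>\<close>.\<close>
  obtain i e :: 'v where i: "e \<epsilon> i" "\<And>n. n \<epsilon> i \<Longrightarrow> \<exists>y. y \<epsilon> i \<and> (\<forall>z. z \<epsilon> y \<longleftrightarrow> z \<epsilon> n \<or> z = n)"
    using infinity by metis
  have v1: "vdef (\<lambda>\<rho> :: nat \<Rightarrow> 'v. \<rho> 0 \<epsilon> \<rho> (Suc 0))" by (intro definable_intros)
  \<comment> \<open>The double union throws the members of the members of all earlier values into
    the next one, so the union of all values is transitive.\<close>
  have v2: "vterm (\<lambda>\<rho>. un2 x (zU (zU (\<rho> 0))))" by (intro definable_intros)
  obtain g where g: "\<And>n. n \<epsilon> i \<Longrightarrow> fval g n = un2 x (zU (zU (zrep (zsep i (\<lambda>q. q \<epsilon> n)) (fval g))))"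
    using wf_recursion[of mem "\<lambda>v. un2 x (zU (zU v))" i, OF v1 v2] wf_mem by blast
  have s: "q \<epsilon> zsep i (\<lambda>q. q \<epsilon> n) \<longleftrightarrow> q \<epsilon> i \<and> q \<epsilon> n" for q n by (rule zsep) (intro definable_intros)
  have r: "y \<epsilon> zrep a (fval g) \<longleftrightarrow> (\<exists>q. q \<epsilon> a \<and> y = fval g q)" for y a by (rule zrep) (intro definable_intros)
  define T where "T = zU (zrep i (fval g))"
  have "trans_set T" unfolding trans_set_def
  proof (intro allI impI)
    fix y z assume "y \<epsilon> T \<and> z \<epsilon> y"
    then obtain n where n: "n \<epsilon> i" "y \<epsilon> fval g n" "z \<epsilon> y" by (auto simp: T_def r)
    obtain m where m: "m \<epsilon> i" "n \<epsilon> m" using i(2)[OF n(1)] by blast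
    have "z \<epsilon> fval g m" unfolding g[OF m(1)] un2_iff zU_iff r s using n m by blast
    then show "z \<epsilon> T" using m by (auto simp: T_def r)
  qed
  moreover have "y \<epsilon> T" if "y \<epsilon> x" for y
  proof -
    have "y \<epsilon> fval g e" unfolding g[OF i(1)] using that by simp
    then show ?thesis using i by (auto simp: T_def r)
  qed
  ultimately show ?thesis by blast
qed

text \<open>A minimal counterexample has to be found in a set: a transitive set around
  \<open>x\<close> supplies the set, and definability of \<open>P\<close> lets Separation cut it
  down to the counterexamples.\<close>

lemma mem_induct:
  assumes "vdef (\<lambda>\<rho>. P (\<rho> 0))" and step: "\<And>x. (\<And>y. y \<epsilon> x \<Longrightarrow> P y) \<Longrightarrow> P x"
  shows "P x"
proof (rule ccontr)
  assume no: "\<not> P x"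
  obtain T where T: "x \<epsilon> T" "trans_set T" using trans_closure[of "upair x x"] by auto
  have X: "q \<epsilon> zsep T (\<lambda>q. \<not> P q) \<longleftrightarrow> q \<epsilon> T \<and> \<not> P q" for q
    by (rule zsep) (intro vdef_neg assms(1))
  obtain m where "m \<epsilon> T" "\<not> P m" "\<And>q. q \<epsilon> T \<Longrightarrow> \<not> P q \<Longrightarrow> \<not> q \<epsilon> m"
    using wf_mem[of "zsep T (\<lambda>q. \<not> P q)"] no T(1) unfolding X by blast
  then show False using step T(2) unfolding trans_set_def by blast
qed

text \<open>This is V_rank(x), obtained from the recursion that sends \<open>x\<close> to the union
  of the power sets of the values at its members, without ordinals or ranks. Recursion is available
  on sets, hence the transitive domain \<open>D\<close>.\<close>

definition is_stage :: "'v::zfc \<Rightarrow> 'v \<Rightarrow> bool" where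
  "is_stage x y \<longleftrightarrow> (\<exists>D g. trans_set D \<and> x \<epsilon> D \<and> fun_on g D \<and>
     (\<forall>p. p \<epsilon> D \<longrightarrow> fval g p = zU (zrep p (\<lambda>q. zP (fval g q)))) \<and> y = fval g x)"

lemma is_stage_ex1: "\<exists>!y. is_stage x y"
proof -
  have r: "y \<epsilon> zrep a (\<lambda>q. zP (fval g q)) \<longleftrightarrow> (\<exists>q. q \<epsilon> a \<and> y = zP (fval g q))" for y a g :: 'a
    by (rule zrep) (intro definable_intros)
  have "\<exists>y. is_stage x y"
  proof -
    obtain T where T: "x \<epsilon> T" "trans_set T" using trans_closure[of "upair x x"] by auto
    have v1: "vdef (\<lambda>\<rho> :: nat \<Rightarrow> 'a. \<rho> 0 \<epsilon> \<rho> (Suc 0))" by (intro definable_intros)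
    have v2: "vterm (\<lambda>\<rho> :: nat \<Rightarrow> 'a. zU (zrep (\<rho> 0) zP))" by (intro definable_intros)
    obtain g where g: "fun_on g T"
      "\<And>n. n \<epsilon> T \<Longrightarrow> fval g n = zU (zrep (zrep (zsep T (\<lambda>q. q \<epsilon> n)) (fval g)) zP)"
      using wf_recursion[of mem "\<lambda>v. zU (zrep v zP)" T, OF v1 v2] wf_mem by blast
    have s: "q \<epsilon> zsep T (\<lambda>q. q \<epsilon> n) \<longleftrightarrow> q \<epsilon> T \<and> q \<epsilon> n" for q n by (rule zsep) (intro definable_intros)
    have 1: "y \<epsilon> zrep a (fval g) \<longleftrightarrow> (\<exists>q. q \<epsilon> a \<and> y = fval g q)" for y a by (rule zrep) (intro definable_intros)
    have 2: "y \<epsilon> zrep a zP \<longleftrightarrow> (\<exists>q. q \<epsilon> a \<and> y = zP q)" for y a :: 'a by (rule zrep) (intro definable_intros)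
    have "fval g n = zU (zrep n (\<lambda>q. zP (fval g q)))" if "n \<epsilon> T" for n
    proof (rule zext)
      fix z
      have "z \<epsilon> fval g n \<longleftrightarrow> (\<exists>q. q \<epsilon> T \<and> q \<epsilon> n \<and> z \<epsilon> zP (fval g q))"
        unfolding g(2)[OF that] zU_iff 1 2 s by blast
      also have "\<dots> \<longleftrightarrow> z \<epsilon> zU (zrep n (\<lambda>q. zP (fval g q)))"
        unfolding zU_iff r using T(2) that unfolding trans_set_def by blast
      finally show "z \<epsilon> fval g n \<longleftrightarrow> z \<epsilon> zU (zrep n (\<lambda>q. zP (fval g q)))" .
    qed
    then show ?thesis unfolding is_stage_def using T g(1) by blast
  qed
  moreover have "y = y'" if yy: "is_stage x y" "is_stage x y'" for y y'
  proof -
    obtain D g D' g' where D: "trans_set D" "x \<epsilon> D" "y = fval g x" "trans_set D'" "x \<epsilon> D'" "y' = fval g' x"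
      "\<And>p. p \<epsilon> D \<Longrightarrow> fval g p = zU (zrep p (\<lambda>q. zP (fval g q)))"
      "\<And>p. p \<epsilon> D' \<Longrightarrow> fval g' p = zU (zrep p (\<lambda>q. zP (fval g' q)))"
      using yy unfolding is_stage_def by metis
    have "x \<epsilon> D \<and> x \<epsilon> D' \<longrightarrow> fval g x = fval g' x"
    proof (rule mem_induct[where P="\<lambda>x. x \<epsilon> D \<and> x \<epsilon> D' \<longrightarrow> fval g x = fval g' x"])
      fix x assume IH: "\<And>y. y \<epsilon> x \<Longrightarrow> y \<epsilon> D \<and> y \<epsilon> D' \<longrightarrow> fval g y = fval g' y"
      show "x \<epsilon> D \<and> x \<epsilon> D' \<longrightarrow> fval g x = fval g' x"
      proof
        assume x: "x \<epsilon> D \<and> x \<epsilon> D'"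
        then have "zrep x (\<lambda>q. zP (fval g q)) = zrep x (\<lambda>q. zP (fval g' q))"
          using D(1,4) IH unfolding trans_set_def by (intro zext) (auto simp: r; metis)
        then show "fval g x = fval g' x" using D(7,8) x by simp
      qed
    qed (intro definable_intros)
    then show ?thesis using D by blast
  qed
  ultimately show ?thesis by blast
qed

text \<open>The rank-initial segment of the universe below the rank of \<open>x\<close>.\<close>

definition stage :: "'v::zfc \<Rightarrow> 'v" where "stage x = (THE y. is_stage x y)"

lemma vterm_stage: "vterm a \<Longrightarrow> vterm (\<lambda>\<rho>. stage (a \<rho>))"
  by (erule vterm_app1[rotated], unfold stage_def, rule vterm_THE[where R="\<lambda>y \<rho>. is_stage (\<rho> 0) y", OF is_stage_ex1])
    (unfold is_stage_def, intro definable_intros vdef_trans_set)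

lemma stage_iff: "z \<epsilon> stage x \<longleftrightarrow> (\<exists>q. q \<epsilon> x \<and> (\<forall>w. w \<epsilon> z \<longrightarrow> w \<epsilon> stage q))"
proof -
  have r: "y \<epsilon> zrep a (\<lambda>q. zP (fval g q)) \<longleftrightarrow> (\<exists>q. q \<epsilon> a \<and> y = zP (fval g q))" for y a g :: 'a
    by (rule zrep) (intro definable_intros)
  have "is_stage x (stage x)" unfolding stage_def by (rule theI'[OF is_stage_ex1])
  then obtain D g where D: "trans_set D" "x \<epsilon> D" "fun_on g D" "stage x = fval g x"
      "\<And>p. p \<epsilon> D \<Longrightarrow> fval g p = zU (zrep p (\<lambda>q. zP (fval g q)))"
    unfolding is_stage_def by blast
  have "stage q = fval g q" if "q \<epsilon> x" for q
    unfolding stage_def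
    by (rule the1_equality[OF is_stage_ex1]) (use D that in \<open>unfold is_stage_def trans_set_def, blast\<close>)
  then show ?thesis unfolding D(4) D(5)[OF D(2)] zU_iff r by auto
qed

lemma stage_sub: "z \<epsilon> stage x \<Longrightarrow> (\<And>w. w \<epsilon> z' \<Longrightarrow> w \<epsilon> z) \<Longrightarrow> z' \<epsilon> stage x"
  unfolding stage_iff[of z] stage_iff[of z'] by blast

lemma stage_trans: "\<forall>z y. z \<epsilon> stage x \<and> y \<epsilon> z \<longrightarrow> y \<epsilon> stage x"
proof (rule mem_induct[where P="\<lambda>x. \<forall>z y. z \<epsilon> stage x \<and> y \<epsilon> z \<longrightarrow> y \<epsilon> stage x"])
  fix x assume IH: "\<And>q. q \<epsilon> x \<Longrightarrow> \<forall>z y. z \<epsilon> stage q \<and> y \<epsilon> z \<longrightarrow> y \<epsilon> stage q"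
  show "\<forall>z y. z \<epsilon> stage x \<and> y \<epsilon> z \<longrightarrow> y \<epsilon> stage x"
  proof (intro allI impI)
    fix z y assume "z \<epsilon> stage x \<and> y \<epsilon> z"
    then obtain q where q: "q \<epsilon> x" "\<And>w. w \<epsilon> z \<Longrightarrow> w \<epsilon> stage q" "y \<epsilon> z" using stage_iff[of z x] by blast
    then show "y \<epsilon> stage x" using IH[OF q(1)] unfolding stage_iff[of y x] by blast
  qed
qed (intro definable_intros vterm_stage)

lemma sub_stage: "\<forall>y. y \<epsilon> x \<longrightarrow> y \<epsilon> stage x"
proof (rule mem_induct[where P="\<lambda>x. \<forall>y. y \<epsilon> x \<longrightarrow> y \<epsilon> stage x"])
  fix x assume IH: "\<And>q. q \<epsilon> x \<Longrightarrow> \<forall>y. y \<epsilon> q \<longrightarrow> y \<epsilon> stage q"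
  then show "\<forall>y. y \<epsilon> x \<longrightarrow> y \<epsilon> stage x" by (metis stage_iff)
qed (intro definable_intros vterm_stage)

text \<open>Comparability of ranks, by induction on both arguments. If \<open>w\<close> separates
  \<open>stage x\<close> from \<open>stage y\<close>, it is a subset of \<open>stage z\<close> for
  some member \<open>z\<close> of \<open>x\<close>. Closure under subsets excludes
  \<open>stage z\<close> from \<open>stage y\<close>, so by induction \<open>stage y\<close> is
  contained in \<open>stage z\<close> and therefore belongs to \<open>stage x\<close>.\<close>

lemma stage_linear: "(\<forall>w. w \<epsilon> stage x \<longrightarrow> w \<epsilon> stage y) \<or> stage y \<epsilon> stage x"
proof -
  define L where "L x y \<longleftrightarrow> (\<forall>w. w \<epsilon> stage y \<longrightarrow> w \<epsilon> stage x) \<or> stage x \<epsilon> stage y" for x y :: 'a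
  have vL: "vdef (\<lambda>\<rho>. L (s \<rho>) (t \<rho>))" if "vterm s" "vterm t" for s t
    by (rule vdef_comp2[OF _ that]) (unfold L_def, intro definable_intros vterm_stage)
  have step: "L y x" if "\<And>z. z \<epsilon> x \<Longrightarrow> L z y" for x y
  proof (cases "\<forall>w. w \<epsilon> stage x \<longrightarrow> w \<epsilon> stage y")
    case True then show ?thesis by (simp add: L_def)
  next
    case False
    then obtain w where w: "w \<epsilon> stage x" "\<not> w \<epsilon> stage y" by blast
    then obtain z where z: "z \<epsilon> x" "\<And>u. u \<epsilon> w \<Longrightarrow> u \<epsilon> stage z" using stage_iff[of w x] by blast
    have "\<not> stage z \<epsilon> stage y" using z(2) w(2) stage_sub by blast
    then have "\<And>w. w \<epsilon> stage y \<Longrightarrow> w \<epsilon> stage z" using that[OF z(1)] unfolding L_def by blast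
    then have "stage y \<epsilon> stage x" using z(1) stage_iff[of "stage y" x] by blast
    then show ?thesis by (simp add: L_def)
  qed
  have "\<forall>y. L x y \<and> L y x" for x
  proof (rule mem_induct[where P="\<lambda>x. \<forall>y. L x y \<and> L y x"])
    fix x assume IH: "\<And>z. z \<epsilon> x \<Longrightarrow> \<forall>y. L z y \<and> L y z"
    have "L x y \<and> L y x" for y
    proof (rule mem_induct[where P="\<lambda>y. L x y \<and> L y x"])
      fix y assume "\<And>z. z \<epsilon> y \<Longrightarrow> L x z \<and> L z x"
      then show "L x y \<and> L y x" using step IH by blast
    qed (intro definable_intros vL)
    then show "\<forall>y. L x y \<and> L y x" by blast
  qed (intro definable_intros vL)
  then show ?thesis unfolding L_def by blast
qed

lemma collection:
  assumes P: "vdef (\<lambda>\<rho>. P (\<rho> 0) (\<rho> (Suc 0)))" and ex: "\<And>x. x \<epsilon> a \<Longrightarrow> \<exists>y. P x y"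
  shows "\<exists>b. \<forall>x. x \<epsilon> a \<longrightarrow> (\<exists>y. y \<epsilon> b \<and> P x y)"
proof -
  note PP = vdef_comp2[OF P]
  \<comment> \<open>Stages are linearly ordered, so the least stage of a witness is determined by \<open>x\<close>.\<close>
  define R where "R x w \<longleftrightarrow> (\<exists>y. P x y \<and> w = stage y) \<and> (\<forall>y. P x y \<longrightarrow> (\<forall>z. z \<epsilon> w \<longrightarrow> z \<epsilon> stage y))" for x w
  have vR: "vdef (\<lambda>\<rho>. R (\<rho> 0) (\<rho> (Suc 0)))"
    unfolding R_def by (intro definable_intros vterm_stage PP)
  have "\<exists>w. R x w" if "x \<epsilon> a" for x
  proof -
    obtain y0 where y0: "P x y0" using ex \<open>x \<epsilon> a\<close> by blast
    define X where "X = zsep (stage y0) (\<lambda>w. \<exists>y. P x y \<and> w = stage y)"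
    have X: "w \<epsilon> X \<longleftrightarrow> w \<epsilon> stage y0 \<and> (\<exists>y. P x y \<and> w = stage y)" for w
      unfolding X_def by (rule zsep) (intro definable_intros PP vterm_stage)
    show ?thesis
    proof (cases "\<exists>w. w \<epsilon> X")
      case False
      \<comment> \<open>No witness has its stage inside \<open>stage y0\<close>, so by linearity
        \<open>stage y0\<close> is contained in the stage of every witness.\<close>
      then have "R x (stage y0)" using y0 stage_linear unfolding R_def X by blast
      then show ?thesis by blast
    next
      case True
      from wf_mem[OF this] obtain m where m: "m \<epsilon> X" "\<And>q. q \<epsilon> X \<Longrightarrow> \<not> q \<epsilon> m" by blast
      have "z \<epsilon> stage y" if "P x y" "z \<epsilon> m" for y z
      proof (rule ccontr)
        assume "\<not> z \<epsilon> stage y"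
        then have "stage y \<epsilon> m" using stage_linear m(1) that(2) unfolding X by blast
        then show False using m stage_trans \<open>P x y\<close> unfolding X by blast
      qed
      then show ?thesis using m(1) unfolding X R_def by blast
    qed
  qed
  moreover have "w = w'" if "R x w" "R x w'" for x w w'
    using that unfolding R_def by (metis zext)
  ultimately have "\<exists>b. \<forall>w. w \<epsilon> b \<longleftrightarrow> (\<exists>x. x \<epsilon> a \<and> R x w)"
    by (intro replacement_vdef[OF vR]) blast
  then obtain b where b: "\<And>w. w \<epsilon> b \<longleftrightarrow> (\<exists>x. x \<epsilon> a \<and> R x w)" by blast
  have r: "y \<epsilon> zrep b zP \<longleftrightarrow> (\<exists>q. q \<epsilon> b \<and> y = zP q)" for y by (rule zrep) (intro definable_intros)
  have "\<exists>y. y \<epsilon> zU (zrep b zP) \<and> P x y" if x: "x \<epsilon> a" for x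
  proof -
    obtain w where w: "R x w" using x \<open>\<And>x. x \<epsilon> a \<Longrightarrow> \<exists>w. R x w\<close> by blast
    then obtain y where y: "P x y" "w = stage y" unfolding R_def by blast
    have "w \<epsilon> b" using b w x by blast
    moreover have "y \<epsilon> zP w" using sub_stage y(2) by simp
    ultimately have "y \<epsilon> zU (zrep b zP)" unfolding zU_iff r by blast
    then show ?thesis using y(1) by blast
  qed
  then show ?thesis by blast
qed

text \<open>Collection bounds the possible values by a set \<open>b\<close>. Tagging each value with
  its argument makes the slices \<open>sl x\<close> disjoint, which is the situation the choice
  axiom treats; the chosen pairs form the graph.\<close>

lemma choice_fun:
  assumes P: "vdef (\<lambda>\<rho>. P (\<rho> 0) (\<rho> (Suc 0)))" and ex: "\<And>x. x \<epsilon> a \<Longrightarrow> \<exists>y. P x y"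
  shows "\<exists>g. fun_on g a \<and> (\<forall>x. x \<epsilon> a \<longrightarrow> P x (fval g x))"
proof -
  note PP = vdef_comp2[OF P]
  obtain b where b: "\<And>x. x \<epsilon> a \<Longrightarrow> \<exists>y. y \<epsilon> b \<and> P x y" using collection[OF assms] by blast
  define sl where "sl x = zrep (zsep b (\<lambda>y. P x y)) (\<lambda>y. opair x y)" for x
  have s: "y \<epsilon> zsep b (\<lambda>y. P x y) \<longleftrightarrow> y \<epsilon> b \<and> P x y" for x y by (rule zsep) (intro definable_intros PP)
  have "z \<epsilon> sl x \<longleftrightarrow> (\<exists>y. y \<epsilon> zsep b (\<lambda>y. P x y) \<and> z = opair x y)" for z x
    unfolding sl_def by (rule zrep) (intro definable_intros)
  then have sl: "z \<epsilon> sl x \<longleftrightarrow> (\<exists>y. y \<epsilon> b \<and> P x y \<and> z = opair x y)" for z x unfolding s by blast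
  have f: "y \<epsilon> zrep a sl \<longleftrightarrow> (\<exists>x. x \<epsilon> a \<and> y = sl x)" for y
    by (rule zrep) (unfold sl_def, intro definable_intros PP)
  have "\<exists>c. \<forall>x. x \<epsilon> zrep a sl \<longrightarrow> (\<exists>!y. y \<epsilon> c \<and> y \<epsilon> x)"
  proof (rule choice)
    show "\<forall>x. x \<epsilon> zrep a sl \<longrightarrow> (\<exists>y. y \<epsilon> x)" unfolding f using b sl by blast
    show "\<forall>x y z. x \<epsilon> zrep a sl \<and> y \<epsilon> zrep a sl \<and> z \<epsilon> x \<and> z \<epsilon> y \<longrightarrow> x = y"
      unfolding f by (auto simp: sl)
  qed
  then obtain c where c: "\<And>x. x \<epsilon> a \<Longrightarrow> \<exists>!y. y \<epsilon> c \<and> y \<epsilon> sl x" using f by metis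
  define g where "g = zsep (zU (zrep a sl)) (\<lambda>p. p \<epsilon> c)"
  have "p \<epsilon> g \<longleftrightarrow> p \<epsilon> zU (zrep a sl) \<and> p \<epsilon> c" for p unfolding g_def by (rule zsep) (intro definable_intros)
  then have g: "p \<epsilon> g \<longleftrightarrow> (\<exists>x. x \<epsilon> a \<and> p \<epsilon> sl x \<and> p \<epsilon> c)" for p using f by auto
  have go: "opair x y \<epsilon> g \<longleftrightarrow> x \<epsilon> a \<and> y \<epsilon> b \<and> P x y \<and> opair x y \<epsilon> c" for x y
    unfolding g sl by auto
  have "\<exists>!y. opair x y \<epsilon> g" if "x \<epsilon> a" for x
    unfolding go using c[OF that] that unfolding sl by (metis opair_inj)
  moreover have "\<exists>x y. x \<epsilon> a \<and> p = opair x y" if "p \<epsilon> g" for p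
    using that unfolding g sl by blast
  ultimately have "fun_on g a" unfolding fun_on_iff by blast
  moreover have "P x (fval g x)" if "x \<epsilon> a" for x
    using fun_on_fval[OF \<open>fun_on g a\<close> that, of "fval g x"] go by blast
  ultimately show ?thesis by blast
qed

section \<open>Ordinals and finite sets\<close>

abbreviation ord :: "'v::zfc \<Rightarrow> bool" where "ord \<equiv> ordinal UNIV"

lemma ord_iff: "ord x \<longleftrightarrow> trans_set x \<and> (\<forall>y. y \<epsilon> x \<longrightarrow> trans_set y)"
  unfolding ordinal_def transitive_def subset_of_def trans_set_def by simp blast

lemma vdef_ord: "vterm a \<Longrightarrow> vdef (\<lambda>\<rho>. ord (a \<rho>))"
  by (erule vdef_comp1[rotated]) (unfold ord_iff, intro definable_intros vdef_trans_set)

lemma ord_mem: "ord x \<Longrightarrow> y \<epsilon> x \<Longrightarrow> ord y"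
  unfolding ord_iff trans_set_def by blast

lemma ord_trans: "ord x \<Longrightarrow> y \<epsilon> x \<Longrightarrow> z \<epsilon> y \<Longrightarrow> z \<epsilon> x"
  unfolding ord_iff trans_set_def by blast

lemma ord_linear:
  fixes x y :: "'v::zfc"
  assumes "ord x" "ord y" shows "x \<epsilon> y \<or> x = y \<or> y \<epsilon> x"
proof -
  have "ord x \<longrightarrow> (\<forall>y. ord y \<longrightarrow> x \<epsilon> y \<or> x = y \<or> y \<epsilon> x)" for x :: 'v
  proof (rule mem_induct[where P="\<lambda>x. ord x \<longrightarrow> (\<forall>y. ord y \<longrightarrow> x \<epsilon> y \<or> x = y \<or> y \<epsilon> x)"])
    fix x :: 'v assume IH: "\<And>z. z \<epsilon> x \<Longrightarrow> ord z \<longrightarrow> (\<forall>y. ord y \<longrightarrow> z \<epsilon> y \<or> z = y \<or> y \<epsilon> z)"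
    show "ord x \<longrightarrow> (\<forall>y. ord y \<longrightarrow> x \<epsilon> y \<or> x = y \<or> y \<epsilon> x)"
    proof
      assume x: "ord x"
      have "ord y \<longrightarrow> x \<epsilon> y \<or> x = y \<or> y \<epsilon> x" for y
      proof (rule mem_induct[where P="\<lambda>y. ord y \<longrightarrow> x \<epsilon> y \<or> x = y \<or> y \<epsilon> x"])
        fix y assume IH2: "\<And>z. z \<epsilon> y \<Longrightarrow> ord z \<longrightarrow> x \<epsilon> z \<or> x = z \<or> z \<epsilon> x"
        show "ord y \<longrightarrow> x \<epsilon> y \<or> x = y \<or> y \<epsilon> x"
        proof (intro impI, rule ccontr)
          assume y: "ord y" and no: "\<not> (x \<epsilon> y \<or> x = y \<or> y \<epsilon> x)"
          have 1: "z \<epsilon> y" if "z \<epsilon> x" for z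
            using IH[OF that] ord_mem[OF x that] y no ord_trans[OF x that] that by blast
          have 2: "z \<epsilon> x" if "z \<epsilon> y" for z
            using IH2[OF that] ord_mem[OF y that] no ord_trans[OF y that] that by blast
          have "x = y" by (rule zext) (use 1 2 in blast)
          then show False using no by blast
        qed
      qed (intro definable_intros vdef_ord)
      then show "\<forall>y. ord y \<longrightarrow> x \<epsilon> y \<or> x = y \<or> y \<epsilon> x" by blast
    qed
  qed (intro definable_intros vdef_ord)
  then show ?thesis using assms by blast
qed

lemma ord_least:
  assumes P: "vdef (\<lambda>\<rho>. P (\<rho> 0))" and x: "ord x" "P x"
  shows "\<exists>m. ord m \<and> P m \<and> (\<forall>y. y \<epsilon> m \<longrightarrow> \<not> P y)"
proof (rule ccontr)
  assume no: "\<nexists>m. ord m \<and> P m \<and> (\<forall>y. y \<epsilon> m \<longrightarrow> \<not> P y)"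
  note PP = vdef_comp1[OF P]
  have "ord x \<longrightarrow> \<not> P x"
  proof (rule mem_induct[where P="\<lambda>x. ord x \<longrightarrow> \<not> P x"])
    fix x assume "\<And>y. y \<epsilon> x \<Longrightarrow> ord y \<longrightarrow> \<not> P y"
    then show "ord x \<longrightarrow> \<not> P x" using no ord_mem by blast
  qed (intro definable_intros vdef_ord PP)
  then show False using x by blast
qed

lemma subset_of_iff [simp]: "subset_of UNIV x y \<longleftrightarrow> (\<forall>z. z \<epsilon> x \<longrightarrow> z \<epsilon> y)"
  unfolding subset_of_def by simp

section \<open>Natural numbers and finite sets\<close>

abbreviation nat_ord :: "'v::zfc \<Rightarrow> bool" where "nat_ord \<equiv> natural UNIV"

definition zinsert :: "'v::zfc \<Rightarrow> 'v \<Rightarrow> 'v" where "zinsert x a = un2 a (upair x x)"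

lemma zinsert_iff [simp]: "z \<epsilon> zinsert x a \<longleftrightarrow> z = x \<or> z \<epsilon> a"
  by (auto simp: zinsert_def)

lemma vterm_zinsert: "vterm a \<Longrightarrow> vterm b \<Longrightarrow> vterm (\<lambda>\<rho>. zinsert (a \<rho>) (b \<rho>))"
  unfolding zinsert_def by (intro definable_intros)

lemma nat_ord_iff: "nat_ord n \<longleftrightarrow> ord n \<and> (\<forall>m. m \<epsilon> n \<or> m = n \<longrightarrow> m = zemp \<or> (\<exists>k. m = zinsert k k))"
proof -
  have "(\<forall>z. z \<epsilon> m \<longleftrightarrow> z \<epsilon> k \<or> z = k) \<longleftrightarrow> m = zinsert k k" for m k :: 'a
    by (auto intro: zext)
  then show ?thesis unfolding natural_def by simp blast
qed

lemma vdef_nat_ord: "vterm a \<Longrightarrow> vdef (\<lambda>\<rho>. nat_ord (a \<rho>))"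
  by (erule vdef_comp1[rotated]) (unfold nat_ord_iff, intro definable_intros vdef_ord vterm_zinsert)

lemma nat_ord_zemp: "nat_ord zemp"
  unfolding nat_ord_iff ord_iff trans_set_def by simp

lemma nat_ord_succ: "nat_ord n \<Longrightarrow> nat_ord (zinsert n n)"
  unfolding nat_ord_iff ord_iff trans_set_def zinsert_iff by blast

lemma nat_ord_pred: "nat_ord (zinsert n n) \<Longrightarrow> nat_ord n"
  unfolding nat_ord_iff ord_iff trans_set_def zinsert_iff by blast

definition enum :: "'v::zfc \<Rightarrow> 'v \<Rightarrow> 'v \<Rightarrow> bool" where
  "enum f n a \<longleftrightarrow> fun_on f n \<and> (\<forall>x y. opair x y \<epsilon> f \<longrightarrow> y \<epsilon> a) \<and>
     (\<forall>y. y \<epsilon> a \<longrightarrow> (\<exists>!x. opair x y \<epsilon> f))"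

lemma vdef_enum:
  assumes "vterm f" "vterm n" "vterm a" shows "vdef (\<lambda>\<rho>. enum (f \<rho>) (n \<rho>) (a \<rho>))"
proof -
  have "vdef (\<lambda>\<rho>. enum (\<rho> 0) (\<rho> (Suc 0)) (\<rho> (Suc (Suc 0))))"
    unfolding enum_def Ex1_def by (intro definable_intros)
  from vdef_comp3[OF this assms] show ?thesis .
qed

abbreviation fin :: "'v::zfc \<Rightarrow> bool" where "fin \<equiv> is_finite UNIV"

lemma fin_iff: "fin a \<longleftrightarrow> (\<exists>n f. nat_ord n \<and> enum f n a)"
proof -
  have "(is_fun UNIV f n a \<and> (\<forall>y. y \<epsilon> a \<longrightarrow> (\<exists>!x. x \<epsilon> n \<and> opair x y \<epsilon> f))) \<longleftrightarrow> enum f n a" for f n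
  proof -
    have "(\<exists>!x. x \<epsilon> n \<and> opair x y \<epsilon> f) \<longleftrightarrow> (\<exists>!x. opair x y \<epsilon> f)" if "fun_on f n" for y
      using fun_on_dom[OF that] by blast
    then show ?thesis by (cases "fun_on f n") (simp_all add: enum_def is_fun_def)
  qed
  then show ?thesis unfolding is_finite_def by simp
qed

lemma enum_insert:
  assumes f: "enum f n a" and x: "\<not> x \<epsilon> a"
  shows "enum (zinsert (opair n x) f) (zinsert n n) (zinsert x a)"
proof -
  have d: "opair u v \<epsilon> f \<Longrightarrow> u \<epsilon> n \<and> v \<epsilon> a" for u v
    using f fun_on_dom unfolding enum_def by blast
  have nx: "\<not> opair n v \<epsilon> f" "\<not> opair u x \<epsilon> f" for u v using d x not_self by blast+
  have o: "opair u v \<epsilon> zinsert (opair n x) f \<longleftrightarrow> (u = n \<and> v = x) \<or> opair u v \<epsilon> f" for u v by auto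
  have fo: "fun_on f n" using f unfolding enum_def by blast
  have "fun_on (zinsert (opair n x) f) (zinsert n n)"
    unfolding fun_on_iff o
  proof (intro conjI allI impI)
    fix p assume "p \<epsilon> zinsert (opair n x) f"
    then show "\<exists>u y. u \<epsilon> zinsert n n \<and> p = opair u y"
      using fo unfolding fun_on_iff zinsert_iff by blast
  next
    fix u assume "u \<epsilon> zinsert n n"
    then show "\<exists>!y. u = n \<and> y = x \<or> opair u y \<epsilon> f"
      using fo nx unfolding fun_on_iff zinsert_iff by blast
  qed
  moreover have "\<exists>!u. opair u y \<epsilon> zinsert (opair n x) f" if "y \<epsilon> zinsert x a" for y
    using that f nx unfolding enum_def zinsert_iff opair_inj by blast
  moreover have "y \<epsilon> zinsert x a" if "opair u y \<epsilon> zinsert (opair n x) f" for u y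
    using that d unfolding zinsert_iff opair_inj by blast
  ultimately show ?thesis unfolding enum_def by blast
qed

lemma zinsert_absorb: "x \<epsilon> a \<Longrightarrow> zinsert x a = a" by (rule zext) auto

lemma fin_insert: "fin a \<Longrightarrow> fin (zinsert x a)"
  unfolding fin_iff using enum_insert nat_ord_succ zinsert_absorb by metis

lemma fin_zemp: "fin zemp"
proof -
  have "enum zemp zemp zemp" unfolding enum_def fun_on_iff by simp
  then show ?thesis unfolding fin_iff using nat_ord_zemp by blast
qed

lemma enum_remove:
  assumes f: "enum f (zinsert n n) b"
  shows "\<exists>f' b' x. enum f' n b' \<and> b = zinsert x b'"
proof -
  have fo: "fun_on f (zinsert n n)" using f unfolding enum_def by blast
  define x where "x = fval f n"
  have x: "opair n y \<epsilon> f \<longleftrightarrow> y = x" for y unfolding x_def by (rule fun_on_fval[OF fo]) simp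
  then have xb: "x \<epsilon> b" using f unfolding enum_def by blast
  define b' where "b' = zsep b (\<lambda>y. y \<noteq> x)"
  have b': "y \<epsilon> b' \<longleftrightarrow> y \<epsilon> b \<and> y \<noteq> x" for y unfolding b'_def by (rule zsep) (intro definable_intros)
  have "b = zinsert x b'" by (rule zext) (use xb in \<open>auto simp: b'\<close>)
  moreover have "enum (restr f n) n b'"
    unfolding enum_def opair_restr_iff
  proof (intro conjI allI impI)
    show "fun_on (restr f n) n" unfolding fun_on_iff opair_restr_iff
    proof (intro conjI allI impI)
      fix u assume "u \<epsilon> n"
      then show "\<exists>!y. opair u y \<epsilon> f \<and> u \<epsilon> n" using fo unfolding fun_on_iff by simp
    qed (auto simp: restr_iff)
  next
    fix u y assume a: "opair u y \<epsilon> f \<and> u \<epsilon> n"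
    then have "y \<epsilon> b" using f unfolding enum_def by blast
    moreover have "y \<noteq> x" using a x xb f not_self unfolding enum_def by metis
    ultimately show "y \<epsilon> b'" unfolding b' by blast
  next
    fix y assume y: "y \<epsilon> b'"
    then obtain u where u: "opair u y \<epsilon> f" "\<And>v. opair v y \<epsilon> f \<Longrightarrow> v = u" using f unfolding enum_def b' by blast
    then have "u \<epsilon> n" using fun_on_dom[OF fo u(1)] x y unfolding b' zinsert_iff by blast
    then show "\<exists>!u. opair u y \<epsilon> f \<and> u \<epsilon> n" using u by blast
  qed
  ultimately show ?thesis by blast
qed

text \<open>Makes the finite supports of an extender directed, so that several codes can be compared
  over one common support. The induction runs along an enumeration of \<open>b\<close>, removing its
  last element.\<close>

lemma fin_un2:
  fixes a b :: "'v::zfc"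
  assumes "fin a" "fin b" shows "fin (un2 a b)"
proof -
  have v: "vdef (\<lambda>\<rho> :: nat \<Rightarrow> 'v. fin (\<rho> 0))"
    unfolding fin_iff by (intro definable_intros vdef_nat_ord vdef_enum)
  have "nat_ord n \<longrightarrow> (\<forall>b f. enum f n b \<longrightarrow> fin (un2 a b))" for n
  proof (rule mem_induct[where P="\<lambda>n. nat_ord n \<longrightarrow> (\<forall>b f. enum f n b \<longrightarrow> fin (un2 a b))"])
    fix n assume IH: "\<And>k. k \<epsilon> n \<Longrightarrow> nat_ord k \<longrightarrow> (\<forall>b f. enum f k b \<longrightarrow> fin (un2 a b))"
    show "nat_ord n \<longrightarrow> (\<forall>b f. enum f n b \<longrightarrow> fin (un2 a b))"
    proof (intro impI allI)
      fix b f assume n: "nat_ord n" and f: "enum f n b"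
      consider "n = zemp" | k where "n = zinsert k k" using n unfolding nat_ord_iff by blast
      then show "fin (un2 a b)"
      proof cases
        case 1
        then have "\<not> y \<epsilon> b" for y using f fun_on_dom unfolding enum_def by (metis zemp)
        then have "un2 a b = a" by (intro zext) simp
        then show ?thesis using assms by simp
      next
        case (2 k)
        then obtain f' b' x where b: "enum f' k b'" "b = zinsert x b'" using enum_remove f by blast
        have "k \<epsilon> n" using 2 by simp
        then have "fin (un2 a b')" using IH nat_ord_pred n 2 b(1) by blast
        moreover have "un2 a b = zinsert x (un2 a b')" by (rule zext) (auto simp: b(2))
        ultimately show ?thesis using fin_insert by metis
      qed
    qed
  qed (intro definable_intros vdef_nat_ord vdef_enum vdef_comp1[OF v])
  then show ?thesis using assms(2) unfolding fin_iff[of b] by blast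
qed

section \<open>The ultrapower of the universe by an extender\<close>

lemma vdef_udef2:
  assumes "udef (\<lambda>N \<rho>. P N (\<rho> 0) (\<rho> (Suc 0)))" "vterm a" "vterm b" shows "vdef (\<lambda>\<rho>. P UNIV (a \<rho>) (b \<rho>))"
  by (rule vdef_comp2[where P="P UNIV", OF vdef_udef[OF assms(1)] assms(2-)])

lemma vdef_udef3:
  assumes "udef (\<lambda>N \<rho>. P N (\<rho> 0) (\<rho> (Suc 0)) (\<rho> (Suc (Suc 0))))" "vterm a" "vterm b" "vterm c"
  shows "vdef (\<lambda>\<rho>. P UNIV (a \<rho>) (b \<rho>) (c \<rho>))"
  by (rule vdef_comp3[where P="P UNIV", OF vdef_udef[OF assms(1)] assms(2-)])

definition prodset :: "'v::zfc \<Rightarrow> 'v \<Rightarrow> 'v" where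
  "prodset A B = zU (zrep A (\<lambda>x. zrep B (\<lambda>y. opair x y)))"

lemma prodset_iff: "p \<epsilon> prodset A B \<longleftrightarrow> (\<exists>x y. x \<epsilon> A \<and> y \<epsilon> B \<and> p = opair x y)"
proof -
  have 1: "z \<epsilon> zrep B (\<lambda>y. opair x y) \<longleftrightarrow> (\<exists>y. y \<epsilon> B \<and> z = opair x y)" for x z
    by (rule zrep) (intro definable_intros)
  have 2: "z \<epsilon> zrep A (\<lambda>x. zrep B (\<lambda>y. opair x y)) \<longleftrightarrow> (\<exists>x. x \<epsilon> A \<and> z = zrep B (\<lambda>y. opair x y))" for z
    by (rule zrep) (intro definable_intros)
  show ?thesis unfolding prodset_def zU_iff 2 using 1 by blast
qed

definition zfst :: "'v::zfc \<Rightarrow> 'v" where "zfst p = (THE a. \<exists>b. p = opair a b)"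

definition zsnd :: "'v::zfc \<Rightarrow> 'v" where "zsnd p = (THE b. \<exists>a. p = opair a b)"

lemma zfst [simp]: "zfst (opair a b) = a" unfolding zfst_def by auto

lemma zsnd [simp]: "zsnd (opair a b) = b" unfolding zsnd_def by auto

definition sub :: "'v::zfc \<Rightarrow> 'v \<Rightarrow> bool" where "sub a b \<longleftrightarrow> (\<forall>z. z \<epsilon> a \<longrightarrow> z \<epsilon> b)"

lemma restr_restr: "sub a b \<Longrightarrow> restr (restr t b) a = restr t a"
  unfolding sub_def by (intro zext) (auto simp: restr_iff)

lemma restr_self: "fun_on t a \<Longrightarrow> restr t a = t"
  using fun_on_iff[of t a] by (intro zext) (simp add: restr_iff, blast)

locale univ_extender =
  fixes F :: "'v::zfc"
  assumes F: "extender UNIV F"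

begin

text \<open>An extender is only known to have some length; one is fixed here so that its finite
  supports can be named.\<close>

definition len :: 'v where "len = (SOME l. ext_system UNIV F l)"

definition fsub :: "'v \<Rightarrow> bool" where "fsub a \<longleftrightarrow> finite_subset UNIV a len"

definition meas :: "'v \<Rightarrow> 'v" where "meas a = fval F a"

definition sp :: "'v \<Rightarrow> 'v" where "sp a = zU (meas a)"

lemma ext_system: "ext_system UNIV F len"
  unfolding len_def using F unfolding extender_def by (metis someI)

lemma fsub_iff: "fsub a \<longleftrightarrow> sub a len \<and> fin a"
  unfolding fsub_def finite_subset_def sub_def by simp

lemma fsub_un2: "fsub a \<Longrightarrow> fsub b \<Longrightarrow> fsub (un2 a b)"
  unfolding fsub_iff sub_def using fin_un2[of a b] by auto

lemma fsub_zemp: "fsub zemp"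
  unfolding fsub_iff sub_def using fin_zemp by simp

lemma opair_F: "opair a U \<epsilon> F \<longleftrightarrow> fsub a \<and> U = meas a"
proof -
  have 1: "fsub a" if "opair a U \<epsilon> F" for a U
    using ext_system that unfolding ext_system_def fsub_def by fastforce
  have 2: "\<exists>!U. opair a U \<epsilon> F" if "fsub a"
    using ext_system that unfolding ext_system_def fsub_def by simp
  show ?thesis using 1 2 fval_eqI[of a _ F] unfolding meas_def by metis
qed

lemma ext_at_iff: "ext_at UNIV F a S U \<longleftrightarrow> fsub a \<and> U = meas a \<and> S = sp a"
  unfolding ext_at_def by (auto simp: opair_F sp_def)

lemma uf: "fsub a \<Longrightarrow> ultrafilter UNIV (sp a) (meas a)"
  using ext_system ext_at_iff unfolding ext_system_def by blast

lemma sp_fun_on: "fsub a \<Longrightarrow> s \<epsilon> sp a \<Longrightarrow> fun_on s a"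
proof -
  assume a: "fsub a" "s \<epsilon> sp a"
  then obtain k where "is_space UNIV a k (sp a)"
    using ext_system ext_at_iff unfolding ext_system_def by blast
  then show ?thesis using a(2) unfolding is_space_def is_fun_def by blast
qed

lemma sp_meas: "fsub a \<Longrightarrow> sp a \<epsilon> meas a"
  using uf unfolding ultrafilter_def by blast

lemma meas_up:
  assumes "fsub a" "X \<epsilon> meas a" "\<And>z. z \<epsilon> X \<Longrightarrow> z \<epsilon> Y" "\<And>z. z \<epsilon> Y \<Longrightarrow> z \<epsilon> sp a" shows "Y \<epsilon> meas a"
proof -
  have "\<forall>X\<in>UNIV. \<forall>Y\<in>UNIV. X \<epsilon> meas a \<and> subset_of UNIV X Y \<and> subset_of UNIV Y (sp a) \<longrightarrow> Y \<epsilon> meas a"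
    using uf[OF assms(1)] unfolding ultrafilter_def by (elim conjE)
  then show ?thesis using assms(2-) subset_of_iff by blast
qed

lemma meas_inter:
  assumes "fsub a" "X \<epsilon> meas a" "Y \<epsilon> meas a" "\<And>z. z \<epsilon> Z \<longleftrightarrow> z \<epsilon> X \<and> z \<epsilon> Y" shows "Z \<epsilon> meas a"
proof -
  have "\<forall>X\<in>UNIV. \<forall>Y\<in>UNIV. \<forall>Z\<in>UNIV. X \<epsilon> meas a \<and> Y \<epsilon> meas a \<and> is_inter UNIV X Y Z \<longrightarrow> Z \<epsilon> meas a"
    using uf[OF assms(1)] unfolding ultrafilter_def by (elim conjE)
  moreover have "is_inter UNIV X Y Z" unfolding is_inter_def using assms(4) by blast
  ultimately show ?thesis using assms(2,3) by blast
qed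

lemma meas_diff:
  assumes "fsub a" "\<And>z. z \<epsilon> X \<Longrightarrow> z \<epsilon> sp a" "\<And>z. z \<epsilon> Y \<longleftrightarrow> z \<epsilon> sp a \<and> \<not> z \<epsilon> X"
  shows "X \<epsilon> meas a \<longleftrightarrow> \<not> Y \<epsilon> meas a"
proof -
  have "\<forall>X\<in>UNIV. \<forall>Y\<in>UNIV. subset_of UNIV X (sp a) \<and> is_diff UNIV (sp a) X Y \<longrightarrow> (X \<epsilon> meas a \<longleftrightarrow> \<not> Y \<epsilon> meas a)"
    using uf[OF assms(1)] unfolding ultrafilter_def by (elim conjE)
  moreover have "is_diff UNIV (sp a) X Y" unfolding is_diff_def using assms(3) by blast
  ultimately show ?thesis using assms(2) subset_of_iff by blast
qed

section \<open>The quantifier "for almost all" with respect to a measure of the extender\<close>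

definition ae :: "'v \<Rightarrow> ('v \<Rightarrow> bool) \<Rightarrow> bool" where
  "ae a P \<longleftrightarrow> measure_one UNIV (sp a) (meas a) P"

lemma ae_iff: "ae a P \<longleftrightarrow> (\<exists>X. X \<epsilon> meas a \<and> (\<forall>s. s \<epsilon> X \<longleftrightarrow> s \<epsilon> sp a \<and> P s))"
  unfolding ae_def measure_one_def by simp

text \<open>\<open>ae\<close> asserts that the set of good points exists. For a definable
  \<open>P\<close> Separation provides that set, and only then do negation and monotonicity behave
  as for an ultrafilter; this is the source of the definability hypotheses below.\<close>

lemma ae_vdef: "vdef (\<lambda>\<rho>. P (\<rho> 0)) \<Longrightarrow> ae a P \<longleftrightarrow> zsep (sp a) P \<epsilon> meas a"
proof -
  assume "vdef (\<lambda>\<rho>. P (\<rho> 0))"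
  note z = zsep[OF this]
  show ?thesis unfolding ae_iff using z[of _ "sp a"] zext[of _ "zsep (sp a) P"] by metis
qed

lemma ae_cong: "(\<And>s. s \<epsilon> sp a \<Longrightarrow> P s \<longleftrightarrow> Q s) \<Longrightarrow> ae a P \<longleftrightarrow> ae a Q"
  unfolding ae_iff by (metis (no_types))

lemma ae_mono:
  assumes "fsub a" "ae a P" "vdef (\<lambda>\<rho>. Q (\<rho> 0))" "\<And>s. s \<epsilon> sp a \<Longrightarrow> P s \<Longrightarrow> Q s"
  shows "ae a Q"
proof -
  obtain X where X: "X \<epsilon> meas a" "\<And>s. s \<epsilon> X \<longleftrightarrow> s \<epsilon> sp a \<and> P s" using assms(2) unfolding ae_iff by blast
  show ?thesis unfolding ae_vdef[OF assms(3)]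
    by (rule meas_up[OF assms(1) X(1)]) (use X(2) zsep[OF assms(3)] assms(4) in blast)+
qed

lemma ae_conj: assumes "fsub a" "ae a P" "ae a Q" shows "ae a (\<lambda>s. P s \<and> Q s)"
proof -
  obtain X where X: "X \<epsilon> meas a" "\<And>s. s \<epsilon> X \<longleftrightarrow> s \<epsilon> sp a \<and> P s" using assms(2) unfolding ae_iff by blast
  obtain Y where Y: "Y \<epsilon> meas a" "\<And>s. s \<epsilon> Y \<longleftrightarrow> s \<epsilon> sp a \<and> Q s" using assms(3) unfolding ae_iff by blast
  have Z: "z \<epsilon> zsep X (\<lambda>z. z \<epsilon> Y) \<longleftrightarrow> z \<epsilon> X \<and> z \<epsilon> Y" for z by (rule zsep) (intro definable_intros)
  have "zsep X (\<lambda>z. z \<epsilon> Y) \<epsilon> meas a" by (rule meas_inter[OF assms(1) X(1) Y(1) Z])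
  then show ?thesis unfolding ae_iff using X Y Z by blast
qed

lemma ae_not: assumes "fsub a" "vdef (\<lambda>\<rho>. P (\<rho> 0))" shows "ae a (\<lambda>s. \<not> P s) \<longleftrightarrow> \<not> ae a P"
proof -
  note z = zsep[OF assms(2)] zsep[OF vdef_neg[OF assms(2)]]
  have "zsep (sp a) P \<epsilon> meas a \<longleftrightarrow> \<not> zsep (sp a) (\<lambda>s. \<not> P s) \<epsilon> meas a"
    by (rule meas_diff[OF assms(1)]) (auto simp: z)
  then show ?thesis unfolding ae_vdef[OF assms(2)] ae_vdef[OF vdef_neg[OF assms(2)]] by simp
qed

lemma ae_sp: "fsub a \<Longrightarrow> (\<And>s. s \<epsilon> sp a \<Longrightarrow> P s) \<Longrightarrow> ae a P"
  unfolding ae_iff by (rule exI[of _ "sp a"]) (use sp_meas in blast)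

lemma ae_ex: assumes "fsub a" "ae a P" shows "\<exists>s. s \<epsilon> sp a \<and> P s"
proof (rule ccontr)
  assume "\<nexists>s. s \<epsilon> sp a \<and> P s"
  then have "ae a (\<lambda>_. False)" using assms(2) unfolding ae_iff by blast
  moreover have "ae a (\<lambda>_. \<not> False)" by (rule ae_sp[OF assms(1)]) simp
  ultimately show False using ae_not[OF assms(1), of "\<lambda>_. False", OF vdef_const] by blast
qed

lemma ae_const: assumes "fsub a" shows "ae a (\<lambda>_. b) \<longleftrightarrow> b"
  using ae_ex[OF assms, of "\<lambda>_. b"] ae_sp[OF assms, of "\<lambda>_. b"] by blast

lemma coherent:
  assumes "fsub a" "fsub b" "sub a b" "\<And>z. z \<epsilon> X \<Longrightarrow> z \<epsilon> sp a"
  shows "X \<epsilon> meas a \<longleftrightarrow> ae b (\<lambda>t. restr t a \<epsilon> X)"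
proof -
  have "ext_coherent UNIV F" using F unfolding extender_def by blast
  from this[unfolded ext_coherent_def ext_at_iff] show ?thesis
    using assms unfolding ae_def sub_def by simp
qed

text \<open>The underlying sets vary with the support, so a restriction may leave
  \<open>sp a\<close>. Coherence, applied to the full set \<open>sp a\<close>, says that this
  happens on a null set only.\<close>

lemma ae_restr: "fsub a \<Longrightarrow> fsub b \<Longrightarrow> sub a b \<Longrightarrow> ae b (\<lambda>t. restr t a \<epsilon> sp a)"
  using coherent[of a b "sp a"] sp_meas by blast

text \<open>Coherence speaks of subsets of \<open>sp a\<close>, so \<open>P\<close> is first cut
  down to \<open>sp a\<close>; after lifting, the cut is harmless because restrictions fall into
  \<open>sp a\<close> almost everywhere.\<close>

lemma ae_lift:
  assumes a: "fsub a" "fsub b" "sub a b" and P: "vdef (\<lambda>\<rho>. P (\<rho> 0))"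
  shows "ae a P \<longleftrightarrow> ae b (\<lambda>t. P (restr t a))"
proof -
  have v: "vdef (\<lambda>\<rho>. P (restr (\<rho> 0) a))" by (rule vdef_comp1[OF P]) (intro definable_intros)
  have v': "vdef (\<lambda>\<rho>. restr (\<rho> 0) a \<epsilon> sp a \<and> P (restr (\<rho> 0) a))" by (intro definable_intros v)
  have "ae a P \<longleftrightarrow> ae b (\<lambda>t. restr t a \<epsilon> sp a \<and> P (restr t a))"
    unfolding ae_vdef[OF P] coherent[OF a, of "zsep (sp a) P"] zsep[OF P]
    using coherent[OF a, of "zsep (sp a) P"] zsep[OF P] by simp
  also have "\<dots> \<longleftrightarrow> ae b (\<lambda>t. P (restr t a))"
  proof
    assume "ae b (\<lambda>t. restr t a \<epsilon> sp a \<and> P (restr t a))"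
    then show "ae b (\<lambda>t. P (restr t a))" by (rule ae_mono[OF a(2) _ v]) blast
  next
    assume "ae b (\<lambda>t. P (restr t a))"
    from ae_conj[OF a(2) ae_restr[OF a] this] show "ae b (\<lambda>t. restr t a \<epsilon> sp a \<and> P (restr t a))" .
  qed
  finally show ?thesis .
qed

section \<open>Codes of ultrapower elements and Los's theorem\<close>

abbreviation code :: "'v \<Rightarrow> bool" where "code \<equiv> ult_code UNIV F"

text \<open>The projection is built in, so that one point \<open>t\<close> of a large space
  evaluates codes with different smaller supports.\<close>

definition val :: "'v \<Rightarrow> 'v \<Rightarrow> 'v" where "val p t = fval (zsnd p) (restr t (zfst p))"

lemma code_iff: "code p \<longleftrightarrow> (\<exists>a f. p = opair a f \<and> fsub a \<and> fun_on f (sp a))"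
  unfolding ult_code_def by (simp add: ext_at_iff)

lemma vdef_code: "vterm a \<Longrightarrow> vdef (\<lambda>\<rho>. code (a \<rho>))"
  by (rule vdef_udef2[where P=ult_code, OF udef_ult_code]) (intro definable_intros)

lemma vterm_val: "vterm t \<Longrightarrow> vterm (\<lambda>\<rho>. val p (t \<rho>))"
  unfolding val_def by (intro definable_intros)

lemma val_restr: "sub (zfst p) c \<Longrightarrow> val p (restr t c) = val p t"
  unfolding val_def by (simp add: restr_restr)

lemma code_fsub: "code p \<Longrightarrow> fsub (zfst p)" unfolding code_iff by auto

abbreviation ult_in :: "'v \<Rightarrow> 'v \<Rightarrow> bool" where "ult_in \<equiv> ult_mem UNIV F"

abbreviation ult_same :: "'v \<Rightarrow> 'v \<Rightarrow> bool" where "ult_same \<equiv> ult_eq UNIV F"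

text \<open>The definition compares two codes over the union of their supports. Coherence allows any
  larger support \<open>c\<close>, which is what statements about three or more codes
  require.\<close>

lemma ult_rel_ae:
  assumes R: "vdef (\<lambda>\<rho>. R (\<rho> 0) (\<rho> (Suc 0)))" and p: "code p" and q: "code q"
    and c: "fsub c" "sub (zfst p) c" "sub (zfst q) c"
  shows "ult_rel R UNIV F p q \<longleftrightarrow> ae c (\<lambda>t. R (val p t) (val q t))"
proof -
  obtain a f b g where pq: "p = opair a f" "fsub a" "fun_on f (sp a)" "q = opair b g" "fsub b" "fun_on g (sp b)"
    using p q unfolding code_iff by blast
  define d where "d = un2 a b"
  have d: "fsub d" "sub a d" "sub b d" "sub d c"
    using pq c fsub_un2 unfolding d_def sub_def by auto
  define Q where "Q t \<longleftrightarrow> (\<exists>r s u v. r = restr t a \<and> s = restr t b \<and> opair r u \<epsilon> f \<and> opair s v \<epsilon> g \<and> R u v)" for t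
  note RR = vdef_comp2[OF R]
  have vQ: "vdef (\<lambda>\<rho>. Q (\<rho> 0))" unfolding Q_def by (intro definable_intros RR)
  have vR: "vdef (\<lambda>\<rho>. R (val p (\<rho> 0)) (val q (\<rho> 0)))" by (intro RR vterm_val definable_intros)
  have ae_r: "ae d (\<lambda>t. restr t a \<epsilon> sp a \<and> restr t b \<epsilon> sp b)"
    by (rule ae_conj) (auto intro: ae_restr d pq)
  have Q: "Q t \<longleftrightarrow> R (val p t) (val q t)" if "restr t a \<epsilon> sp a \<and> restr t b \<epsilon> sp b" for t
    using that fun_on_fval[OF pq(3)] fun_on_fval[OF pq(6)] unfolding Q_def val_def pq(1,4) by auto
  have "ult_rel R UNIV F p q \<longleftrightarrow> ae d Q"
    unfolding ult_rel_def Q_def ae_def pq(1,4) by (auto simp: ext_at_iff d_def d(1)[unfolded d_def])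
  also have "\<dots> \<longleftrightarrow> ae d (\<lambda>t. R (val p t) (val q t))"
  proof
    assume "ae d Q"
    from ae_conj[OF d(1) ae_r this] show "ae d (\<lambda>t. R (val p t) (val q t))"
      by (rule ae_mono[OF d(1) _ vR]) (use Q in blast)
  next
    assume "ae d (\<lambda>t. R (val p t) (val q t))"
    from ae_conj[OF d(1) ae_r this] show "ae d Q"
      by (rule ae_mono[OF d(1) _ vQ]) (use Q in blast)
  qed
  also have "\<dots> \<longleftrightarrow> ae c (\<lambda>t. R (val p (restr t d)) (val q (restr t d)))"
    by (rule ae_lift[OF d(1) c(1) d(4) vR])
  also have "\<dots> \<longleftrightarrow> ae c (\<lambda>t. R (val p t) (val q t))"
    using d pq by (simp add: val_restr)
  finally show ?thesis .
qed

lemma ult_in_ae: "code p \<Longrightarrow> code q \<Longrightarrow> fsub c \<Longrightarrow> sub (zfst p) c \<Longrightarrow> sub (zfst q) c \<Longrightarrow>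
    ult_in p q \<longleftrightarrow> ae c (\<lambda>t. val p t \<epsilon> val q t)"
  by (rule ult_rel_ae) (intro definable_intros)

lemma ult_same_ae: "code p \<Longrightarrow> code q \<Longrightarrow> fsub c \<Longrightarrow> sub (zfst p) c \<Longrightarrow> sub (zfst q) c \<Longrightarrow>
    ult_same p q \<longleftrightarrow> ae c (\<lambda>t. val p t = val q t)"
  by (rule ult_rel_ae) (intro definable_intros)

lemma code_opair: "fsub c \<Longrightarrow> fun_on g (sp c) \<Longrightarrow> code (opair c g)"
  unfolding code_iff by blast

lemma val_opair: "fsub c \<Longrightarrow> t \<epsilon> sp c \<Longrightarrow> val (opair c g) t = fval g t"
  unfolding val_def using restr_self[OF sp_fun_on[of c t]] by simp

text \<open>The infinitely many values of an assignment need not have a common finite support, so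
  \<open>c\<close> is only asked to contain the supports of the free variables. For the quantifier,
  a choice function on \<open>sp c\<close> collects counterexamples into one code with support
  \<open>c\<close>.\<close>

lemma los:
  assumes "\<And>i. code (\<rho> i)" "fsub c" "\<And>i. i \<in> fv \<phi> \<Longrightarrow> sub (zfst (\<rho> i)) c"
  shows "satG {p. code p} ult_in ult_same \<rho> \<phi> \<longleftrightarrow> ae c (\<lambda>t. satN UNIV (\<lambda>i. val (\<rho> i) t) \<phi>)"
  using assms
proof (induction \<phi> arbitrary: \<rho> c)
  case (Mem i k) then show ?case by (simp add: ult_in_ae)
next
  case (Eq i k) then show ?case by (simp add: ult_same_ae)
next
  case (Neg \<phi>)
  have v: "vdef (\<lambda>\<rho>'. satN UNIV (\<lambda>i. val (\<rho> i) (\<rho>' 0)) \<phi>)" by (intro vdef_satN vterm_val definable_intros)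
  show ?case using Neg.IH[of \<rho> c] Neg.prems ae_not[OF _ v] by simp
next
  case (Conj \<phi> \<psi>)
  have v: "vdef (\<lambda>\<rho>'. satN UNIV (\<lambda>i. val (\<rho> i) (\<rho>' 0)) \<phi>)" for \<phi> by (intro vdef_satN vterm_val definable_intros)
  have "ae c (\<lambda>t. P t \<and> Q t) \<longleftrightarrow> ae c P \<and> ae c Q" if "vdef (\<lambda>\<rho>. P (\<rho> 0))" "vdef (\<lambda>\<rho>. Q (\<rho> 0))" for P Q
    using ae_mono[OF Conj.prems(2) _ that(1)] ae_mono[OF Conj.prems(2) _ that(2)] ae_conj[OF Conj.prems(2)] by blast
  from this[OF v v] show ?case using Conj.IH[of \<rho> c] Conj.prems by simp
next
  case (All k \<phi>)
  have v: "vdef (\<lambda>\<sigma>. satN UNIV (\<lambda>i. val (\<rho> i) (\<sigma> 0)) \<phi>)" for \<phi> \<rho> by (intro vdef_satN vterm_val definable_intros)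
  have v2: "vdef (\<lambda>\<sigma>. satN UNIV ((\<lambda>i. val (\<rho> i) (\<sigma> 0))(k := \<sigma> (Suc 0))) \<phi>)"
  proof -
    have "vterm (\<lambda>\<sigma>. if i = k then \<sigma> (Suc 0) else val (\<rho> i) (\<sigma> 0))" for i
      by (cases "i = k") (auto intro: vterm_val vterm_var)
    from vdef_satN[of "\<lambda>i \<sigma>. if i = k then \<sigma> (Suc 0) else val (\<rho> i) (\<sigma> 0)", OF this]
    show ?thesis by (simp add: fun_upd_def)
  qed
  have upd: "(\<lambda>i. val ((\<rho>(k := q)) i) t) = (\<lambda>i. val (\<rho> i) t)(k := val q t)" for q t by auto
  show ?case
  proof
    assume L: "satG {p. code p} ult_in ult_same \<rho> (All k \<phi>)"
    \<comment> \<open>If the universal statement fails at \<open>t\<close>, then \<open>y\<close> is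
      a counterexample there; so a suitable \<open>y\<close> exists for every
      \<open>t\<close>.\<close>
    define P where "P t y \<longleftrightarrow> satN UNIV ((\<lambda>i. val (\<rho> i) t)(k := y)) \<phi> \<longrightarrow> satN UNIV (\<lambda>i. val (\<rho> i) t) (All k \<phi>)" for t y
    have "vdef (\<lambda>\<sigma>. P (\<sigma> 0) (\<sigma> (Suc 0)))" unfolding P_def by (intro definable_intros v v2)
    moreover have "\<exists>y. P t y" for t unfolding P_def satG.simps by blast
    ultimately have "\<exists>g. fun_on g (sp c) \<and> (\<forall>t. t \<epsilon> sp c \<longrightarrow> P t (fval g t))"
      by (rule choice_fun[where P=P])
    then obtain g where g: "fun_on g (sp c)" "\<And>t. t \<epsilon> sp c \<Longrightarrow> P t (fval g t)" by blast
    define q where "q = opair c g"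
    have q: "code q" "sub (zfst q) c" "\<And>t. t \<epsilon> sp c \<Longrightarrow> val q t = fval g t"
      unfolding q_def using code_opair val_opair All.prems(2) g(1) by (auto simp: sub_def)
    have "satG {p. code p} ult_in ult_same (\<rho>(k := q)) \<phi>" using L q(1) by simp
    then have "ae c (\<lambda>t. satN UNIV (\<lambda>i. val ((\<rho>(k := q)) i) t) \<phi>)"
      using All.IH[of "\<rho>(k := q)" c] All.prems q(1,2) by simp
    then show "ae c (\<lambda>t. satN UNIV (\<lambda>i. val (\<rho> i) t) (All k \<phi>))"
      by (rule ae_mono[OF All.prems(2) _ v]) (use g(2) q(3) upd P_def in metis)
  next
    assume R: "ae c (\<lambda>t. satN UNIV (\<lambda>i. val (\<rho> i) t) (All k \<phi>))"
    have "satG {p. code p} ult_in ult_same (\<rho>(k := q)) \<phi>" if q: "code q" for q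
    proof -
      \<comment> \<open>An arbitrary code \<open>q\<close> need not be supported by
        \<open>c\<close>, so the almost-everywhere statement is lifted to a support that includes
        both.\<close>
      define d where "d = un2 c (zfst q)"
      have d: "fsub d" "sub c d" "sub (zfst q) d"
        using All.prems(2) code_fsub[OF q] fsub_un2 unfolding d_def sub_def by auto
      have cd: "sub a c \<Longrightarrow> sub a d" for a using d unfolding sub_def by blast
      have "ae d (\<lambda>t. satN UNIV (\<lambda>i. val (\<rho> i) (restr t c)) (All k \<phi>))"
        using ae_lift[OF All.prems(2) d(1,2) v] R by blast
      then have "ae d (\<lambda>t. satN UNIV (\<lambda>i. val ((\<rho>(k := q)) i) t) \<phi>)"
      proof (rule ae_mono[OF d(1) _ v])
        fix t assume "satN UNIV (\<lambda>i. val (\<rho> i) (restr t c)) (All k \<phi>)"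
        also have "satN UNIV (\<lambda>i. val (\<rho> i) (restr t c)) (All k \<phi>) = satN UNIV (\<lambda>i. val (\<rho> i) t) (All k \<phi>)"
          by (rule satG_cong) (use All.prems(3) val_restr in blast)
        finally show "satN UNIV (\<lambda>i. val ((\<rho>(k := q)) i) t) \<phi>" unfolding upd by simp
      qed
      moreover have "satG {p. code p} ult_in ult_same (\<rho>(k := q)) \<phi> \<longleftrightarrow> ae d (\<lambda>t. satN UNIV (\<lambda>i. val ((\<rho>(k := q)) i) t) \<phi>)"
        by (rule All.IH) (use All.prems q d cd in auto)
      ultimately show ?thesis by blast
    qed
    then show "satG {p. code p} ult_in ult_same \<rho> (All k \<phi>)" by simp
  qed
qed

lemma vdef_ult_in: "vterm a \<Longrightarrow> vterm b \<Longrightarrow> vdef (\<lambda>\<rho>. ult_in (a \<rho>) (b \<rho>))"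
  by (rule vdef_udef3[where P=ult_mem, OF udef_ult_mem]) (intro definable_intros)

lemma vdef_ult_same: "vterm a \<Longrightarrow> vterm b \<Longrightarrow> vdef (\<lambda>\<rho>. ult_same (a \<rho>) (b \<rho>))"
  by (rule vdef_udef3[where P=ult_eq, OF udef_ult_eq]) (intro definable_intros)

definition supp3 :: "'v \<Rightarrow> 'v \<Rightarrow> 'v \<Rightarrow> 'v" where
  "supp3 p q r = un2 (zfst p) (un2 (zfst q) (zfst r))"

lemma supp3: assumes "code p" "code q" "code r"
  shows "fsub (supp3 p q r)" "sub (zfst p) (supp3 p q r)" "sub (zfst q) (supp3 p q r)" "sub (zfst r) (supp3 p q r)"
  unfolding supp3_def using assms fsub_un2 code_fsub by (auto simp: sub_def)

lemma ult_same_refl: assumes "code p" shows "ult_same p p"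
proof -
  note s = supp3[OF assms assms assms]
  show ?thesis unfolding ult_same_ae[OF assms assms s(1,2,2)] by (rule ae_sp[OF s(1)]) simp
qed

lemma ult_same_sym: assumes "code p" "code q" "ult_same p q" shows "ult_same q p"
proof -
  note s = supp3[OF assms(1,2,2)]
  show ?thesis using assms(3)
    unfolding ult_same_ae[OF assms(1,2) s(1,2,3)] ult_same_ae[OF assms(2,1) s(1,3,2)] by (simp add: eq_commute)
qed

lemma ult_same_trans: assumes c: "code p" "code q" "code r" and "ult_same p q" "ult_same q r" shows "ult_same p r"
proof -
  note s = supp3[OF c]
  have "ae (supp3 p q r) (\<lambda>t. val p t = val q t \<and> val q t = val r t)"
    by (rule ae_conj[OF s(1)]) (use assms s ult_same_ae in blast)+
  then have "ae (supp3 p q r) (\<lambda>t. val p t = val r t)"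
    by (rule ae_mono[OF s(1)]) (intro definable_intros vterm_val, auto)
  then show ?thesis using ult_same_ae c s by blast
qed

lemma ult_in_cong_left: assumes c: "code p" "code q" "code r" and "ult_same p q" "ult_in p r" shows "ult_in q r"
proof -
  note s = supp3[OF c]
  have "ae (supp3 p q r) (\<lambda>t. val p t = val q t \<and> val p t \<epsilon> val r t)"
    by (rule ae_conj[OF s(1)]) (use assms s ult_same_ae ult_in_ae in blast)+
  then have "ae (supp3 p q r) (\<lambda>t. val q t \<epsilon> val r t)"
    by (rule ae_mono[OF s(1)]) (intro definable_intros vterm_val, auto)
  then show ?thesis using ult_in_ae c s by blast
qed

lemma ult_in_cong_right: assumes c: "code p" "code q" "code r" and "ult_same q r" "ult_in p q" shows "ult_in p r"
proof -
  note s = supp3[OF c]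
  have "ae (supp3 p q r) (\<lambda>t. val q t = val r t \<and> val p t \<epsilon> val q t)"
    by (rule ae_conj[OF s(1)]) (use assms s ult_same_ae ult_in_ae in blast)+
  then have "ae (supp3 p q r) (\<lambda>t. val p t \<epsilon> val r t)"
    by (rule ae_mono[OF s(1)]) (intro definable_intros vterm_val, auto)
  then show ?thesis using ult_in_ae c s by blast
qed

text \<open>Extensionality of the ultrapower. Wherever the two values differ, a choice function
  picks an element of exactly one of them; the code of that function distinguishes \<open>p\<close>
  from \<open>q\<close>.\<close>

lemma code_ext:
  assumes c: "code p" "code q" and ne: "\<not> ult_same p q"
  shows "\<exists>r. code r \<and> (ult_in r p \<longleftrightarrow> \<not> ult_in r q)"
proof -
  define d where "d = supp3 p q q"
  note d = supp3[OF c c(2), folded d_def]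
  define P where "P t y \<longleftrightarrow> val p t \<noteq> val q t \<longrightarrow> (y \<epsilon> val p t \<longleftrightarrow> \<not> y \<epsilon> val q t)" for t y
  have "vdef (\<lambda>\<sigma>. P (\<sigma> 0) (\<sigma> (Suc 0)))" unfolding P_def by (intro definable_intros vterm_val)
  moreover have "\<exists>y. P t y" for t unfolding P_def using zext[of "val p t" "val q t"] by blast
  ultimately have "\<exists>g. fun_on g (sp d) \<and> (\<forall>t. t \<epsilon> sp d \<longrightarrow> P t (fval g t))"
    by (rule choice_fun[where P=P])
  then obtain g where g: "fun_on g (sp d)" "\<And>t. t \<epsilon> sp d \<Longrightarrow> P t (fval g t)" by blast
  define r where "r = opair d g"
  have r: "code r" "sub (zfst r) d" "\<And>t. t \<epsilon> sp d \<Longrightarrow> val r t = fval g t"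
    unfolding r_def using code_opair[OF d(1) g(1)] val_opair[OF d(1)] by (auto simp: sub_def)
  have v: "vdef (\<lambda>\<sigma>. val p (\<sigma> 0) = val q (\<sigma> 0))" by (intro definable_intros vterm_val)
  have v2: "vdef (\<lambda>\<sigma>. val r (\<sigma> 0) \<epsilon> val q (\<sigma> 0))" by (intro definable_intros vterm_val)
  have "ae d (\<lambda>t. \<not> val p t = val q t)"
    using ne ult_same_ae[OF c d(1-3)] ae_not[OF d(1) v] by blast
  then have A: "ae d (\<lambda>t. val r t \<epsilon> val p t \<longleftrightarrow> \<not> val r t \<epsilon> val q t)"
    by (rule ae_mono[OF d(1)]) (intro definable_intros vterm_val, use r(3) g(2) P_def in metis)
  have "ult_in r p \<longleftrightarrow> ae d (\<lambda>t. \<not> val r t \<epsilon> val q t)"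
  proof
    assume "ult_in r p"
    then have "ae d (\<lambda>t. val r t \<epsilon> val p t)" using ult_in_ae[OF r(1) c(1) d(1) r(2) d(2)] by blast
    from ae_conj[OF d(1) A this] show "ae d (\<lambda>t. \<not> val r t \<epsilon> val q t)"
      by (rule ae_mono[OF d(1)]) (intro definable_intros vterm_val, blast)
  next
    assume "ae d (\<lambda>t. \<not> val r t \<epsilon> val q t)"
    from ae_conj[OF d(1) A this] have "ae d (\<lambda>t. val r t \<epsilon> val p t)"
      by (rule ae_mono[OF d(1)]) (intro definable_intros vterm_val, blast)
    then show "ult_in r p" using ult_in_ae[OF r(1) c(1) d(1) r(2) d(2)] by blast
  qed
  then show ?thesis using ae_not[OF d(1) v2] ult_in_ae[OF r(1) c(2) d(1) r(2) d(3)] r(1) by blast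
qed

lemma ult_in_wf:
  assumes "\<exists>x. x \<epsilon> X" "\<And>x. x \<epsilon> X \<Longrightarrow> code x"
  shows "\<exists>m. m \<epsilon> X \<and> (\<forall>q. q \<epsilon> X \<longrightarrow> \<not> ult_in q m)"
proof -
  have "ult_wellfounded UNIV F" using F unfolding extender_def by blast
  then have "\<not> X = zemp \<and> (\<forall>p. p \<epsilon> X \<longrightarrow> code p) \<longrightarrow> (\<exists>p. p \<epsilon> X \<and> (\<forall>q. q \<epsilon> X \<longrightarrow> \<not> ult_in q p))"
    unfolding ult_wellfounded_def is_empty_iff by blast
  moreover have "X \<noteq> zemp" using assms(1) zemp by blast
  ultimately show ?thesis using assms(2) by blast
qed

section \<open>The Mostowski collapse of the ultrapower\<close>

definition closed_codes :: "'v \<Rightarrow> bool" where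
  "closed_codes D \<longleftrightarrow> (\<forall>p. p \<epsilon> D \<longrightarrow> code p) \<and>
    (\<forall>p q. p \<epsilon> D \<and> code q \<and> ult_in q p \<longrightarrow> (\<exists>r. r \<epsilon> D \<and> ult_same q r))"

lemma closed_codes_ex:
  assumes p: "code p" shows "\<exists>D. p \<epsilon> D \<and> closed_codes D"
proof -
  obtain a0 f0 where p0: "p = opair a0 f0" "fsub a0" "fun_on f0 (sp a0)" using p code_iff by blast
  have r0: "y \<epsilon> zrep (sp a0) (fval f0) \<longleftrightarrow> (\<exists>x. x \<epsilon> sp a0 \<and> y = fval f0 x)" for y
    by (rule zrep) (intro definable_intros)
  obtain T where T: "trans_set T" "zemp \<epsilon> T" "\<And>x. x \<epsilon> sp a0 \<Longrightarrow> fval f0 x \<epsilon> T"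
    using trans_closure[of "zinsert zemp (zrep (sp a0) (fval f0))"] r0 by auto
  \<comment> \<open>All codes whose functions take values in the transitive set \<open>T\<close>.\<close>
  define Z where "Z = zU (zU (zU (zU F)))"
  define B where "B = prodset (zP len) (zP (prodset Z T))"
  define D where "D = zsep B (\<lambda>p. code p \<and> (\<forall>a f x y. p = opair a f \<and> opair x y \<epsilon> f \<longrightarrow> y \<epsilon> T))"
  have D: "p \<epsilon> D \<longleftrightarrow> p \<epsilon> B \<and> code p \<and> (\<forall>a f x y. p = opair a f \<and> opair x y \<epsilon> f \<longrightarrow> y \<epsilon> T)" for p
    unfolding D_def by (rule zsep) (intro definable_intros vdef_code)
  have spZ: "s \<epsilon> Z" if s: "fsub a" "s \<epsilon> sp a" for s a
  proof -
    have "meas a \<epsilon> zU (zU F)" using opair_F s(1) opair_in_fld by blast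
    then show ?thesis using s(2) unfolding Z_def sp_def zU_iff by blast
  qed
  have inD: "opair a f \<epsilon> D" if a: "fsub a" "fun_on f (sp a)" "\<And>x. x \<epsilon> sp a \<Longrightarrow> fval f x \<epsilon> T" for a f
  proof -
    have y: "x \<epsilon> sp a \<and> y \<epsilon> T" if "opair x y \<epsilon> f" for x y
    proof -
      have x: "x \<epsilon> sp a" using fun_on_dom[OF a(2) that] .
      then show ?thesis using iffD1[OF fun_on_fval[OF a(2) x] that] a(3)[OF x] by simp
    qed
    have "f \<epsilon> zP (prodset Z T)"
      unfolding zP_iff prodset_iff
    proof (intro allI impI)
      fix z assume z: "z \<epsilon> f"
      then obtain x y' where "z = opair x y'" using a(2) unfolding fun_on_iff by blast
      then show "\<exists>x y. x \<epsilon> Z \<and> y \<epsilon> T \<and> z = opair x y" using y spZ[OF a(1)] z by blast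
    qed
    moreover have "a \<epsilon> zP len" using a(1) unfolding fsub_iff sub_def by simp
    ultimately have "opair a f \<epsilon> B" unfolding B_def prodset_iff by blast
    then show ?thesis unfolding D using code_opair[OF a(1,2)] y by auto
  qed
  have "p \<epsilon> D" unfolding p0(1) by (rule inD) (use p0 T in blast)+
  moreover have "\<exists>r. r \<epsilon> D \<and> ult_same q r" if p: "p \<epsilon> D" and q: "code q" and qp: "ult_in q p" for p q
  proof -
    obtain a f where af: "p = opair a f" "fsub a" "fun_on f (sp a)" using p D code_iff by blast
    have fT: "fval f x \<epsilon> T" if "x \<epsilon> sp a" for x
      using p fun_on_fval[OF af(3) that] unfolding D af(1) by blast
    obtain b g where bg: "q = opair b g" "fsub b" "fun_on g (sp b)" using q code_iff by blast
    \<comment> \<open>Values outside \<open>T\<close> are replaced by \<open>zemp\<close>, an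
      element of \<open>T\<close>. As \<open>q\<close> lies below \<open>p\<close>, almost all of
      its values are members of values in the transitive \<open>T\<close>, so only a null set
      changes.\<close>
    define G where "G s = (if fval g s \<epsilon> T then fval g s else zemp)" for s
    have vG: "vterm (\<lambda>\<rho>. G (\<rho> 0))" unfolding G_def by (intro definable_intros)
    define r where "r = opair b (lam (sp b) G)"
    have rD: "r \<epsilon> D" unfolding r_def
      by (rule inD[OF bg(2) lam_fun_on[OF vG]]) (simp add: lam_fval[OF vG], simp add: G_def T)
    then have cr: "code r" unfolding D by blast
    have cp: "code p" using p D by blast
    define c where "c = supp3 p q r"
    note c = supp3[OF cp q cr, folded c_def]
    have cc: "sub a c" "sub b c" using c(2,3) unfolding af(1) bg(1) by simp_all
    have "ae c (\<lambda>t. val q t \<epsilon> val p t)" using ult_in_ae[OF q cp c(1,3,2)] qp by blast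
    from ae_conj[OF c(1) this ae_conj[OF c(1) ae_restr[OF af(2) c(1) cc(1)] ae_restr[OF bg(2) c(1) cc(2)]]]
    have "ae c (\<lambda>t. val q t = val r t)"
    proof (rule ae_mono[OF c(1)])
      fix t assume t: "val q t \<epsilon> val p t \<and> restr t a \<epsilon> sp a \<and> restr t b \<epsilon> sp b"
      then have "val p t \<epsilon> T" unfolding val_def af(1) zfst zsnd using fT by blast
      then have "val q t \<epsilon> T" using t T(1) unfolding trans_set_def by blast
      then show "val q t = val r t" using t unfolding val_def bg(1) r_def zfst zsnd
        by (simp add: lam_fval[OF vG] G_def)
    qed (intro definable_intros vterm_val)
    then show ?thesis using ult_same_ae[OF q cr c(1,3,4)] rD by blast
  qed
  moreover have "code p" if "p \<epsilon> D" for p using that D by blast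
  ultimately show ?thesis unfolding closed_codes_def by blast
qed

abbreviation approx :: "'v \<Rightarrow> 'v \<Rightarrow> bool" where "approx \<equiv> collapse_approx UNIV F"

lemma approx_iff: "approx D g \<longleftrightarrow> fun_on g D \<and> closed_codes D \<and>
    (\<forall>p. p \<epsilon> D \<longrightarrow> (\<forall>z. z \<epsilon> fval g p \<longleftrightarrow> (\<exists>q. q \<epsilon> D \<and> ult_in q p \<and> z = fval g q)))"
proof (cases "fun_on g D")
  case True
  have 1: "opair p y \<epsilon> g \<longleftrightarrow> p \<epsilon> D \<and> y = fval g p" for p y
    using fun_on_fval[OF True] fun_on_dom[OF True] by blast
  show ?thesis unfolding collapse_approx_def closed_codes_def app_iff 1 by (simp; blast)
qed (simp add: collapse_approx_def)

lemma approx_ex: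
  assumes p: "code p" shows "\<exists>D g. p \<epsilon> D \<and> approx D g"
proof -
  obtain D where D: "p \<epsilon> D" "closed_codes D" using closed_codes_ex[OF p] by blast
  have v1: "vdef (\<lambda>\<rho>. ult_in (\<rho> 0) (\<rho> (Suc 0)))" by (intro definable_intros vdef_ult_in)
  have v2: "vterm (\<lambda>\<rho>. \<rho> 0 :: 'v)" by (intro definable_intros)
  have cD: "\<And>x. x \<epsilon> D \<Longrightarrow> code x" using D(2) unfolding closed_codes_def by blast
  have "\<exists>g. fun_on g D \<and> (\<forall>p. p \<epsilon> D \<longrightarrow> fval g p = zrep (zsep D (\<lambda>q. ult_in q p)) (fval g))"
    by (rule wf_recursion[where G="\<lambda>x. x", OF v1 v2]) (rule ult_in_wf, assumption, use cD in blast)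
  then obtain g where g: "fun_on g D" "\<And>p. p \<epsilon> D \<Longrightarrow> fval g p = zrep (zsep D (\<lambda>q. ult_in q p)) (fval g)"
    by blast
  have s: "q \<epsilon> zsep D (\<lambda>q. ult_in q p) \<longleftrightarrow> q \<epsilon> D \<and> ult_in q p" for q p by (rule zsep) (intro definable_intros vdef_ult_in)
  have r: "z \<epsilon> zrep A (fval g) \<longleftrightarrow> (\<exists>q. q \<epsilon> A \<and> z = fval g q)" for z A by (rule zrep) (intro definable_intros)
  have "z \<epsilon> fval g p \<longleftrightarrow> (\<exists>q. q \<epsilon> D \<and> ult_in q p \<and> z = fval g q)" if "p \<epsilon> D" for p z
    unfolding g(2)[OF that] r s by blast
  then show ?thesis using D g(1) unfolding approx_iff by blast
qed

text \<open>Two domains may share no code at all, so the comparison runs up to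
  \<open>ult_same\<close>. At a minimal disagreement, each member below one code is matched by
  closure with an equivalent code in the other domain, where the values already agree.\<close>

lemma approx_agree:
  assumes g: "approx D g" "approx D' g'" and p: "p \<epsilon> D" "p' \<epsilon> D'" "ult_same p p'"
  shows "fval g p = fval g' p'"
proof (rule ccontr)
  assume ne: "fval g p \<noteq> fval g' p'"
  define X where "X = zsep D (\<lambda>p. \<exists>p'. p' \<epsilon> D' \<and> ult_same p p' \<and> fval g p \<noteq> fval g' p')"
  have X: "p \<epsilon> X \<longleftrightarrow> p \<epsilon> D \<and> (\<exists>p'. p' \<epsilon> D' \<and> ult_same p p' \<and> fval g p \<noteq> fval g' p')" for p
    unfolding X_def by (rule zsep) (intro definable_intros vdef_ult_same)
  have c: "\<And>p. p \<epsilon> D \<Longrightarrow> code p" "\<And>p. p \<epsilon> D' \<Longrightarrow> code p"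
    and cl: "\<And>p q. p \<epsilon> D \<Longrightarrow> code q \<Longrightarrow> ult_in q p \<Longrightarrow> \<exists>r. r \<epsilon> D \<and> ult_same q r"
      "\<And>p q. p \<epsilon> D' \<Longrightarrow> code q \<Longrightarrow> ult_in q p \<Longrightarrow> \<exists>r. r \<epsilon> D' \<and> ult_same q r"
    and gg: "\<And>p z. p \<epsilon> D \<Longrightarrow> z \<epsilon> fval g p \<longleftrightarrow> (\<exists>q. q \<epsilon> D \<and> ult_in q p \<and> z = fval g q)"
      "\<And>p z. p \<epsilon> D' \<Longrightarrow> z \<epsilon> fval g' p \<longleftrightarrow> (\<exists>q. q \<epsilon> D' \<and> ult_in q p \<and> z = fval g' q)"
    using g unfolding approx_iff closed_codes_def by blast+
  have "\<exists>m. m \<epsilon> X \<and> (\<forall>q. q \<epsilon> X \<longrightarrow> \<not> ult_in q m)"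
    by (rule ult_in_wf) (use p ne c in \<open>unfold X, blast+\<close>)
  then obtain m where m: "m \<epsilon> X" "\<And>q. q \<epsilon> X \<Longrightarrow> \<not> ult_in q m" by blast
  then obtain m' where m': "m \<epsilon> D" "m' \<epsilon> D'" "ult_same m m'" "fval g m \<noteq> fval g' m'" unfolding X by blast
  note cm = c(1)[OF m'(1)] c(2)[OF m'(2)]
  have sub: "fval g q = fval g' r" if "q \<epsilon> D" "r \<epsilon> D'" "ult_same q r" "ult_in q m" for q r
    using that m(2)[of q] unfolding X by blast
  have "fval g m = fval g' m'"
  proof (rule zext)
    fix z
    show "z \<epsilon> fval g m \<longleftrightarrow> z \<epsilon> fval g' m'"
    proof
      assume "z \<epsilon> fval g m"
      then obtain q where q: "q \<epsilon> D" "ult_in q m" "z = fval g q" using gg(1)[OF m'(1)] by blast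
      have "ult_in q m'" using ult_in_cong_right[OF c(1)[OF q(1)] cm m'(3) q(2)] .
      then obtain r where r: "r \<epsilon> D'" "ult_same q r" using cl(2)[OF m'(2) c(1)[OF q(1)]] by blast
      have "ult_in r m'" using ult_in_cong_left[OF c(1)[OF q(1)] c(2)[OF r(1)] cm(2) r(2) \<open>ult_in q m'\<close>] .
      moreover have "z = fval g' r" using sub[OF q(1) r q(2)] q(3) by simp
      ultimately show "z \<epsilon> fval g' m'" unfolding gg(2)[OF m'(2)] using r(1) by blast
    next
      assume "z \<epsilon> fval g' m'"
      then obtain r where r: "r \<epsilon> D'" "ult_in r m'" "z = fval g' r" using gg(2)[OF m'(2)] by blast
      have rm: "ult_in r m" using ult_in_cong_right[OF c(2)[OF r(1)] cm(2,1) ult_same_sym[OF cm m'(3)] r(2)] .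
      then obtain q where q: "q \<epsilon> D" "ult_same r q" using cl(1)[OF m'(1) c(2)[OF r(1)]] by blast
      have qm: "ult_in q m" using ult_in_cong_left[OF c(2)[OF r(1)] c(1)[OF q(1)] cm(1) q(2) rm] .
      have "fval g q = fval g' r" by (rule sub[OF q(1) r(1) ult_same_sym[OF c(2)[OF r(1)] c(1)[OF q(1)] q(2)] qm])
      then have "z = fval g q" using r(3) by simp
      then show "z \<epsilon> fval g m" unfolding gg(1)[OF m'(1)] using q(1) qm by blast
    qed
  qed
  then show False using m'(4) by blast
qed

definition mostowski :: "'v \<Rightarrow> 'v" where "mostowski p = (THE y. collapse UNIV F p y)"

lemma collapse_iff_capp: "collapse UNIV F p y \<longleftrightarrow> (\<exists>D g. approx D g \<and> p \<epsilon> D \<and> y = fval g p)"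
proof -
  have "approx D g \<Longrightarrow> p \<epsilon> D \<Longrightarrow> opair p y \<epsilon> g \<longleftrightarrow> y = fval g p" for D g
    using fun_on_fval approx_iff by blast
  then show ?thesis unfolding collapse_def by auto
qed

lemma mostowski_capp: assumes "approx D g" "p \<epsilon> D" shows "mostowski p = fval g p"
proof -
  have "code p" using assms unfolding approx_iff closed_codes_def by blast
  have 1: "y = fval g p" if "collapse UNIV F p y" for y
    using that approx_agree[OF _ assms(1) _ assms(2) ult_same_refl[OF \<open>code p\<close>]] unfolding collapse_iff_capp by metis
  have 2: "collapse UNIV F p (fval g p)" using assms unfolding collapse_iff_capp by blast
  show ?thesis unfolding mostowski_def by (rule the_equality[where P="collapse UNIV F p", OF 2 1])
qed

lemma approx_code: "approx D g \<Longrightarrow> p \<epsilon> D \<Longrightarrow> code p"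
  unfolding approx_iff closed_codes_def by blast

lemma collapse_iff: "collapse UNIV F p y \<longleftrightarrow> code p \<and> y = mostowski p"
proof
  assume "collapse UNIV F p y"
  then obtain D g where "approx D g" "p \<epsilon> D" "y = fval g p" unfolding collapse_iff_capp by blast
  then show "code p \<and> y = mostowski p" using mostowski_capp[of D g p] approx_code[of D g p] by simp
next
  assume p: "code p \<and> y = mostowski p"
  then obtain D g where D: "p \<epsilon> D" "approx D g" using approx_ex[of p] by blast
  then show "collapse UNIV F p y" using p mostowski_capp[OF D(2,1)] unfolding collapse_iff_capp by blast
qed

lemma mostowski_ue: assumes "code p" "code q" "ult_same p q" shows "mostowski p = mostowski q"
proof -
  obtain D g where D: "p \<epsilon> D" "approx D g" using approx_ex[OF assms(1)] by blast
  obtain D' g' where D': "q \<epsilon> D'" "approx D' g'" using approx_ex[OF assms(2)] by blast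
  show ?thesis using approx_agree[OF D(2) D'(2) D(1) D'(1) assms(3)] mostowski_capp D D' by metis
qed

lemma mostowski_iff: assumes p: "code p" shows "z \<epsilon> mostowski p \<longleftrightarrow> (\<exists>q. code q \<and> ult_in q p \<and> z = mostowski q)"
proof -
  obtain D g where D: "p \<epsilon> D" "approx D g" using approx_ex[OF p] by blast
  have gg: "z \<epsilon> fval g p \<longleftrightarrow> (\<exists>q. q \<epsilon> D \<and> ult_in q p \<and> z = fval g q)" and cc: "closed_codes D"
    using D unfolding approx_iff by blast+
  have pr: "q \<epsilon> D \<Longrightarrow> mostowski q = fval g q" for q using mostowski_capp[OF D(2)] .
  show ?thesis
  proof
    assume "z \<epsilon> mostowski p"
    then obtain q where q: "q \<epsilon> D" "ult_in q p" "z = fval g q" unfolding pr[OF D(1)] gg by blast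
    then have "code q" using cc unfolding closed_codes_def by blast
    then show "\<exists>q. code q \<and> ult_in q p \<and> z = mostowski q" using q(2,3) pr[OF q(1)] by metis
  next
    assume "\<exists>q. code q \<and> ult_in q p \<and> z = mostowski q"
    then obtain q where q: "code q" "ult_in q p" "z = mostowski q" by blast
    then obtain r where r: "r \<epsilon> D" "ult_same q r" using cc D(1) unfolding closed_codes_def by blast
    then have cr: "code r" using cc unfolding closed_codes_def by blast
    have "ult_in r p" by (rule ult_in_cong_left[OF q(1) cr p r(2) q(2)])
    moreover have "z = fval g r" using mostowski_ue[OF q(1) cr r(2)] pr[OF r(1)] q(3) by simp
    ultimately show "z \<epsilon> mostowski p" unfolding pr[OF D(1)] gg using r(1) by blast
  qed
qed

text \<open>At a minimal failure \<open>m\<close>, \<open>m'\<close>, extensionality of the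
  ultrapower gives a code \<open>r\<close> below exactly one of them. Its collapse belongs to the
  common value, hence is also the collapse of some \<open>s\<close> below the other one; minimality
  identifies \<open>r\<close> with \<open>s\<close>.\<close>

lemma mostowski_inj:
  assumes "code p" "code q" "mostowski p = mostowski q" shows "ult_same p q"
proof (rule ccontr)
  assume ne: "\<not> ult_same p q"
  obtain D g where D: "p \<epsilon> D" "approx D g" using approx_ex[OF assms(1)] by blast
  obtain D' g' where D': "q \<epsilon> D'" "approx D' g'" using approx_ex[OF assms(2)] by blast
  define X where "X = zsep D (\<lambda>p. \<exists>q. q \<epsilon> D' \<and> fval g p = fval g' q \<and> \<not> ult_same p q)"
  have X: "p \<epsilon> X \<longleftrightarrow> p \<epsilon> D \<and> (\<exists>q. q \<epsilon> D' \<and> fval g p = fval g' q \<and> \<not> ult_same p q)" for p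
    unfolding X_def by (rule zsep) (intro definable_intros vdef_ult_same)
  have c: "\<And>p. p \<epsilon> D \<Longrightarrow> code p" "\<And>p. p \<epsilon> D' \<Longrightarrow> code p"
    and cl: "\<And>p q. p \<epsilon> D \<Longrightarrow> code q \<Longrightarrow> ult_in q p \<Longrightarrow> \<exists>r. r \<epsilon> D \<and> ult_same q r"
      "\<And>p q. p \<epsilon> D' \<Longrightarrow> code q \<Longrightarrow> ult_in q p \<Longrightarrow> \<exists>r. r \<epsilon> D' \<and> ult_same q r"
    using D(2) D'(2) unfolding approx_iff closed_codes_def by blast+
  have pr: "r \<epsilon> D \<Longrightarrow> mostowski r = fval g r" "r \<epsilon> D' \<Longrightarrow> mostowski r = fval g' r" for r
    using mostowski_capp D(2) D'(2) by blast+
  have "fval g p = fval g' q" using pr D(1) D'(1) assms(3) by simp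
  have "\<exists>m. m \<epsilon> X \<and> (\<forall>q. q \<epsilon> X \<longrightarrow> \<not> ult_in q m)"
    by (rule ult_in_wf) (use D(1) D'(1) ne c \<open>fval g p = fval g' q\<close> in \<open>unfold X, blast+\<close>)
  then obtain m where m: "m \<epsilon> X" "\<And>q. q \<epsilon> X \<Longrightarrow> \<not> ult_in q m" by blast
  then obtain m' where m': "m \<epsilon> D" "m' \<epsilon> D'" "fval g m = fval g' m'" "\<not> ult_same m m'" unfolding X by blast
  note cm = c(1)[OF m'(1)] c(2)[OF m'(2)]
  have pm: "mostowski m = mostowski m'" using pr m' by simp
  \<comment> \<open>Minimality concerns codes in the chosen domains; closure up to
    \<open>ult_same\<close> extends it to all codes below \<open>m\<close> and
    \<open>m'\<close>.\<close>
  have min: "ult_same r s" if r: "code r" "code s" "ult_in r m" "ult_in s m'" "mostowski r = mostowski s" for r s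
  proof -
    obtain r' where r': "r' \<epsilon> D" "ult_same r r'" using cl(1)[OF m'(1) r(1,3)] by blast
    obtain s' where s': "s' \<epsilon> D'" "ult_same s s'" using cl(2)[OF m'(2) r(2,4)] by blast
    note c' = c(1)[OF r'(1)] c(2)[OF s'(1)]
    have "fval g r' = fval g' s'"
      using mostowski_ue[OF r(1) c'(1) r'(2)] mostowski_ue[OF r(2) c'(2) s'(2)] pr r'(1) s'(1) r(5) by simp
    moreover have "ult_in r' m" using ult_in_cong_left[OF r(1) c'(1) cm(1) r'(2) r(3)] .
    ultimately have "ult_same r' s'" using m(2) r'(1) s'(1) unfolding X by blast
    then show ?thesis
      using ult_same_trans[OF r(1) c'(1) r(2) r'(2)] ult_same_trans[OF c' r(2) _ ult_same_sym[OF r(2) c'(2) s'(2)]] by blast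
  qed
  obtain r where r: "code r" "ult_in r m \<longleftrightarrow> \<not> ult_in r m'" using code_ext[OF cm m'(4)] by blast
  show False
  proof (cases "ult_in r m")
    case True
    then have "mostowski r \<epsilon> mostowski m'" using mostowski_iff[OF cm(1)] r(1) pm by metis
    then obtain s where s: "code s" "ult_in s m'" "mostowski r = mostowski s" using mostowski_iff[OF cm(2)] by blast
    have "ult_same r s" using min[OF r(1) s(1) True s(2,3)] .
    then have "ult_in r m'" using ult_in_cong_left[OF s(1) r(1) cm(2) ult_same_sym[OF r(1) s(1)] s(2)] by blast
    then show False using r True by blast
  next
    case False
    then have rm: "ult_in r m'" using r by blast
    then have "mostowski r \<epsilon> mostowski m" using mostowski_iff[OF cm(2)] r(1) pm by metis
    then obtain s where s: "code s" "ult_in s m" "mostowski r = mostowski s" using mostowski_iff[OF cm(1)] by blast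
    have "ult_same s r" using min[OF s(1) r(1) s(2) rm] s(3) by simp
    then have "ult_in r m" using ult_in_cong_left[OF s(1) r(1) cm(1) _ s(2)] by blast
    then show False using False by blast
  qed
qed

lemma mostowski_eq_iff: "code p \<Longrightarrow> code q \<Longrightarrow> ult_same p q \<longleftrightarrow> mostowski p = mostowski q"
  using mostowski_ue mostowski_inj by blast

lemma mostowski_mem_iff: assumes "code p" "code q" shows "ult_in p q \<longleftrightarrow> mostowski p \<epsilon> mostowski q"
proof
  assume "ult_in p q" then show "mostowski p \<epsilon> mostowski q" using mostowski_iff[OF assms(2)] assms(1) by blast
next
  assume "mostowski p \<epsilon> mostowski q"
  then obtain r where r: "code r" "ult_in r q" "mostowski p = mostowski r" using mostowski_iff[OF assms(2)] by blast
  then show "ult_in p q" using ult_in_cong_left[OF r(1) assms(1,2) _ r(2)] mostowski_inj[OF r(1) assms(1)] by simp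
qed

lemma Ult_eq: "Ult UNIV F = mostowski ` {p. code p}"
  unfolding Ult_def collapse_iff by blast

lemma Ult_transitive: "y \<in> Ult UNIV F \<Longrightarrow> z \<epsilon> y \<Longrightarrow> z \<in> Ult UNIV F"
  unfolding Ult_eq using mostowski_iff by blast

lemma sat_Ult: "(\<And>i. code (\<rho> i)) \<Longrightarrow> satG {p. code p} ult_in ult_same \<rho> \<phi> = satN (Ult UNIV F) (\<lambda>i. mostowski (\<rho> i)) \<phi>"
  unfolding Ult_eq by (rule satG_iso) (auto simp: mostowski_eq_iff mostowski_mem_iff)

section \<open>The embedding given by constant functions\<close>

definition kcode :: "'v \<Rightarrow> 'v" where "kcode x = opair zemp (lam (sp zemp) (\<lambda>_. x))"

lemma kcode: "code (kcode x)"
  unfolding kcode_def by (intro code_opair fsub_zemp lam_fun_on vterm_const)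

lemma kcode_val: "restr t zemp \<epsilon> sp zemp \<Longrightarrow> val (kcode x) t = x"
  unfolding val_def kcode_def by (simp add: lam_fval[OF vterm_const])

lemma const_code_iff: "const_code UNIV F x p \<longleftrightarrow> p = kcode x"
proof -
  have "f = lam (sp zemp) (\<lambda>_. x)" if f: "fun_on f (sp zemp)" "\<forall>s. s \<epsilon> sp zemp \<longrightarrow> opair s x \<epsilon> f" for f
  proof (rule zext)
    fix p
    show "p \<epsilon> f \<longleftrightarrow> p \<epsilon> lam (sp zemp) (\<lambda>_. x)"
      unfolding lam_iff[OF vterm_const] using f unfolding fun_on_iff by blast
  qed
  moreover have "\<forall>s. s \<epsilon> sp zemp \<longrightarrow> opair s x \<epsilon> lam (sp zemp) (\<lambda>_. x)"
    by (simp add: lam_opair[OF vterm_const])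
  ultimately show ?thesis
    unfolding const_code_def kcode_def using fsub_zemp lam_fun_on[OF vterm_const] by (auto simp: ext_at_iff)
qed

lemma emb_eq: "ult_emb UNIV F x = mostowski (kcode x)"
  unfolding ult_emb_def const_code_iff collapse_iff using kcode by auto

lemma emb_in: "ult_emb UNIV F x \<in> Ult UNIV F"
  unfolding emb_eq Ult_eq using kcode by blast

text \<open>Constant codes have empty support, and over it their values do not depend on the point.
  Los's theorem then says that truth of the formula in the universe holds almost everywhere, that
  is, holds.\<close>

theorem emb_elementary: "satN UNIV \<rho> \<phi> \<longleftrightarrow> satN (Ult UNIV F) (\<lambda>i. ult_emb UNIV F (\<rho> i)) \<phi>"
proof -
  have z: "sub (zfst (kcode x)) zemp" for x unfolding kcode_def sub_def by simp
  have "satN (Ult UNIV F) (\<lambda>i. ult_emb UNIV F (\<rho> i)) \<phi> \<longleftrightarrow> satG {p. code p} ult_in ult_same (\<lambda>i. kcode (\<rho> i)) \<phi>"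
    unfolding emb_eq using sat_Ult[of "\<lambda>i. kcode (\<rho> i)"] kcode by simp
  also have "\<dots> \<longleftrightarrow> ae zemp (\<lambda>t. satN UNIV (\<lambda>i. val (kcode (\<rho> i)) t) \<phi>)"
    by (rule los) (auto intro: kcode fsub_zemp z)
  also have "\<dots> \<longleftrightarrow> ae zemp (\<lambda>t. satN UNIV \<rho> \<phi>)"
  proof (rule ae_cong)
    fix t assume t: "t \<epsilon> sp zemp"
    then have "restr t zemp = t" using restr_self sp_fun_on[OF fsub_zemp] by blast
    then show "satN UNIV (\<lambda>i. val (kcode (\<rho> i)) t) \<phi> = satN UNIV \<rho> \<phi>" using t by (simp add: kcode_val)
  qed
  finally show ?thesis using ae_const[OF fsub_zemp] by simp
qed

text \<open>An element represented by a function \<open>f\<close> belongs to the image of the range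
  of \<open>f\<close>, since all values of \<open>f\<close> lie in that range.\<close>

lemma emb_cofinal: assumes "y \<in> Ult UNIV F" shows "\<exists>x. y \<epsilon> ult_emb UNIV F x"
proof -
  obtain p where p: "code p" "y = mostowski p" using assms unfolding Ult_eq by blast
  then obtain a f where af: "p = opair a f" "fsub a" "fun_on f (sp a)" unfolding code_iff by blast
  define x where "x = zrep (sp a) (fval f)"
  have x: "z \<epsilon> x \<longleftrightarrow> (\<exists>s. s \<epsilon> sp a \<and> z = fval f s)" for z unfolding x_def by (rule zrep) (intro definable_intros)
  have s: "sub (zfst p) a" "sub (zfst (kcode x)) a" unfolding af(1) kcode_def sub_def by simp_all
  have "sub zemp a" unfolding sub_def by simp
  from ae_restr[OF fsub_zemp af(2) this] have "ae a (\<lambda>t. val p t \<epsilon> val (kcode x) t)"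
    by (rule ae_mono[OF af(2)])
      (intro definable_intros vterm_val, use kcode_val val_opair[OF af(2)] x af(1) in metis)
  then have "ult_in p (kcode x)" using ult_in_ae[OF p(1) kcode af(2) s] by blast
  then show ?thesis unfolding emb_eq p(2) using mostowski_mem_iff[OF p(1) kcode] by blast
qed

end

section \<open>Transfer to inner models\<close>

text \<open>\<open>ult_emb\<close> is a description and not a formula. This relation is its graph as
  a formula, the form in which statements about the embedding are transported.\<close>

definition emb_rel :: "'v::zfc set \<Rightarrow> 'v \<Rightarrow> 'v \<Rightarrow> 'v \<Rightarrow> bool" where
  "emb_rel N E x y \<longleftrightarrow> (\<exists>p\<in>N. const_code N E x p \<and> collapse N E p y)"

lemma udef_emb_rel: "udef (\<lambda>N \<rho>. emb_rel N (\<rho> a) (\<rho> b) (\<rho> c))"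
  unfolding emb_rel_def by (intro udef_intros udef_const_code udef_collapse)

lemma ult_emb_rel: "ult_emb N E x = (THE y. y \<in> N \<and> emb_rel N E x y)"
  unfolding ult_emb_def emb_rel_def ..

lemma Ult_subset: "Ult N E \<subseteq> N" unfolding Ult_def by blast

text \<open>Relativizing the quantifiers of the defining formula to the definable class
  \<open>Ult N E\<close> gives a formula over \<open>N\<close>, with \<open>E\<close> as the new
  variable 0. In this way the universe can speak of truth in \<open>M F\<close>.\<close>

lemma udef_Ult:
  fixes P :: "'v::zfc set \<Rightarrow> (nat \<Rightarrow> 'v) \<Rightarrow> bool"
  assumes "udef P" shows "udef (\<lambda>N \<rho>. P (Ult N (\<rho> 0)) (\<lambda>i. \<rho> (Suc i)))"
proof -
  have "udef (\<lambda>N (\<rho> :: nat \<Rightarrow> 'v). satN (Ult N (\<rho> 0)) (\<lambda>i. \<rho> (Suc i)) \<phi>)" for \<phi>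
  proof (induction \<phi>)
    case (All k \<phi>)
    have "udef (\<lambda>N (\<rho> :: nat \<Rightarrow> 'v). \<rho> (Suc k) \<in> Ult N (\<rho> 0) \<longrightarrow> satN (Ult N (\<rho> 0)) (\<lambda>i. \<rho> (Suc i)) \<phi>)"
      by (intro udef_imp udef_in_Ult All)
    from udef_upd_all[OF this, of "Suc k"]
    have 1: "udef (\<lambda>N (\<rho> :: nat \<Rightarrow> 'v). \<forall>x\<in>N. x \<in> Ult N (\<rho> 0) \<longrightarrow>
      satN (Ult N (\<rho> 0)) (\<lambda>i. (\<rho>(Suc k := x)) (Suc i)) \<phi>)" by simp
    have 2: "(\<lambda>i. (\<rho>(Suc k := x)) (Suc i)) = (\<lambda>i. \<rho> (Suc i))(k := x)" for \<rho> and x :: 'v by auto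
    have 3: "(\<forall>x\<in>N. x \<in> Ult N e \<longrightarrow> R x) = (\<forall>x\<in>Ult N e. R x)" for N e and R :: "'v \<Rightarrow> bool"
      using Ult_subset by blast
    show ?case using 1 unfolding 2 3 satG.simps .
  next
    case (Mem i k) show ?case unfolding satG.simps by (rule udef_mem)
  next
    case (Eq i k) show ?case unfolding satG.simps by (rule udef_eq)
  next
    case (Neg \<phi>) show ?case unfolding satG.simps by (rule udef_neg[OF Neg])
  next
    case (Conj \<phi> \<psi>) show ?case unfolding satG.simps by (rule udef_conj[OF Conj])
  qed
  moreover obtain \<phi> where "\<And>N \<rho>. P N \<rho> = satN N \<rho> \<phi>" using assms unfolding udef_def by blast
  ultimately show ?thesis by (simp only:)
qed

text \<open>A finite conjunction indexed by a HOL natural number; it treats the finitely many free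
  variables of a formula together.\<close>

lemma udef_all_less:
  assumes "\<And>i. udef (Q i)" shows "udef (\<lambda>N \<rho>. \<forall>i<n::nat. Q i N \<rho>)"
proof (induction n)
  case 0 show ?case using udef_const[of True] by simp
next
  case (Suc n)
  have "udef (\<lambda>N \<rho>. Q n N \<rho> \<and> (\<forall>i<n. Q i N \<rho>))" by (rule udef_conj[OF assms Suc])
  moreover have "(\<forall>i<Suc n. R i) \<longleftrightarrow> R n \<and> (\<forall>i<n. R i)" for R :: "nat \<Rightarrow> bool"
    using less_Suc_eq by auto
  ultimately show ?case by (simp only:)
qed

text \<open>\<open>N\<close> is transitive and satisfies every first-order sentence that is true in the universe;
  free variables are read as universally quantified.\<close>

definition inner_model :: "'v::zfc set \<Rightarrow> bool" where
  "inner_model N \<longleftrightarrow> (\<forall>y z. y \<in> N \<and> z \<epsilon> y \<longrightarrow> z \<in> N) \<and>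
    (\<forall>P. udef P \<longrightarrow> (\<forall>\<rho>. P UNIV \<rho>) \<longrightarrow> (\<forall>\<rho>. (\<forall>i. \<rho> i \<in> N) \<longrightarrow> P N \<rho>))"

section \<open>Ultrapower embeddings computed in inner models\<close>

lemma inner_model_UNIV: "inner_model UNIV" unfolding inner_model_def by simp

lemma inner_model_trans: "inner_model N \<Longrightarrow> y \<in> N \<Longrightarrow> z \<epsilon> y \<Longrightarrow> z \<in> N" unfolding inner_model_def by blast

lemma inner_model_transfer: "inner_model N \<Longrightarrow> udef P \<Longrightarrow> (\<And>\<rho>. P UNIV \<rho>) \<Longrightarrow> (\<And>i. \<rho> i \<in> N) \<Longrightarrow> P N \<rho>"
  unfolding inner_model_def by blast

lemma elist_in: "set xs \<subseteq> N \<Longrightarrow> xs \<noteq> [] \<Longrightarrow> elist xs i \<in> N"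
  unfolding elist_def using last_in_set nth_mem by (cases "i < length xs") auto

lemma inner_model_transfer2:
  assumes "inner_model N" "udef (\<lambda>N \<rho>. P N (\<rho> 0) (\<rho> (Suc 0)))" "\<And>a b. P UNIV a b" "a \<in> N" "b \<in> N"
  shows "P N a b"
  using inner_model_transfer[OF assms(1,2), of "elist [a,b]"] assms(3-) elist_in[of "[a,b]" N] by simp

lemma univ_emb_rel:
  assumes "extender UNIV F" shows "emb_rel UNIV F x y \<longleftrightarrow> y = ult_emb UNIV F x"
proof -
  interpret univ_extender F by standard (rule assms)
  show ?thesis unfolding emb_rel_def const_code_iff collapse_iff emb_eq using kcode by blast
qed

lemma extender_in: "extender N E \<Longrightarrow> E \<in> N" unfolding extender_def by blast

text \<open>The description \<open>ult_emb\<close> denotes in \<open>N\<close> because existence and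
  uniqueness of the image is one first-order statement about all extenders and all sets, true in the
  universe and hence in \<open>N\<close>. The same scheme proves the facts on embeddings of
  \<open>N\<close> below.\<close>

lemma emb_rel_iff:
  assumes N: "inner_model N" "extender N E" and x: "x \<in> N" and y: "y \<in> N"
  shows "emb_rel N E x y \<longleftrightarrow> y = ult_emb N E x" and "ult_emb N E x \<in> Ult N E"
proof -
  define P where "P N E x \<longleftrightarrow> (extender N E \<longrightarrow>
    (\<exists>y\<in>N. y \<in> Ult N E \<and> emb_rel N E x y \<and> (\<forall>z\<in>N. emb_rel N E x z \<longrightarrow> z = y)))" for N and E x :: 'a
  have "P N E x"
  proof (rule inner_model_transfer2[where P=P, OF N(1)])
    show "udef (\<lambda>N \<rho>. P N (\<rho> 0) (\<rho> (Suc 0)))"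
      unfolding P_def by (intro udef_intros udef_extender udef_emb_rel udef_in_Ult)
    show "P UNIV F x" for F x
      unfolding P_def
    proof
      assume F: "extender UNIV F"
      show "\<exists>y\<in>UNIV. y \<in> Ult UNIV F \<and> emb_rel UNIV F x y \<and> (\<forall>z\<in>UNIV. emb_rel UNIV F x z \<longrightarrow> z = y)"
        unfolding univ_emb_rel[OF F] using univ_extender.emb_in[OF univ_extender.intro[OF F]] by blast
    qed
  qed (use x extender_in[OF N(2)] in auto)
  then obtain u where u: "u \<in> N" "u \<in> Ult N E" "emb_rel N E x u" "\<And>z. z \<in> N \<Longrightarrow> emb_rel N E x z \<Longrightarrow> z = u"
    using N(2) unfolding P_def by blast
  have "ult_emb N E x = u" unfolding ult_emb_rel
    by (rule the_equality[where P="\<lambda>y. y \<in> N \<and> emb_rel N E x y"]) (simp_all only: u(1,3) simp_thms, use u(4) in blast)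
  then show "emb_rel N E x y \<longleftrightarrow> y = ult_emb N E x" "ult_emb N E x \<in> Ult N E" using u y by metis+
qed

lemma emb_in_Ult: "inner_model N \<Longrightarrow> extender N E \<Longrightarrow> x \<in> N \<Longrightarrow> ult_emb N E x \<in> Ult N E"
  using emb_rel_iff(2) by blast

lemma emb_in_N: "inner_model N \<Longrightarrow> extender N E \<Longrightarrow> x \<in> N \<Longrightarrow> ult_emb N E x \<in> N"
  using emb_in_Ult Ult_subset by blast

text \<open>For one fixed formula, elementarity is a single statement about an extender and finitely
  many argument-value pairs of its embedding. Los's theorem makes it true in the universe, and
  \<open>N\<close> inherits it.\<close>

lemma emb_elem_sat:
  assumes N: "inner_model N" "extender N E" and \<rho>: "\<And>i. \<rho> i \<in> N"
  shows "satN N \<rho> \<phi> \<longleftrightarrow> satN (Ult N E) (\<lambda>i. ult_emb N E (\<rho> i)) \<phi>"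
proof -
  obtain n where n: "\<And>i. i \<in> fv \<phi> \<Longrightarrow> i < n" using finite_fv[of \<phi>] unfolding finite_nat_set_iff_bounded by blast
  define P where "P N \<sigma> \<longleftrightarrow> extender N (\<sigma> 0) \<and> (\<forall>i<n. emb_rel N (\<sigma> 0) (\<sigma> (Suc (2 * i))) (\<sigma> (Suc (Suc (2 * i))))) \<longrightarrow>
    (satN N (\<lambda>i. \<sigma> (Suc (2 * i))) \<phi> \<longleftrightarrow> satN (Ult N (\<sigma> 0)) (\<lambda>i. \<sigma> (Suc (Suc (2 * i)))) \<phi>)" for N and \<sigma> :: "nat \<Rightarrow> 'a"
  have 1: "udef (\<lambda>N \<sigma>. satN N (\<lambda>i. \<sigma> (Suc (2 * i))) \<phi>)"
    by (rule udef_ren[OF udef_sat, of "\<lambda>i. Suc (2 * i)"])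
  have 2: "udef (\<lambda>N \<sigma>. satN (Ult N (\<sigma> 0)) (\<lambda>i. \<sigma> (Suc (Suc (2 * i)))) \<phi>)"
    using udef_ren[OF udef_Ult[OF udef_sat[of \<phi>]], of "\<lambda>i. case i of 0 \<Rightarrow> 0 | Suc k \<Rightarrow> Suc (Suc (2 * k))"] by simp
  have P: "udef P" unfolding P_def
    by (intro udef_imp udef_conj udef_iff udef_extender udef_all_less udef_emb_rel 1 2)
  have "P UNIV \<sigma>" for \<sigma> unfolding P_def
  proof
    assume a: "extender UNIV (\<sigma> 0) \<and> (\<forall>i<n. emb_rel UNIV (\<sigma> 0) (\<sigma> (Suc (2 * i))) (\<sigma> (Suc (Suc (2 * i)))))"
    then have F: "extender UNIV (\<sigma> 0)" by blast
    have "satN UNIV (\<lambda>i. \<sigma> (Suc (2 * i))) \<phi> \<longleftrightarrow> satN (Ult UNIV (\<sigma> 0)) (\<lambda>i. ult_emb UNIV (\<sigma> 0) (\<sigma> (Suc (2 * i)))) \<phi>"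
      using univ_extender.emb_elementary[OF univ_extender.intro[OF F]] .
    also have "\<dots> \<longleftrightarrow> satN (Ult UNIV (\<sigma> 0)) (\<lambda>i. \<sigma> (Suc (Suc (2 * i)))) \<phi>"
      by (rule satG_cong) (use a n univ_emb_rel[OF F] in auto)
    finally show "satN UNIV (\<lambda>i. \<sigma> (Suc (2 * i))) \<phi> \<longleftrightarrow> satN (Ult UNIV (\<sigma> 0)) (\<lambda>i. \<sigma> (Suc (Suc (2 * i)))) \<phi>" .
  qed
  note tr = inner_model_transfer[OF N(1) P this]
  \<comment> \<open>The extender sits at variable 0, the arguments at the odd variables and their
    images at the following even ones.\<close>
  define \<sigma> where "\<sigma> i = (if i = 0 then E else if odd i then \<rho> (i div 2) else ult_emb N E (\<rho> (i div 2 - 1)))" for i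
  have s: "\<sigma> 0 = E" "\<sigma> (Suc (2 * i)) = \<rho> i" "\<sigma> (Suc (Suc (2 * i))) = ult_emb N E (\<rho> i)" for i
    unfolding \<sigma>_def by auto
  have "\<sigma> i \<in> N" for i unfolding \<sigma>_def using \<rho> extender_in[OF N(2)] emb_in_N[OF N \<rho>] by simp
  from tr[of \<sigma>, OF this] show ?thesis
    unfolding P_def s using N(2) emb_rel_iff(1)[OF N \<rho> emb_in_N[OF N \<rho>]] by simp
qed

lemma emb_elem:
  assumes N: "inner_model N" "extender N E" and P: "udef P" and \<rho>: "\<And>i. \<rho> i \<in> N"
  shows "P N \<rho> \<longleftrightarrow> P (Ult N E) (\<lambda>i. ult_emb N E (\<rho> i))"
proof -
  obtain \<phi> where "\<And>N \<rho>. P N \<rho> = satN N \<rho> \<phi>" using P unfolding udef_def by blast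
  then show ?thesis using emb_elem_sat[OF N \<rho>] by simp
qed

lemma emb_elem1:
  assumes "inner_model N" "extender N E" "udef (\<lambda>N \<rho>. P N (\<rho> 0))" "a \<in> N"
  shows "P N a \<longleftrightarrow> P (Ult N E) (ult_emb N E a)"
  using emb_elem[OF assms(1-3), of "elist [a]"] assms(4-) elist_in[of "[a]" N] by simp

lemma emb_elem2:
  assumes "inner_model N" "extender N E" "udef (\<lambda>N \<rho>. P N (\<rho> 0) (\<rho> (Suc 0)))" "a \<in> N" "b \<in> N"
  shows "P N a b \<longleftrightarrow> P (Ult N E) (ult_emb N E a) (ult_emb N E b)"
  using emb_elem[OF assms(1-3), of "elist [a,b]"] assms(4-) elist_in[of "[a,b]" N] by simp

lemma emb_elem3:
  assumes "inner_model N" "extender N E" "udef (\<lambda>N \<rho>. P N (\<rho> 0) (\<rho> (Suc 0)) (\<rho> (Suc (Suc 0))))" "a \<in> N" "b \<in> N" "c \<in> N"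
  shows "P N a b c \<longleftrightarrow> P (Ult N E) (ult_emb N E a) (ult_emb N E b) (ult_emb N E c)"
  using emb_elem[OF assms(1-3), of "elist [a,b,c]"] assms(4-) elist_in[of "[a,b,c]" N] by simp

lemma emb_elem4:
  assumes "inner_model N" "extender N E" "udef (\<lambda>N \<rho>. P N (\<rho> 0) (\<rho> (Suc 0)) (\<rho> (Suc (Suc 0))) (\<rho> (Suc (Suc (Suc 0)))))"
    "a \<in> N" "b \<in> N" "c \<in> N" "d \<in> N"
  shows "P N a b c d \<longleftrightarrow> P (Ult N E) (ult_emb N E a) (ult_emb N E b) (ult_emb N E c) (ult_emb N E d)"
  using emb_elem[OF assms(1-3), of "elist [a,b,c,d]"] assms(4-) elist_in[of "[a,b,c,d]" N] by simp

lemma emb_mem: "inner_model N \<Longrightarrow> extender N E \<Longrightarrow> a \<in> N \<Longrightarrow> b \<in> N \<Longrightarrow> a \<epsilon> b \<longleftrightarrow> ult_emb N E a \<epsilon> ult_emb N E b"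
  by (rule emb_elem2[where P="\<lambda>N a b. a \<epsilon> b"]) (auto intro: udef_mem)

lemma Ult_trans:
  assumes N: "inner_model N" "extender N E" and y: "y \<in> Ult N E" "z \<epsilon> y" shows "z \<in> Ult N E"
proof -
  define P where "P N E y \<longleftrightarrow> (extender N E \<longrightarrow> y \<in> Ult N E \<longrightarrow> (\<forall>z\<in>N. z \<epsilon> y \<longrightarrow> z \<in> Ult N E))" for N and E y :: 'a
  have yN: "y \<in> N" using y(1) Ult_subset by blast
  have "P N E y"
  proof (rule inner_model_transfer2[where P=P, OF N(1)])
    show "udef (\<lambda>N \<rho>. P N (\<rho> 0) (\<rho> (Suc 0)))"
      unfolding P_def by (intro udef_intros udef_extender udef_in_Ult)
    show "P UNIV F y" for F y
      unfolding P_def using univ_extender.Ult_transitive[OF univ_extender.intro] by blast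
  qed (use yN extender_in[OF N(2)] in auto)
  then show ?thesis using N y inner_model_trans[OF N(1) yN y(2)] unfolding P_def by blast
qed

fun close :: "nat list \<Rightarrow> fm \<Rightarrow> fm" where
  "close [] \<phi> = \<phi>" | "close (k # ks) \<phi> = All k (close ks \<phi>)"

lemma close_valid:
  fixes N :: "'v::zfc set"
  shows "(\<forall>\<rho>. (\<forall>i. \<rho> i \<in> N) \<longrightarrow> satN N \<rho> (close ks \<phi>)) \<longleftrightarrow> (\<forall>\<rho>. (\<forall>i. \<rho> i \<in> N) \<longrightarrow> satN N \<rho> \<phi>)"
proof (induction ks)
  case (Cons k ks)
  have "(\<forall>\<rho>. (\<forall>i. \<rho> i \<in> N) \<longrightarrow> satN N \<rho> (All k \<psi>)) \<longleftrightarrow> (\<forall>\<rho>. (\<forall>i. \<rho> i \<in> N) \<longrightarrow> satN N \<rho> \<psi>)" for \<psi>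
  proof safe
    fix \<rho> :: "nat \<Rightarrow> 'v"
    assume a: "\<forall>\<rho>. (\<forall>i. \<rho> i \<in> N) \<longrightarrow> satN N \<rho> (All k \<psi>)" and r: "\<forall>i. \<rho> i \<in> N"
    then have "satN N (\<rho>(k := \<rho> k)) \<psi>" unfolding satG.simps by blast
    then show "satN N \<rho> \<psi>" by simp
  next
    fix \<rho> :: "nat \<Rightarrow> 'v"
    assume a: "\<forall>\<rho>. (\<forall>i. \<rho> i \<in> N) \<longrightarrow> satN N \<rho> \<psi>" and r: "\<forall>i. \<rho> i \<in> N"
    then show "satN N \<rho> (All k \<psi>)" by simp
  qed
  then show ?case using Cons by simp
qed simp

lemma fv_close: "fv (close ks \<phi>) = fv \<phi> - set ks"
  by (induction ks) auto

text \<open>Elementarity transports truth only for parameters in the range of the embedding, whereas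
  \<open>inner_model\<close> allows any parameters from the class. The universal closure has no
  parameters left, so it can be transported and then instantiated freely.\<close>

lemma inner_model_Ult: assumes N: "inner_model N" "extender N E" shows "inner_model (Ult N E)"
  unfolding inner_model_def
proof (intro conjI allI impI)
  fix y z assume "y \<in> Ult N E \<and> z \<epsilon> y" then show "z \<in> Ult N E" using Ult_trans[OF N] by blast
next
  fix P :: "'a set \<Rightarrow> (nat \<Rightarrow> 'a) \<Rightarrow> bool" and \<rho> :: "nat \<Rightarrow> 'a"
  assume P: "udef P" "\<forall>\<rho>. P UNIV \<rho>" and \<rho>: "\<forall>i. \<rho> i \<in> Ult N E"
  obtain \<phi> where \<phi>: "\<And>N \<rho>. P N \<rho> = satN N \<rho> \<phi>" using P unfolding udef_def by blast
  obtain ks where ks: "set ks = fv \<phi>" using finite_list[OF finite_fv] by blast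
  have "\<forall>\<rho>. (\<forall>i. \<rho> i \<in> N) \<longrightarrow> satN N \<rho> \<phi>" using inner_model_transfer[OF N(1) P(1)] P(2) \<phi> by blast
  then have "\<forall>\<rho>. (\<forall>i. \<rho> i \<in> N) \<longrightarrow> satN N \<rho> (close ks \<phi>)" unfolding close_valid .
  \<comment> \<open>The closure is a sentence, so any assignment into \<open>N\<close> serves;
    \<open>E\<close> is an element at hand.\<close>
  then have "satN N (\<lambda>i. E) (close ks \<phi>)" using spec[of _ "\<lambda>i. E"] extender_in[OF N(2)] by fast
  then have 1: "satN (Ult N E) (\<lambda>i. ult_emb N E E) (close ks \<phi>)"
    using emb_elem_sat[OF N, of "\<lambda>_. E"] extender_in[OF N(2)] by blast
  have "satN (Ult N E) \<sigma> (close ks \<phi>)" for \<sigma>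
    using 1 satG_cong[of "close ks \<phi>" \<sigma> "\<lambda>i. ult_emb N E E"] by (simp add: fv_close ks)
  then have "\<forall>\<rho>. (\<forall>i. \<rho> i \<in> Ult N E) \<longrightarrow> satN (Ult N E) \<rho> \<phi>" using close_valid by blast
  then show "P (Ult N E) \<rho>" using \<phi> \<rho> by blast
qed

lemma emb_cofinal:
  assumes N: "inner_model N" "extender N E" and y: "y \<in> Ult N E" shows "\<exists>x\<in>N. y \<epsilon> ult_emb N E x"
proof -
  define P where "P N E y \<longleftrightarrow> (extender N E \<longrightarrow> y \<in> Ult N E \<longrightarrow> (\<exists>x\<in>N. \<exists>z\<in>N. emb_rel N E x z \<and> y \<epsilon> z))" for N and E y :: 'a
  have yN: "y \<in> N" using y(1) Ult_subset by blast
  have "P N E y"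
  proof (rule inner_model_transfer2[where P=P, OF N(1)])
    show "udef (\<lambda>N \<rho>. P N (\<rho> 0) (\<rho> (Suc 0)))"
      unfolding P_def by (intro udef_intros udef_extender udef_in_Ult udef_emb_rel)
    show "P UNIV F y" for F y
      unfolding P_def
    proof (intro impI)
      assume F: "extender UNIV F" "y \<in> Ult UNIV F"
      show "\<exists>x\<in>UNIV. \<exists>z\<in>UNIV. emb_rel UNIV F x z \<and> y \<epsilon> z"
        unfolding univ_emb_rel[OF F(1)] using univ_extender.emb_cofinal[OF univ_extender.intro[OF F(1)] F(2)] by blast
    qed
  qed (use yN extender_in[OF N(2)] in auto)
  then show ?thesis using N y emb_rel_iff[OF N] unfolding P_def by blast
qed

section \<open>Absoluteness of ordinals and pairs; the action of embeddings on ordinals\<close>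

lemma inner_model_ordinal:
  assumes "inner_model N" "x \<in> N" shows "ordinal N x \<longleftrightarrow> ord x"
proof -
  have t: "transitive N y \<longleftrightarrow> trans_set y" if "y \<in> N" for y
    unfolding transitive_def subset_of_def trans_set_def using inner_model_trans[OF assms(1)] that by blast
  have "ordinal N x \<longleftrightarrow> trans_set x \<and> (\<forall>y\<in>N. y \<epsilon> x \<longrightarrow> transitive N y)"
    unfolding ordinal_def t[OF assms(2)] ..
  then show ?thesis unfolding ord_iff using t inner_model_trans[OF assms] by blast
qed

text \<open>Transfer of Pairing gives \<open>N\<close> something that it regards as the pair;
  transitivity of \<open>N\<close> makes it the true one.\<close>

lemma inner_model_pair:
  assumes N: "inner_model N" and xy: "x \<in> N" "y \<in> N"
  shows "opair x y \<in> N" and "p \<in> N \<Longrightarrow> is_pair N x y p \<longleftrightarrow> p = opair x y"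
proof -
  have up: "is_upair N a b u \<longleftrightarrow> u = upair a b" if "u \<in> N" "a \<in> N" "b \<in> N" for a b u
    unfolding is_upair_def using inner_model_trans[OF N that(1)] that zext[of u "upair a b"] by auto
  have pr: "is_pair N x y p \<longleftrightarrow> p = opair x y" if "p \<in> N" for p
  proof
    assume "is_pair N x y p"
    then obtain u v where "u \<in> N" "v \<in> N" "is_upair N x x u" "is_upair N x y v" "is_upair N u v p"
      unfolding is_pair_def by blast
    then show "p = opair x y" using up xy that unfolding opair_def by metis
  next
    assume p: "p = opair x y"
    have "upair x x \<epsilon> p" "upair x y \<epsilon> p" unfolding p opair_def by simp_all
    then have "upair x x \<in> N" "upair x y \<in> N" using inner_model_trans[OF N that] by blast+
    then show "is_pair N x y p" unfolding is_pair_def using up xy p that unfolding opair_def by metis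
  qed
  have "\<exists>p\<in>N. is_pair N x y p"
  proof (rule inner_model_transfer2[where P="\<lambda>N x y. \<exists>p\<in>N. is_pair N x y p", OF N _ _ xy])
    show "udef (\<lambda>N \<rho>. \<exists>p\<in>N. is_pair N (\<rho> 0) (\<rho> (Suc 0)) p)" by (intro udef_intros udef_is_pair)
  qed simp
  then show "opair x y \<in> N" using pr by blast
  show "p \<in> N \<Longrightarrow> is_pair N x y p \<longleftrightarrow> p = opair x y" by (rule pr)
qed

lemma vterm_emb: "extender UNIV F \<Longrightarrow> vterm a \<Longrightarrow> vterm (\<lambda>\<rho>. ult_emb UNIV F (a \<rho>))"
  by (erule vterm_app1[rotated], unfold vterm_def univ_emb_rel[symmetric],
    rule vdef_udef3[where P=emb_rel, OF udef_emb_rel]) (intro definable_intros)+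

lemma univ_emb_ge:
  assumes F: "extender UNIV F" and x: "ord x" shows "\<not> ult_emb UNIV F x \<epsilon> x"
proof
  assume "ult_emb UNIV F x \<epsilon> x"
  moreover have "vdef (\<lambda>\<rho>. ult_emb UNIV F (\<rho> 0) \<epsilon> \<rho> 0)" by (intro definable_intros vterm_emb F)
  ultimately obtain m where m: "ord m" "ult_emb UNIV F m \<epsilon> m"
    "\<And>y. y \<epsilon> m \<Longrightarrow> \<not> ult_emb UNIV F y \<epsilon> y"
    using ord_least[of "\<lambda>x. ult_emb UNIV F x \<epsilon> x" x] x by blast
  show False using m(3)[OF m(2)] emb_mem[OF inner_model_UNIV F, of "ult_emb UNIV F m" m] m(2) by blast
qed

lemma emb_ge:
  assumes N: "inner_model N" "extender N E" and x: "x \<in> N" "ord x" shows "\<not> ult_emb N E x \<epsilon> x"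
proof -
  define P where "P N E x \<longleftrightarrow> (extender N E \<longrightarrow> ordinal N x \<longrightarrow> (\<forall>y\<in>N. emb_rel N E x y \<longrightarrow> \<not> y \<epsilon> x))" for N and E x :: 'a
  have "P N E x"
  proof (rule inner_model_transfer2[where P=P, OF N(1)])
    show "udef (\<lambda>N \<rho>. P N (\<rho> 0) (\<rho> (Suc 0)))"
      unfolding P_def by (intro udef_intros udef_extender udef_ordinal udef_emb_rel)
    show "P UNIV F y" for F y
      unfolding P_def by (intro impI ballI) (simp add: univ_emb_rel univ_emb_ge)
  qed (use x extender_in[OF N(2)] in auto)
  then show ?thesis using N x emb_rel_iff[OF N x(1)] inner_model_ordinal[OF N(1) x(1)] emb_in_N[OF N x(1)]
    unfolding P_def by blast
qed

lemma emb_ord: assumes N: "inner_model N" "extender N E" and x: "x \<in> N" "ord x" shows "ord (ult_emb N E x)"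
proof -
  have "ordinal N x \<longleftrightarrow> ordinal (Ult N E) (ult_emb N E x)"
    by (rule emb_elem1[where P=ordinal, OF N udef_ordinal x(1)])
  then show ?thesis
    using inner_model_ordinal[OF N(1) x(1)] inner_model_ordinal[OF inner_model_Ult[OF N] emb_in_Ult[OF N x(1)]] x(2) by blast
qed

text \<open>By elementarity \<open>j F\<close> maps the part of the class inside a set
  \<open>x\<close> to the part, inside \<open>j F x\<close>, of the class that the same formula
  defines in \<open>M F\<close> from \<open>j F F\<close>. These parts exhaust the latter class
  because the sets \<open>j F x\<close> cover \<open>M F\<close>.\<close>

lemma class_image_univ:
  assumes F: "extender UNIV F" and P: "udef (\<lambda>N \<rho>. P N (\<rho> 0) (\<rho> (Suc 0)))"
  shows "class_image UNIV (j F) {z. P UNIV z F} = {z \<in> M F. P (M F) z (j F F)}"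
proof -
  note e = inner_model_UNIV F
  define Q where "Q N c x F \<longleftrightarrow> (\<forall>z\<in>N. z \<epsilon> c \<longleftrightarrow> P N z F \<and> z \<epsilon> x)" for N and c x F :: 'a
  have P': "udef (\<lambda>N \<rho>. P N (\<rho> 0) (\<rho> (Suc (Suc (Suc 0)))))"
    using udef_ren[OF P, of "\<lambda>i. if i = 0 then 0 else 3"] by (simp add: numeral_eq_Suc)
  have "udef (\<lambda>N \<rho>. Q N (\<rho> 0) (\<rho> (Suc 0)) (\<rho> (Suc (Suc 0))))"
    unfolding Q_def by (intro udef_intros P')
  from emb_elem3[where P=Q, OF e this]
  have Q: "Q UNIV c x F \<longleftrightarrow> Q (M F) (j F c) (j F x) (j F F)" for c x by blast
  have M: "j F c \<in> M F" for c using emb_in_Ult[OF e] by blast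
  show ?thesis
  proof safe
    fix y assume "y \<in> class_image UNIV (j F) {z. P UNIV z F}"
    then obtain x c where c: "Q UNIV c x F" "y \<epsilon> j F c" unfolding class_image_def Q_def by blast
    show yM: "y \<in> M F" using Ult_trans[OF e M c(2)] .
    show "P (M F) y (j F F)" using c Q yM unfolding Q_def by blast
  next
    fix y assume y: "y \<in> M F" "P (M F) y (j F F)"
    obtain x where x: "y \<epsilon> j F x" using emb_cofinal[OF e y(1)] by blast
    have v: "vdef (\<lambda>\<rho>. P UNIV (\<rho> 0) F)" by (rule vdef_udef2[where P=P, OF P]) (intro definable_intros)+
    define c where "c = zsep x (\<lambda>z. P UNIV z F)"
    have c: "Q UNIV c x F" unfolding Q_def c_def zsep[OF v] by blast
    then have "y \<epsilon> j F c" using Q x y unfolding Q_def by blast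
    then show "y \<in> class_image UNIV (j F) {z. P UNIV z F}" using c unfolding class_image_def Q_def by blast
  qed
qed

section \<open>Identification of j_F(M_F) and j_F(j_F), and their comparison with j_F\<close>

lemma M2_eq: assumes F: "extender UNIV F" shows "M2 F = Ult (M F) (j F F)"
proof -
  have "M2 F = {z \<in> M F. z \<in> Ult (M F) (j F F)}"
    using class_image_univ[OF F, where P="\<lambda>N z F. z \<in> Ult N F", OF udef_in_Ult] unfolding M2_def by simp
  then show ?thesis using Ult_subset by blast
qed

text \<open>The graph of \<open>j F\<close> is defined in the universe from \<open>F\<close>, so its
  image is the graph that \<open>M F\<close> defines from \<open>j F F\<close>. Absoluteness of
  pairs lets \<open>class_app\<close>, which reads pairs in the universe, recover the
  function.\<close>

lemma jj_eq: assumes F: "extender UNIV F" and x: "x \<in> M F" shows "jj F x = ult_emb (M F) (j F F) x"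
proof -
  note e = inner_model_UNIV F
  have g: "inner_model (M F)" by (rule inner_model_Ult[OF e])
  have F1: "extender (M F) (j F F)"
    using emb_elem1[where P=extender, OF e udef_extender, of F] F by simp
  define P where "P N p F \<longleftrightarrow> (\<exists>x\<in>N. \<exists>y\<in>N. is_pair N x y p \<and> emb_rel N F x y)" for N and p F :: 'a
  have P: "udef (\<lambda>N \<rho>. P N (\<rho> 0) (\<rho> (Suc 0)))" unfolding P_def by (intro udef_intros udef_is_pair udef_emb_rel)
  have "graph UNIV UNIV (j F) = {p. P UNIV p F}"
    unfolding graph_def P_def using univ_emb_rel[OF F] by auto
  then have J: "class_image UNIV (j F) (graph UNIV UNIV (j F)) = {p \<in> M F. P (M F) p (j F F)}"
    using class_image_univ[where P=P, OF F P] by simp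
  have "(\<exists>p\<in>{p \<in> M F. P (M F) p (j F F)}. is_pair UNIV x y p) \<longleftrightarrow> y = ult_emb (M F) (j F F) x" for y
  proof
    assume "\<exists>p\<in>{p \<in> M F. P (M F) p (j F F)}. is_pair UNIV x y p"
    then have o: "opair x y \<in> M F" "P (M F) (opair x y) (j F F)" by auto
    then obtain x' y' where "x' \<in> M F" "y' \<in> M F" "is_pair (M F) x' y' (opair x y)" "emb_rel (M F) (j F F) x' y'"
      unfolding P_def by blast
    then show "y = ult_emb (M F) (j F F) x" using inner_model_pair(2)[OF g] o emb_rel_iff[OF g F1] by auto
  next
    assume y: "y = ult_emb (M F) (j F F) x"
    then have yM: "y \<in> M F" using emb_in_N[OF g F1 x] by simp
    have o: "opair x y \<in> M F" by (rule inner_model_pair(1)[OF g x yM])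
    then have "P (M F) (opair x y) (j F F)"
      unfolding P_def using inner_model_pair(2)[OF g x yM o] emb_rel_iff[OF g F1 x yM] y x yM by blast
    then show "\<exists>p\<in>{p \<in> M F. P (M F) p (j F F)}. is_pair UNIV x y p" using o by auto
  qed
  then show ?thesis unfolding jj_def class_app_def J by simp
qed

text \<open>Presents the embedding by \<open>E\<close> in \<open>M F\<close> as a relation over the
  universe in the parameters \<open>F\<close> and \<open>E\<close>, so that \<open>j F\<close> can
  act on it and least ordinals can be chosen.\<close>

lemma udef_emb_rel_Ult: "udef (\<lambda>N \<rho>. emb_rel (Ult N (\<rho> a)) (\<rho> b) (\<rho> c) (\<rho> d))"
  using udef_ren[OF udef_Ult[OF udef_emb_rel[of 0 1 2]], of "elist [a,b,c,d]"]
  by (simp add: numeral_eq_Suc)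

lemma jj_le_j:
  assumes F: "extender UNIV F" and a: "a \<in> M F" "ord a"
  shows "ult_emb (M F) (j F F) a \<epsilon> j F a \<or> (\<exists>c. ord c \<and> a = j F c)"
proof -
  note e = inner_model_UNIV F
  have g: "inner_model (M F)" by (rule inner_model_Ult[OF e])
  have F1: "extender (M F) (j F F)"
    using emb_elem1[where P=extender, OF e udef_extender, of F] F by simp
  have v: "vdef (\<lambda>\<rho>. \<not> j F (\<rho> 0) \<epsilon> a)" by (intro definable_intros vterm_emb F)
  \<comment> \<open>If \<open>a < j c\<close>, apply \<open>j\<close> to \<open>\<forall>b < c. j b < a\<close> and specialize to \<open>b = a\<close>.\<close>
  obtain c where c: "ord c" "\<not> j F c \<epsilon> a" "\<And>b. b \<epsilon> c \<Longrightarrow> j F b \<epsilon> a"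
    using ord_least[of "\<lambda>x. \<not> j F x \<epsilon> a", OF v a(2) univ_emb_ge[OF F a(2)]] by blast
  show ?thesis
  proof (cases "a = j F c")
    case False
    then have ac: "a \<epsilon> j F c"
      using ord_linear[OF a(2) emb_ord[OF e _ c(1)]] c(2) by blast
    define P where "P N F c a \<longleftrightarrow> (\<forall>b\<in>N. \<forall>y\<in>N. b \<epsilon> c \<and> emb_rel N F b y \<longrightarrow> y \<epsilon> a)" for N and F c a :: 'a
    have P: "udef (\<lambda>N \<rho>. P N (\<rho> 0) (\<rho> (Suc 0)) (\<rho> (Suc (Suc 0))))"
      unfolding P_def by (intro udef_intros udef_emb_rel)
    have "P UNIV F c a" unfolding P_def univ_emb_rel[OF F] using c(3) by blast
    then have "P (M F) (j F F) (j F c) (j F a)" using emb_elem3[where P=P, OF e P, of F c a] by blast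
    then have "ult_emb (M F) (j F F) a \<epsilon> j F a"
      unfolding P_def using a(1) ac emb_rel_iff(1)[OF g F1 a(1) emb_in_N[OF g F1 a(1)]] emb_in_N[OF g F1 a(1)] by blast
    then show ?thesis by blast
  qed (use c in blast)
qed

section \<open>The commutation hypothesis at a least counterexample\<close>

theorem mainTheorem10:
  fixes F E :: "'v::zfc"
  assumes "extender V F"
    and "E \<in> M F"
    and "extender (M F) E"
    and "commute (M2 F) (jj F E) (j F E)"
  shows "\<forall>\<xi>. ordinal V \<xi> \<longrightarrow> ult_emb (M F) E (j F \<xi>) = j F \<xi>"
proof -
  note F = assms(1) and EM = assms(2) and E = assms(3)
  note e = inner_model_UNIV F
  \<comment> \<open>Here \<open>k\<close> is j_F(j_F), \<open>N\<close> is M_{F^2}, and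
    \<open>E0\<close>, \<open>E1\<close> will be the two images of \<open>E\<close>.\<close>
  define k where "k = ult_emb (M F) (j F F)"
  define i where "i = ult_emb (M F) E"
  define N where "N = Ult (M F) (j F F)"
  have M2: "M2 F = N" unfolding N_def by (rule M2_eq[OF F])
  have g1: "inner_model (M F)" by (rule inner_model_Ult[OF e])
  have F1: "extender (M F) (j F F)"
    using emb_elem1[where P=extender, OF e udef_extender, of F] F by simp
  have g2: "inner_model N" unfolding N_def by (rule inner_model_Ult[OF g1 F1])
  have jM: "j F x \<in> M F" for x using emb_in_Ult[OF e] by blast
  have kN: "x \<in> M F \<Longrightarrow> k x \<in> N" for x unfolding k_def N_def by (rule emb_in_Ult[OF g1 F1])
  have iM: "x \<in> M F \<Longrightarrow> i x \<in> M F" for x unfolding i_def by (rule emb_in_N[OF g1 E])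
  define E0 where "E0 = k E"
  define E1 where "E1 = j F E"
  have jjE: "jj F E = E0" unfolding E0_def k_def by (rule jj_eq[OF F EM])
  have E0: "extender N E0"
    unfolding N_def E0_def k_def using emb_elem1[where P=extender, OF g1 F1 udef_extender EM] E by simp
  \<comment> \<open>That \<open>E\<close> is an extender in \<open>M F\<close> is read as a
    statement of the universe about \<open>F\<close> and \<open>E\<close>; its image under
    \<open>j F\<close> concerns the ultrapower of \<open>M F\<close> by \<open>j F F\<close>, which
    is \<open>N\<close>.\<close>
  have "udef (\<lambda>N \<rho>. extender (Ult N (\<rho> 0)) (\<rho> (Suc 0)))"
    by (rule udef_Ult[OF udef_extender[of 0]])
  from emb_elem2[where P="\<lambda>N F E. extender (Ult N F) E", OF e this, of F E]
  have E1: "extender N E1" unfolding N_def E1_def using E by simp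
  define i0 where "i0 = ult_emb N E0"
  define i1 where "i1 = ult_emb N E1"
  have i1N: "x \<in> N \<Longrightarrow> i1 x \<in> N" for x unfolding i1_def by (rule emb_in_N[OF g2 E1])
  have jN: "x \<in> M F \<Longrightarrow> j F x \<in> N" for x
    unfolding N_def using emb_elem2[where P="\<lambda>N x F. x \<in> Ult N F", OF e udef_in_Ult, of x F] by blast
  \<comment> \<open>One fact about \<open>i\<close> is transported twice: as a statement of the
    universe by \<open>j F\<close>, yielding the embedding \<open>i1\<close> by
    \<open>j F E\<close>, and as a statement of \<open>M F\<close> by \<open>k\<close>, yielding the
    embedding \<open>i0\<close> by \<open>k E\<close>.\<close>
  have i1j: "i1 (j F a) = j F (i a)" if a: "a \<in> M F" for a
  proof -
    have "emb_rel (Ult UNIV F) E a (i a)" unfolding i_def using emb_rel_iff(1)[OF g1 E a emb_in_N[OF g1 E a]] by simp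
    then have "emb_rel N E1 (j F a) (j F (i a))" unfolding N_def E1_def
      using emb_elem4[where P="\<lambda>N F. emb_rel (Ult N F)", OF e udef_emb_rel_Ult, of F E a "i a"] by blast
    then show ?thesis unfolding i1_def using emb_rel_iff(1)[OF g2 E1 jN[OF a] jN[OF iM[OF a]]] by simp
  qed
  have i0k: "i0 (k a) = k (i a)" if a: "a \<in> M F" for a
  proof -
    have "emb_rel (M F) E a (i a)" unfolding i_def using emb_rel_iff(1)[OF g1 E a emb_in_N[OF g1 E a]] by simp
    then have "emb_rel N E0 (k a) (k (i a))" unfolding N_def E0_def k_def
      using emb_elem3[where P=emb_rel, OF g1 F1 udef_emb_rel EM a iM[OF a]] by blast
    then show ?thesis unfolding i0_def using emb_rel_iff(1)[OF g2 E0 kN[OF a] kN[OF iM[OF a]]] by simp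
  qed
  \<comment> \<open>Apply \<open>j F\<close> to the relation between \<open>x\<close> and
    \<open>j F x\<close>: the embedding itself turns into \<open>k\<close>.\<close>
  have kj: "k (j F x) = j F (j F x)" for x
  proof -
    have "emb_rel UNIV F x (j F x)" using univ_emb_rel[OF F] by simp
    then have "emb_rel (M F) (j F F) (j F x) (j F (j F x))"
      using emb_elem3[where P=emb_rel, OF e udef_emb_rel, of F x "j F x"] by blast
    then show ?thesis unfolding k_def using emb_rel_iff(1)[OF g1 F1 jM jM] by simp
  qed
  have k_mem: "a \<in> M F \<Longrightarrow> b \<in> M F \<Longrightarrow> a \<epsilon> b \<longleftrightarrow> k a \<epsilon> k b" for a b
    unfolding k_def by (rule emb_mem[OF g1 F1])
  have ordj: "ord x \<Longrightarrow> ord (j F x)" for x using emb_ord[OF e] by blast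
  have ordi: "x \<in> M F \<Longrightarrow> ord x \<Longrightarrow> ord (i x)" for x unfolding i_def by (rule emb_ord[OF g1 E])
  have ordk: "x \<in> M F \<Longrightarrow> ord x \<Longrightarrow> ord (k x)" for x unfolding k_def by (rule emb_ord[OF g1 F1])
  show ?thesis
  proof (rule ccontr)
    assume "\<not> ?thesis"
    then obtain \<xi>0 where \<xi>0: "ord \<xi>0" "i (j F \<xi>0) \<noteq> j F \<xi>0" unfolding i_def by blast
    \<comment> \<open>Written through \<open>emb_rel\<close>, the inequality is definable from
      \<open>F\<close> and \<open>E\<close>, which permits the choice of a least
      \<open>\<xi>\<close>.\<close>
    have neq_iff: "i (j F x) \<noteq> j F x \<longleftrightarrow> \<not> emb_rel (Ult UNIV F) E (j F x) (j F x)" for x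
      unfolding i_def using emb_rel_iff(1)[OF g1 E jM jM] by auto
    have "vdef (\<lambda>\<rho>. i (j F (\<rho> 0)) \<noteq> j F (\<rho> 0))"
      unfolding neq_iff
      by (intro vdef_neg vdef_comp4[where P="\<lambda>F. emb_rel (Ult UNIV F)", OF vdef_udef[OF udef_emb_rel_Ult]] definable_intros vterm_emb F)
    from ord_least[where P="\<lambda>x. i (j F x) \<noteq> j F x", OF this \<xi>0]
    obtain \<xi> where \<xi>: "ord \<xi>" "i (j F \<xi>) \<noteq> j F \<xi>" "\<And>y. y \<epsilon> \<xi> \<Longrightarrow> i (j F y) = j F y" by blast
    define \<eta> where "\<eta> = j F \<xi>"
    have \<eta>: "\<eta> \<in> M F" "ord \<eta>" unfolding \<eta>_def using jM ordj \<xi>(1) by blast+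
    have \<eta>i: "\<eta> \<epsilon> i \<eta>"
      using ord_linear[OF \<eta>(2) ordi[OF \<eta>]] emb_ge[OF g1 E \<eta>] \<xi>(2) unfolding \<eta>_def i_def by metis
    define x where "x = j F \<eta>"
    have xk: "x = k \<eta>" unfolding x_def \<eta>_def by (rule kj[symmetric])
    have xN: "x \<in> N" "ord x" unfolding x_def using jN[OF \<eta>(1)] ordj[OF \<eta>(2)] by blast+
    have i0x: "i0 x = k (i \<eta>)" unfolding xk by (rule i0k[OF \<eta>(1)])
    have i1x: "i1 x = j F (i \<eta>)" unfolding x_def by (rule i1j[OF \<eta>(1)])
    have x_lt: "x \<epsilon> i0 x" unfolding i0x unfolding xk using k_mem[OF \<eta>(1) iM[OF \<eta>(1)]] \<eta>i by blast
    \<comment> \<open>This is \<open>jj_le_j\<close> at \<open>i \<eta>\<close>; if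
      \<open>i \<eta>\<close> is in the range of \<open>j F\<close>, then \<open>kj\<close> gives
      equality of the two images.\<close>
    have le01: "\<not> i1 x \<epsilon> i0 x"
      using jj_le_j[OF F iM[OF \<eta>(1)] ordi[OF \<eta>]] kj not_self not_cycle2
      unfolding i0x i1x k_def by metis

    \<comment> \<open>Members of \<open>\<eta>\<close> lie in the transitive class
      \<open>M F\<close>, so the witness may range over the universe; this gives the condition on
      \<open>c\<close> a definable form. The ordinal \<open>\<eta>\<close> satisfies it, so a least
      \<open>c\<close> exists.\<close>
    have below_iff: "\<not> i c \<epsilon> \<eta> \<longleftrightarrow> \<not> (\<exists>y. emb_rel (Ult UNIV F) E c y \<and> y \<epsilon> \<eta>)" if "c \<in> M F" for c
      unfolding i_def using emb_rel_iff(1)[OF g1 E that] emb_in_N[OF g1 E that] inner_model_trans[OF g1 \<eta>(1)] by blast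
    have "vdef (\<lambda>\<rho>. \<rho> 0 \<in> M F \<and> \<not> (\<exists>y. emb_rel (Ult UNIV F) E (\<rho> 0) y \<and> y \<epsilon> \<eta>))"
      by (intro definable_intros vdef_comp4[where P="\<lambda>F. emb_rel (Ult UNIV F)", OF vdef_udef[OF udef_emb_rel_Ult]]
          vdef_comp2[where P="\<lambda>x F. x \<in> Ult UNIV F", OF vdef_udef[OF udef_in_Ult]])
    from ord_least[where P="\<lambda>c. c \<in> M F \<and> \<not> (\<exists>y. emb_rel (Ult UNIV F) E c y \<and> y \<epsilon> \<eta>)", OF this \<eta>(2)]
    obtain c where c: "ord c" "c \<in> M F" "\<not> i c \<epsilon> \<eta>" "\<And>d. d \<epsilon> c \<Longrightarrow> d \<in> M F \<Longrightarrow> i d \<epsilon> \<eta>"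
      using \<eta>(1) \<eta>i not_cycle2 below_iff by metis
    \<comment> \<open>Ordinals of \<open>M F\<close> below \<open>c\<close> are sent below
      \<open>\<eta>\<close>, but \<open>\<eta>\<close> is sent above itself.\<close>
    have cle: "\<not> \<eta> \<epsilon> c" using c(4) \<eta>(1) \<eta>i not_cycle2 by blast
    have jcN: "j F c \<in> N" by (rule jN[OF c(2)])

    have below: "i1 d \<epsilon> x" if d: "d \<epsilon> j F c" for d
    proof -
      define P where "P N F E c h \<longleftrightarrow> (\<forall>d\<in>Ult N F. \<forall>y\<in>Ult N F. d \<epsilon> c \<and> emb_rel (Ult N F) E d y \<longrightarrow> y \<epsilon> h)"
        for N and F E c h :: 'v
      \<comment> \<open>\<open>Q\<close> is \<open>P\<close> for an abstract class in place of the
        ultrapower; relativizing it by \<open>udef_Ult\<close> inserts \<open>F\<close> as variable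
        0 and shifts the others, which is exactly \<open>P\<close>.\<close>
      define Q where "Q N \<rho> \<longleftrightarrow> (\<forall>d\<in>N. \<forall>y\<in>N. d \<epsilon> \<rho> (Suc 0) \<and> emb_rel N (\<rho> 0) d y \<longrightarrow> y \<epsilon> \<rho> (Suc (Suc 0)))"
        for N and \<rho> :: "nat \<Rightarrow> 'v"
      have "udef Q" unfolding Q_def by (intro udef_intros udef_emb_rel)
      from udef_Ult[OF this]
      have "udef (\<lambda>N \<rho>. P N (\<rho> 0) (\<rho> (Suc 0)) (\<rho> (Suc (Suc 0))) (\<rho> (Suc (Suc (Suc 0)))))"
        unfolding Q_def P_def .
      from emb_elem4[where P=P, OF e this, of F E c \<eta>]
      have "P UNIV F E c \<eta> \<longleftrightarrow> P (M F) (j F F) E1 (j F c) x" unfolding E1_def x_def by blast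
      moreover have "P UNIV F E c \<eta>"
        unfolding P_def using c(4) emb_rel_iff(1)[OF g1 E] unfolding i_def by blast
      ultimately have *: "\<forall>d\<in>N. \<forall>y\<in>N. d \<epsilon> j F c \<and> emb_rel N E1 d y \<longrightarrow> y \<epsilon> x"
        unfolding P_def N_def by blast
      have dN: "d \<in> N" by (rule inner_model_trans[OF g2 jcN d])
      then show ?thesis using * d emb_rel_iff(1)[OF g2 E1 dN i1N[OF dN]] i1N[OF dN] unfolding i1_def by blast
    qed

    \<comment> \<open>Instead of transporting the leastness of \<open>j F c\<close>, it suffices to
      transport \<open>below\<close> and to apply the result to \<open>x\<close>. The assumption
      \<open>x \<epsilon> i0 (j F c)\<close> also places \<open>x\<close> in the domain
      \<open>N0\<close> on which the two classes of pairs are compared.\<close>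
    have i0c: "\<not> x \<epsilon> i0 (j F c)"
    proof
      assume xi: "x \<epsilon> i0 (j F c)"
      define N0 where "N0 = Ult N E0"
      have g3: "inner_model N0" unfolding N0_def by (rule inner_model_Ult[OF g2 E0])
      have x0: "x \<in> N0"
        using inner_model_trans[OF g3 _ xi] emb_in_Ult[OF g2 E0 jcN] unfolding N0_def i0_def by blast
      have pN: "opair x (i1 x) \<in> N" by (rule inner_model_pair(1)[OF g2 xN(1) i1N[OF xN(1)]])
      \<comment> \<open>The pair is first placed in the restricted graph of \<open>i1\<close>;
        commutation then places it in the image of the full graph, hence in \<open>i0 s\<close> for
        a set \<open>s\<close> of \<open>N\<close>.\<close>
      have "opair x (i1 x) \<in> graph N N0 i1"
        unfolding graph_def using x0 pN inner_model_pair(2)[OF g2 xN(1) i1N[OF xN(1)] pN] by blast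
      moreover have "class_image N i0 (graph N N i1) = graph N N0 i1"
        using assms(4) unfolding commute_def M2 jjE i0_def i1_def E1_def N0_def by blast
      ultimately obtain X s where s: "X \<in> N" "s \<in> N" "\<And>z. z \<in> N \<Longrightarrow> z \<epsilon> s \<longleftrightarrow> z \<in> graph N N i1 \<and> z \<epsilon> X"
        "opair x (i1 x) \<epsilon> i0 s" unfolding class_image_def by blast
      have p0: "opair x (i1 x) \<in> N0"
        using inner_model_trans[OF g3 _ s(4)] emb_in_Ult[OF g2 E0 s(2)] unfolding N0_def i0_def by blast
      have "upair x (i1 x) \<epsilon> opair x (i1 x)" "i1 x \<epsilon> upair x (i1 x)" unfolding opair_def by simp_all
      then have i10: "i1 x \<in> N0" using inner_model_trans[OF g3] p0 by blast
      define R where "R N s c x \<longleftrightarrow> (\<forall>p\<in>N. \<forall>u\<in>N. \<forall>v\<in>N. p \<epsilon> s \<and> is_pair N u v p \<and> u \<epsilon> c \<longrightarrow> v \<epsilon> x)"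
        for N and s c x :: 'v
      have R: "udef (\<lambda>N \<rho>. R N (\<rho> 0) (\<rho> (Suc 0)) (\<rho> (Suc (Suc 0))))"
        unfolding R_def by (intro udef_intros udef_is_pair)
      \<comment> \<open>\<open>i0 s\<close> is a piece of the graph of \<open>i1\<close>, so \<open>i0\<close> carries \<open>R\<close> to a statement about \<open>i1\<close> itself.\<close>
      have "R N s (j F c) x" unfolding R_def
      proof (intro ballI impI)
        fix p u v assume p: "p \<in> N" "u \<in> N" "v \<in> N" "p \<epsilon> s \<and> is_pair N u v p \<and> u \<epsilon> j F c"
        then have "p = opair u v" using inner_model_pair(2)[OF g2] by blast
        moreover obtain w where w: "w \<in> N" "is_pair N w (i1 w) p"
          using p s(3)[OF p(1)] unfolding graph_def by blast
        then have "p = opair w (i1 w)" using inner_model_pair(2)[OF g2 w(1) i1N[OF w(1)] p(1)] by blast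
        ultimately have "v = i1 u" by auto
        then show "v \<epsilon> x" using below p(4) by blast
      qed
      then have "R N0 (i0 s) (i0 (j F c)) (i0 x)"
        using emb_elem3[where P=R, OF g2 E0 R s(2) jcN xN(1)] unfolding N0_def i0_def by blast
      then have "i1 x \<epsilon> i0 x"
        unfolding R_def using p0 x0 i10 s(4) xi inner_model_pair(2)[OF g3 x0 i10 p0] by blast
      then show False using le01 by blast
    qed

    have kc: "\<not> i0 (k c) \<epsilon> x"
    proof -
      have "\<eta> = i c \<or> \<eta> \<epsilon> i c" using ord_linear[OF \<eta>(2) ordi[OF c(2,1)]] c(3) by blast
      then have "x = k (i c) \<or> x \<epsilon> k (i c)" unfolding xk using k_mem[OF \<eta>(1) iM[OF c(2)]] by blast
      then show ?thesis unfolding i0k[OF c(2)] using not_self not_cycle2 by blast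
    qed
    have ord_i0c: "ord (i0 (j F c))" unfolding i0_def by (rule emb_ord[OF g2 E0 jcN ordj[OF c(1)]])
    have "\<not> k c \<epsilon> j F c"
    proof
      assume "k c \<epsilon> j F c"
      then have "i0 (k c) \<epsilon> i0 (j F c)" unfolding i0_def using emb_mem[OF g2 E0 kN[OF c(2)] jcN] by blast
      moreover have "i0 (j F c) = x \<or> i0 (j F c) \<epsilon> x" using ord_linear[OF ord_i0c xN(2)] i0c by blast
      ultimately have "i0 (k c) \<epsilon> x" using ord_trans[OF xN(2)] by blast
      then show False using kc by blast
    qed
    then obtain \<zeta> where \<zeta>: "ord \<zeta>" "c = j F \<zeta>"
      using jj_le_j[OF F c(2,1)] unfolding k_def by blast
    consider "\<zeta> \<epsilon> \<xi>" | "\<zeta> = \<xi>" | "\<xi> \<epsilon> \<zeta>" using ord_linear[OF \<zeta>(1) \<xi>(1)] by blast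
    then show False
    proof cases
      case 1
      then have "j F \<zeta> \<epsilon> \<eta>" unfolding \<eta>_def using emb_mem[OF e, of \<zeta> \<xi>] by blast
      then show False using \<xi>(3)[OF 1] c(3) \<zeta>(2) by simp
    next
      case 2
      then have "j F c = x" unfolding x_def \<eta>_def \<zeta>(2) by simp
      then show False using i0c x_lt by simp
    next
      case 3
      then have "\<eta> \<epsilon> c" unfolding \<eta>_def \<zeta>(2) using emb_mem[OF e, of \<xi> \<zeta>] by blast
      then show False using cle by blast
    qed
  qed
qed

end
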